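(* Let $p\in\mathbb N=\{1,2,\dots\}$. The map $B^-:\mathcal B(\mathcal H_{(0,p)})\to C^\infty_{\mathbb C}(\mathbb CP^2)$, $A\mapsto B^-_A$, with $$B^-_A(\mathrm x)=\langle\Phi_p\circ\theta(\mathbf n)\,|\,A\,\Phi_p\circ\theta(\mathbf n)\rangle$$ for $\mathrm x\in\mathbb CP^2$ and $\mathbf n\in S^5\subset\mathbb C^3$ related by $[\mathbf n]=\mathrm x$, is a mapping-positive symbol correspondence whose operator kernel is the projection $\Pi_{(0,p,p)}$ onto the lowest weight space of $(0,p)$ and whose characteristic numbers are $$b_{n-}=(-1)^p\sqrt{\frac{\dim(0,p)}{(n+1)^3}}\;C^{(0,p),\,(p,0),\,n}_{(0,p,p),\,(p,0,0),\,(n,n,n)0}\,.$$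
   Context: Representations. In a representation of $SU(3)$ (extended to $\mathfrak{sl}(3,\mathbb C)$) let $T_+,T_-,T_3,U_+,U_-,U_3$ be the images of $E_{12},E_{21},\tfrac12(E_{11}-E_{22}),E_{23},E_{32},\tfrac12(E_{22}-E_{33})$. For $\boldsymbol p=(p,q)\in\mathbb N_0^2$, "the irrep $\boldsymbol p$" is the unitary irrep on $\mathcal H_{\boldsymbol p}$ whose highest weight vector has eigenvalue $p/2$ for $T_3$ and $q/2$ for $U_3$; $\dim(\boldsymbol p)=\frac{(p+1)(q+1)(p+q+2)}2$, $|\boldsymbol p|=p+q$, $\check{\boldsymbol p}=(q,p)$ (the dual irrep). Inner products are linear in the second entry. Gelfand-Tsetlin (GT) basis: an orthonormal basis $\{\boldsymbol e(\boldsymbol p;\boldsymbol\nu,J)\}$ indexed by $\boldsymbol\nu=(\nu_1,\nu_2,\nu_3)$ and $J$ where, for integers $0\le r_-\le q\le r_+\le p+q$ and $r_-\le\nu_3\le r_+$: $\nu_1=p+2q-(r_++r_-)$, $\nu_2=r_++r_--\nu_3$, $J=\frac12(r_+-r_-)$. Put $t_{\boldsymbol\nu}=\frac{\nu_1-\nu_2}2$, $u_{\boldsymbol\nu}=\frac{\nu_2-\nu_3}2$ (the eigenvalues of $T_3,U_3$). The basis is determined by a unit highest weight vector $\boldsymbol e(\boldsymbol p;(p+q,q,0),q/2)$ via, with $u=u_{\boldsymbol\nu}$, $U_-\boldsymbol e(\boldsymbol p;\boldsymbol\nu,J)=\sqrt{(J+u)(J-u+1)}\,\boldsymbol e(\boldsymbol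 p;(\nu_1,\nu_2-1,\nu_3+1),J)$ and $T_-\boldsymbol e(\boldsymbol p;\boldsymbol\nu,J)=\sqrt{\tfrac{(J-u)(p+q+J-u-\nu_3+1)(q+J-u-\nu_3)(u-J+\nu_3+1)}{2J(2J+1)}}\,\boldsymbol e(\boldsymbol p;(\nu_1-1,\nu_2+1,\nu_3),J-\tfrac12)+\sqrt{\tfrac{(J+u+1)(p+q-J-u-\nu_3)(J+u+1+\nu_3-q)(J+u+2+\nu_3)}{2(J+1)(2J+1)}}\,\boldsymbol e(\boldsymbol p;(\nu_1-1,\nu_2+1,\nu_3),J+\tfrac12)$ (terms with zero numerator are $0$). For $\boldsymbol p=(p,0)$ or $(0,p)$, $J$ is determined by $\boldsymbol\nu$ and is omitted. For a GT label $\boldsymbol\nu$ of $\boldsymbol p$ put $\check{\boldsymbol\nu}=(|\boldsymbol p|,|\boldsymbol p|,|\boldsymbol p|)-\boldsymbol\nu$. The induced GT basis of $\mathcal H_{\check{\boldsymbol p}}=\mathcal H_{\boldsymbol p}^*$ is $\check{\boldsymbol e}(\check{\boldsymbol p};\check{\boldsymbol\nu},J)=(-1)^{2(t_{\boldsymbol\nu}+u_{\boldsymbol\nu})}\boldsymbol e^*(\boldsymbol p;\boldsymbol\nu,J)$. Coupled basis. For $\boldsymbol p=(p,0)$ or $(0,p)$, $\mathcal B(\mathcal H_{\boldsymbol p})\simeq\mathcal H_{\boldsymbol p}\otimes\mathcal H_{\boldsymbol p}^*=\bigoplus_{n=0}^p(n,n)$ under $A^g=\rho(g)A\rho(g)^{-1}$,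 with inner product $\operatorname{tr}(A^\dagger B)$; $\{\boldsymbol e(n;\boldsymbol\nu,J)\}$ is the union of GT bases of the summands $(n,n)$, with phases such that all Clebsch-Gordan coefficients $C^{\boldsymbol p,\check{\boldsymbol p},n}_{\boldsymbol\nu_1,\boldsymbol\nu_2,\boldsymbol\nu J}=\langle\boldsymbol e(n;\boldsymbol\nu,J)|\boldsymbol e(\boldsymbol p;\boldsymbol\nu_1)\otimes\check{\boldsymbol e}(\check{\boldsymbol p};\boldsymbol\nu_2)\rangle$ are real and $\boldsymbol e(0;(0,0,0),0)=\mathds 1/\sqrt{\dim\boldsymbol p}$. Symbol correspondences. $\mathbb CP^2\simeq SU(3)/H$, $H=\{\mathrm{diag}(\det(U)^{-1},U):U\in U(2)\}$ the isotropy group of $\mathrm x_0=[1:0:0]$, with the invariant integral of total mass $1$. A symbol correspondence $W:\mathcal B(\mathcal H_{\boldsymbol p})\to C^\infty_{\mathbb C}(\mathbb CP^2)$ is an injective linear map with: (1) $W_{A^g}=(W_A)^g$, where $f^g(\mathrm x)=f(g^{-1}\mathrm x)$; (2) $W_{A^\dagger}=\overline{W_A}$; (3) $\int W_A\,d\mathrm x=\operatorname{tr}(A)/\dim(\boldsymbol p)$. Each has a unique operator kernel $K$, fixed by $H$, with $W_A(g\mathrm x_0)=\operatorname{tr}(AK^g)$, and $K=\sum_{n=0}^pc_n\sqrt{(n+1)^3/\dim(\boldsymbol p)}\,\boldsymbol e(n;(n,n,n),0)$ with $c_0=1$, $c_n\in\mathbb R^\times$; the $c_n$ are its characteristic numbers.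 $W$ is mapping-positive if it maps positive (semidefinite) operators to everywhere $\ge0$ functions and positive-definite operators to everywhere $>0$ functions. The maps $\Phi_p$ and $\theta$. $\mathcal H_{(0,1)}=(\mathbb C^3)^*$ is the dual of the defining representation, with orthonormal basis $\check e_1=-e_3^*$, $\check e_2=e_2^*$, $\check e_3=-e_1^*$; $\mathcal H_{(0,p)}=\mathrm{Sym}^p((\mathbb C^3)^* )$ with the induced inner product and action $\check\rho_p$, identified with $\mathbb C^{(p+1)(p+2)/2}$ via the orthonormal basis $\{\check e_{j,k,l}:j+k+l=p\}$ of normalized symmetrizations of $\check e_1^{\otimes j}\otimes\check e_2^{\otimes k}\otimes\check e_3^{\otimes l}$. In these coordinates $\Phi_p(z_1,z_2,z_3)=\sum_{j+k+l=p}\sqrt{\frac{p!}{j!k!l!}}\,z_1^jz_2^kz_3^l\,\check e_{j,k,l}$, and $\theta:\mathbb C^3\to\mathbb C^3$, $\theta(z_1,z_2,z_3)=(-\overline{z_3},\overline{z_2},-\overline{z_1})$. $S^5\subset\mathbb C^3$ is the unit sphere and $\mathbf n\mapsto[\mathbf n]$ the canonical projection to $\mathbb CP^2$. *)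

theory Defs
  imports "HOL-Analysis.Analysis" "HOL-Combinatorics.Permutations"
begin

section \<open>The group, its Lie algebra and the complex projective plane\<close>

definition cadjoint :: "complex^'n^'m \<Rightarrow> complex^'m^'n" where
  "cadjoint A = (\<chi> i j. cnj (A $ j $ i))"

definition unitary_group :: "(complex^'n^'n) set" where
  "unitary_group = {g. cadjoint g ** g = mat 1 \<and> g ** cadjoint g = mat 1}"

definition SU3 :: "(complex^3^3) set" where
  "SU3 = {g \<in> unitary_group. det g = 1}"

definition isotropy_group :: "(complex^3^3) set" where
  "isotropy_group =
     {vector [vector [inverse (det U), 0, 0],
              vector [0, U $ 1 $ 1, U $ 1 $ 2],
              vector [0, U $ 2 $ 1, U $ 2 $ 2]] | U :: complex^2^2. U \<in> unitary_group}"

definition mexp :: "complex^'n^'n \<Rightarrow> complex^'n^'n" where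
  "mexp X = (\<Sum>k. (1 / fact k) *\<^sub>R (((**) X) ^^ k) (mat 1))"

definition matrix_unit :: "3 \<Rightarrow> 3 \<Rightarrow> complex^3^3" where
  "matrix_unit a b = (\<chi> i j. if i = a \<and> j = b then 1 else 0)"

quotient_type cp2 = "complex^3" / partial: "\<lambda>x y. x \<noteq> 0 \<and> y \<noteq> 0 \<and> (\<exists>c. y = c *s x)"
proof (rule part_equivpI)
  show "\<exists>x::complex^3. x \<noteq> 0 \<and> x \<noteq> 0 \<and> (\<exists>c. x = c *s x)"
    by (rule exI[of _ "axis 1 1"]) (auto simp: axis_eq_0_iff intro!: exI[of _ 1])
  show "symp (\<lambda>x y::complex^3. x \<noteq> 0 \<and> y \<noteq> 0 \<and> (\<exists>c. y = c *s x))"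
  proof (rule sympI)
    fix x y :: "complex^3"
    assume a: "x \<noteq> 0 \<and> y \<noteq> 0 \<and> (\<exists>c. y = c *s x)"
    then obtain c where c: "y = c *s x" by auto
    with a have "c \<noteq> 0" by auto
    with c have "x = inverse c *s y" by (simp add: vector_smult_assoc)
    with a show "y \<noteq> 0 \<and> x \<noteq> 0 \<and> (\<exists>c. x = c *s y)" by auto
  qed
  show "transp (\<lambda>x y::complex^3. x \<noteq> 0 \<and> y \<noteq> 0 \<and> (\<exists>c. y = c *s x))"
    by (rule transpI) (auto simp: vector_smult_assoc)
qed

abbreviation proj :: "complex^3 \<Rightarrow> cp2" where
  "proj \<equiv> abs_cp2"

definition act :: "complex^3^3 \<Rightarrow> cp2 \<Rightarrow> cp2" where
  "act g x = proj (g *v rep_cp2 x)"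

definition base_point :: cp2 where
  "base_point = proj (vector [1, 0, 0])"

lemma proj_eq_iff:
  assumes "m \<noteq> 0" "n \<noteq> 0"
  shows "proj m = proj n \<longleftrightarrow> (\<exists>c. n = c *s m)"
  using Quotient3_rel[OF Quotient3_cp2, of m n] assms
  by (metis vector_smult_lid)

lemma rep_cp2_nonzero: "rep_cp2 x \<noteq> 0"
  using Quotient3_rep_reflp[OF Quotient3_cp2, of x] by blast

lemma proj_rep_cp2: "proj (rep_cp2 x) = x"
  by (rule Quotient3_abs_rep[OF Quotient3_cp2])

lemma SU3_mult_nonzero:
  assumes "g \<in> SU3" "n \<noteq> 0"
  shows "g *v n \<noteq> 0"
proof
  assume "g *v n = 0"
  then have "cadjoint g *v (g *v n) = 0" by simp
  then show False
    using assms by (simp add: matrix_vector_mul_assoc SU3_def unitary_group_def)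
qed

lemma act_proj:
  assumes g: "g \<in> SU3" and n: "n \<noteq> 0"
  shows "act g (proj n) = proj (g *v n)"
proof -
  have "proj (rep_cp2 (proj n)) = proj n" by (rule proj_rep_cp2)
  then obtain c where c: "n = c *s rep_cp2 (proj n)"
    using proj_eq_iff[OF rep_cp2_nonzero n] by auto
  have "g *v n = c *s (g *v rep_cp2 (proj n))"
    by (subst c) (simp add: vec_eq_iff matrix_vector_mult_def sum_distrib_left algebra_simps)
  then show ?thesis
    unfolding act_def
    using proj_eq_iff[OF SU3_mult_nonzero[OF g rep_cp2_nonzero] SU3_mult_nonzero[OF g n]] by auto
qed

text \<open>Smoothness is in the real sense; a function on the projective plane is smooth iff it is so
  in the three standard affine charts.\<close>

primrec Ck :: "nat \<Rightarrow> ('a::real_normed_vector \<Rightarrow> 'b::real_normed_vector) \<Rightarrow> bool" where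
  "Ck 0 f \<longleftrightarrow> continuous_on UNIV f"
| "Ck (Suc k) f \<longleftrightarrow>
     f differentiable_on UNIV \<and> (\<forall>v. Ck k (\<lambda>x. frechet_derivative f (at x) v))"

definition smooth_cp2 :: "(cp2 \<Rightarrow> complex) \<Rightarrow> bool" where
  "smooth_cp2 f \<longleftrightarrow> (\<forall>k.
     Ck k (\<lambda>(w1, w2). f (proj (vector [1, w1, w2]))) \<and>
     Ck k (\<lambda>(w1, w2). f (proj (vector [w1, 1, w2]))) \<and>
     Ck k (\<lambda>(w1, w2). f (proj (vector [w1, w2, 1]))))"

text \<open>The invariant integral of total mass 1: the image of the uniform distribution on the unit
  ball (the origin is a null set). Mass and invariance are proved in
  \<open>cp2_integral_one\<close> and \<open>cp2_integral_invariant\<close> below.\<close>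

definition cp2_integral :: "(cp2 \<Rightarrow> complex) \<Rightarrow> complex" where
  "cp2_integral f =
     (LINT z:ball (0 :: complex^3) 1|lborel. f (proj z)) / measure lborel (ball (0 :: complex^3) 1)"

lemma cp2_integral_one: "cp2_integral (\<lambda>_. 1) = 1"
proof -
  have "measure lborel (ball (0 :: complex^3) 1) \<noteq> 0"
    using content_ball_pos[of 1 "0 :: complex^3"] by simp
  moreover have "(LINT z:ball (0 :: complex^3) 1|lborel. (1 :: complex)) =
      of_real (measure lborel (ball (0 :: complex^3) 1))"
    using emeasure_lborel_ball_finite[of "0 :: complex^3" 1]
    by (subst set_integral_const) (auto simp: scaleR_conv_of_real)
  ultimately show ?thesis by (simp add: cp2_integral_def)
qed

lemma isometry_emeasure_mono:
  fixes T :: "'a::euclidean_space \<Rightarrow> 'a"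
  assumes iso: "\<And>x y. dist (T x) (T y) = dist x y" and "bij T" and "open U" "open (T ` U)"
  shows "emeasure lborel U \<le> emeasure lborel (T ` U)"
proof -
  have ball: "T ` ball x r = ball (T x) r" for x r
  proof
    show "ball (T x) r \<subseteq> T ` ball x r"
    proof
      fix y assume y: "y \<in> ball (T x) r"
      obtain z where "y = T z" using \<open>bij T\<close> by (metis bij_pointE)
      then show "y \<in> T ` ball x r" using y iso by auto
    qed
  qed (use iso in auto)
  define K where "K = {(x, r). x \<in> U \<and> 0 < r \<and> ball x r \<subseteq> U}"
  obtain C where C: "countable C" "C \<subseteq> K"
    and disj: "pairwise (\<lambda>i j. disjnt (ball (fst i) (snd i)) (ball (fst j) (snd j))) C"
    and neg: "negligible (U - (\<Union>i\<in>C. ball (fst i) (snd i)))"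
  proof (rule Vitali_covering_theorem_balls[of U K fst snd])
    fix x and d :: real assume "x \<in> U" "0 < d"
    then obtain e where e: "e > 0" "ball x e \<subseteq> U"
      using \<open>open U\<close> open_contains_ball by blast
    then show "\<exists>i. i \<in> K \<and> x \<in> ball (fst i) (snd i) \<and> snd i < d"
      using \<open>0 < d\<close> \<open>x \<in> U\<close>
      by (intro exI[of _ "(x, min e (d/2))"]) (auto simp: K_def subset_iff)
  qed blast
  let ?V = "\<Union>i\<in>C. ball (fst i) (snd i)"
  have V: "?V \<in> sets lborel" using C(1) by (auto intro!: sets.countable_UN')
  have null: "U - ?V \<in> null_sets lborel"
  proof -
    have "U - ?V \<in> sets borel" using \<open>open U\<close> V by auto
    then show ?thesis
      using neg by (simp add: negligible_iff_null_sets null_sets_completion_iff)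
  qed
  have "emeasure lborel U \<le> emeasure lborel (?V \<union> (U - ?V))"
    using \<open>open U\<close> V by (intro emeasure_mono) auto
  also have "\<dots> = emeasure lborel ?V"
    using null V by (intro emeasure_Un_null_set) auto
  also have "\<dots> = (\<integral>\<^sup>+ i. emeasure lborel (ball (fst i) (snd i)) \<partial>count_space C)"
    using disj by (intro emeasure_UN_countable)
      (auto simp: C(1) disjoint_family_on_def pairwise_def disjnt_def)
  also have "\<dots> = (\<integral>\<^sup>+ i. emeasure lborel (ball (T (fst i)) (snd i)) \<partial>count_space C)"
  proof (intro nn_integral_cong)
    fix i assume "i \<in> space (count_space C)"
    then have "0 \<le> snd i" using C(2) by (auto simp: K_def)
    then show "emeasure lborel (ball (fst i) (snd i)) = emeasure lborel (ball (T (fst i)) (snd i))"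
      by (simp add: emeasure_ball)
  qed
  also have "\<dots> = emeasure lborel (\<Union>i\<in>C. ball (T (fst i)) (snd i))"
  proof (intro emeasure_UN_countable[symmetric])
    show "disjoint_family_on (\<lambda>i. ball (T (fst i)) (snd i)) C"
      unfolding disjoint_family_on_def ball[symmetric]
      using disj bij_is_inj[OF \<open>bij T\<close>]
      by (auto simp: pairwise_def disjnt_def image_Int[symmetric])
  qed (auto simp: C(1))
  also have "\<dots> \<le> emeasure lborel (T ` U)"
  proof (intro emeasure_mono UN_least)
    fix i assume "i \<in> C"
    then have "ball (fst i) (snd i) \<subseteq> U" using C(2) unfolding K_def by fastforce
    then show "ball (T (fst i)) (snd i) \<subseteq> T ` U" unfolding ball[symmetric] by (rule image_mono)
  qed (use \<open>open (T ` U)\<close> in auto)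
  finally show ?thesis .
qed

lemma distr_lborel_isometry:
  fixes T :: "'a::euclidean_space \<Rightarrow> 'a"
  assumes iso: "\<And>x y. dist (T x) (T y) = dist x y" and bij: "bij T"
  shows "distr lborel borel T = lborel"
proof -
  have cont: "continuous_on UNIV T"
    unfolding continuous_on_iff using iso by metis
  have iso': "dist (inv T x) (inv T y) = dist x y" for x y
    using iso[of "inv T x" "inv T y"] bij by (simp add: bij_is_surj surj_f_inv_f)
  have cont': "continuous_on UNIV (inv T)"
    unfolding continuous_on_iff using iso' by metis
  have meas: "T \<in> borel_measurable borel"
    using cont by (rule borel_measurable_continuous_onI)
  have eq: "emeasure (distr lborel borel T) U = emeasure lborel U" if "open U" for U
  proof -
    have inv: "T -` U = inv T ` U" using bij by (simp add: bij_vimage_eq_inv_image)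
    have o: "open (T -` U)" using cont \<open>open U\<close> by (simp add: open_vimage)
    have "T ` (T -` U) = U" using bij by (simp add: bij_is_surj surj_image_vimage_eq)
    then have "emeasure lborel (T -` U) \<le> emeasure lborel U"
      using isometry_emeasure_mono[OF iso bij o] \<open>open U\<close> by simp
    moreover have "emeasure lborel U \<le> emeasure lborel (T -` U)"
      using isometry_emeasure_mono[OF iso' bij_imp_bij_inv[OF bij] \<open>open U\<close>] o by (simp add: inv)
    ultimately show ?thesis
      using meas \<open>open U\<close> by (simp add: emeasure_distr)
  qed
  show ?thesis
  proof (rule sym, rule lborel_eqI)
    fix l u :: 'a
    assume le: "\<And>b. b \<in> Basis \<Longrightarrow> l \<bullet> b \<le> u \<bullet> b"
    show "emeasure (distr lborel borel T) (box l u) = (\<Prod>b\<in>Basis. (u - l) \<bullet> b)"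
      using eq[OF open_box, of l u] emeasure_lborel_box[of l u, OF le] by simp
  qed simp
qed

lemma norm_SU3:
  assumes "g \<in> SU3"
  shows "norm (g *v z) = norm z"
proof -
  have sq: "complex_of_real ((norm v)\<^sup>2) = (\<Sum>i\<in>UNIV. cnj (v $ i) * v $ i)" for v :: "complex^3"
    by (simp add: norm_vec_def L2_set_def sum_nonneg complex_norm_square mult.commute
        flip: of_real_power)
  have adj: "(\<Sum>i\<in>UNIV. cnj ((g *v v) $ i) * w $ i) = (\<Sum>i\<in>UNIV. cnj (v $ i) * (cadjoint g *v w) $ i)"
    for v w :: "complex^3"
    by (simp add: matrix_vector_mult_def cadjoint_def sum_3 algebra_simps)
  have "complex_of_real ((norm (g *v z))\<^sup>2) = complex_of_real ((norm z)\<^sup>2)"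
    unfolding sq adj using assms
    by (simp add: matrix_vector_mul_assoc SU3_def unitary_group_def)
  then show ?thesis by (simp only: of_real_eq_iff) simp
qed

lemma cp2_integral_invariant:
  assumes g: "g \<in> SU3" and f: "(\<lambda>z. f (proj z)) \<in> borel_measurable borel"
  shows "cp2_integral (\<lambda>x. f (act g x)) = cp2_integral f"
proof -
  let ?T = "\<lambda>z. g *v z"
  have iso: "dist (?T x) (?T y) = dist x y" for x y
    using norm_SU3[OF g, of "x - y"] by (simp add: dist_norm matrix_vector_mult_diff_distrib)
  have "g *v (cadjoint g *v z) = z" "cadjoint g *v (g *v z) = z" for z
    using g by (simp_all add: matrix_vector_mul_assoc SU3_def unitary_group_def)
  then have bij: "bij ?T" by (intro o_bij[of "\<lambda>z. cadjoint g *v z"]) (auto simp: fun_eq_iff)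
  have T: "?T \<in> borel_measurable borel"
    by (rule borel_measurable_continuous_onI) (use iso in \<open>auto simp: continuous_on_iff\<close>)
  let ?F = "\<lambda>z. indicator (ball 0 1) z *\<^sub>R f (proj z)"
  have "(LINT z:ball (0 :: complex^3) 1|lborel. f (proj z)) = integral\<^sup>L (distr lborel borel ?T) ?F"
    by (simp add: distr_lborel_isometry[OF iso bij] set_lebesgue_integral_def)
  also have "\<dots> = (LINT z|lborel. ?F (?T z))"
    using T f by (intro integral_distr borel_measurable_scaleR borel_measurable_indicator) auto
  also have "\<dots> = (LINT z|lborel. indicator (ball 0 1) z *\<^sub>R f (act g (proj z)))"
  proof (rule integral_cong_AE)
    show m: "(\<lambda>z. ?F (?T z)) \<in> borel_measurable lborel"
    proof -
      have "?F \<in> borel_measurable borel"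
        using f by (intro borel_measurable_scaleR borel_measurable_indicator) auto
      from measurable_compose[OF T this] show ?thesis by simp
    qed
    have ae: "?F (?T z) = indicator (ball 0 1) z *\<^sub>R f (act g (proj z))" if "z \<noteq> 0" for z
      using that g by (simp add: act_proj norm_SU3 indicator_def)
    then show "AE z in lborel. ?F (?T z) = indicator (ball 0 1) z *\<^sub>R f (act g (proj z))"
      by (intro AE_I[where N = "{0}"]) auto
    have "(\<lambda>z. if z = 0 then f (act g (proj 0)) else ?F (?T z)) \<in> borel_measurable lborel"
      using m by (intro measurable_If) auto
    also have "(\<lambda>z. if z = 0 then f (act g (proj 0)) else ?F (?T z)) =
        (\<lambda>z. indicator (ball 0 1) z *\<^sub>R f (act g (proj z)))"
      using ae by (auto simp: fun_eq_iff)
    finally show "(\<lambda>z. indicator (ball 0 1) z *\<^sub>R f (act g (proj z))) \<in> borel_measurable lborel" .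
  qed
  finally show ?thesis by (simp add: cp2_integral_def set_lebesgue_integral_def)
qed


section \<open>Finite-dimensional Hilbert spaces and operators in coordinates\<close>

text \<open>For a finite index set \<open>I\<close>, the Hilbert space with orthonormal basis \<open>I\<close> is
  modelled by the functions vanishing outside \<open>I\<close>, and its operators by matrices, that is,
  functions vanishing outside \<open>I \<times> I\<close>.\<close>

definition cspace :: "'i set \<Rightarrow> ('i \<Rightarrow> complex) set" where
  "cspace I = {v. \<forall>i. i \<notin> I \<longrightarrow> v i = 0}"

definition cinner :: "'i set \<Rightarrow> ('i \<Rightarrow> complex) \<Rightarrow> ('i \<Rightarrow> complex) \<Rightarrow> complex" where
  "cinner I v w = (\<Sum>i\<in>I. cnj (v i) * w i)"

abbreviation ops :: "'i set \<Rightarrow> ('i \<times> 'i \<Rightarrow> complex) set" where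
  "ops I \<equiv> cspace (I \<times> I)"

definition op_apply :: "'i set \<Rightarrow> ('i \<times> 'i \<Rightarrow> complex) \<Rightarrow> ('i \<Rightarrow> complex) \<Rightarrow> 'i \<Rightarrow> complex" where
  "op_apply I A v = (\<lambda>i. \<Sum>j\<in>I. A (i, j) * v j)"

definition op_mult ::
  "'i set \<Rightarrow> ('i \<times> 'i \<Rightarrow> complex) \<Rightarrow> ('i \<times> 'i \<Rightarrow> complex) \<Rightarrow> 'i \<times> 'i \<Rightarrow> complex" where
  "op_mult I A B = (\<lambda>(i, k). \<Sum>j\<in>I. A (i, j) * B (j, k))"

definition op_id :: "'i set \<Rightarrow> 'i \<times> 'i \<Rightarrow> complex" where
  "op_id I = (\<lambda>(i, j). if i \<in> I \<and> i = j then 1 else 0)"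

definition op_adj :: "('i \<times> 'i \<Rightarrow> complex) \<Rightarrow> 'i \<times> 'i \<Rightarrow> complex" where
  "op_adj A = (\<lambda>(i, j). cnj (A (j, i)))"

definition op_trace :: "'i set \<Rightarrow> ('i \<times> 'i \<Rightarrow> complex) \<Rightarrow> complex" where
  "op_trace I A = (\<Sum>i\<in>I. A (i, i))"

definition op_inner ::
  "'i set \<Rightarrow> ('i \<times> 'i \<Rightarrow> complex) \<Rightarrow> ('i \<times> 'i \<Rightarrow> complex) \<Rightarrow> complex" where
  "op_inner I A B = op_trace I (op_mult I (op_adj A) B)"

definition positive_op :: "'i set \<Rightarrow> ('i \<times> 'i \<Rightarrow> complex) \<Rightarrow> bool" where
  "positive_op I A \<longleftrightarrow> A \<in> ops I \<and>
     (\<forall>v\<in>cspace I. cinner I v (op_apply I A v) \<in> \<real> \<and> 0 \<le> Re (cinner I v (op_apply I A v)))"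

definition positive_definite_op :: "'i set \<Rightarrow> ('i \<times> 'i \<Rightarrow> complex) \<Rightarrow> bool" where
  "positive_definite_op I A \<longleftrightarrow> A \<in> ops I \<and>
     (\<forall>v\<in>cspace I. v \<noteq> (\<lambda>_. 0) \<longrightarrow>
        cinner I v (op_apply I A v) \<in> \<real> \<and> 0 < Re (cinner I v (op_apply I A v)))"

definition orth_projection :: "'i set \<Rightarrow> ('i \<Rightarrow> complex) set \<Rightarrow> 'i \<times> 'i \<Rightarrow> complex" where
  "orth_projection I S = (THE P. P \<in> ops I \<and>
     (\<forall>v\<in>S. op_apply I P v = v) \<and>
     (\<forall>v\<in>cspace I. (\<forall>s\<in>S. cinner I s v = 0) \<longrightarrow> op_apply I P v = (\<lambda>_. 0)))"

text \<open>The derived representation: on the Lie algebra of \<open>SU3\<close> it is the derivative of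
  \<open>\<rho>(exp(tX))\<close> at \<open>t = 0\<close>, and it is extended complex-linearly to all traceless
  matrices through the decomposition into anti-Hermitian parts.\<close>

definition drep_su :: "(complex^3^3 \<Rightarrow> ('i \<Rightarrow> complex) \<Rightarrow> 'i \<Rightarrow> complex) \<Rightarrow>
    complex^3^3 \<Rightarrow> ('i \<Rightarrow> complex) \<Rightarrow> 'i \<Rightarrow> complex" where
  "drep_su \<rho> X v = (\<lambda>i. vector_derivative (\<lambda>t. \<rho> (mexp (t *\<^sub>R X)) v i) (at 0))"

definition drep :: "(complex^3^3 \<Rightarrow> ('i \<Rightarrow> complex) \<Rightarrow> 'i \<Rightarrow> complex) \<Rightarrow>
    complex^3^3 \<Rightarrow> ('i \<Rightarrow> complex) \<Rightarrow> 'i \<Rightarrow> complex" where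
  "drep \<rho> Z v = (\<lambda>i.
     drep_su \<rho> ((1 / 2) *\<^sub>R (Z - cadjoint Z)) v i +
     \<i> * drep_su \<rho> (\<chi> a b. (Z + cadjoint Z) $ a $ b / (2 * \<i>)) v i)"

definition T_plus where "T_plus \<rho> = drep \<rho> (matrix_unit 1 2)"
definition T_minus where "T_minus \<rho> = drep \<rho> (matrix_unit 2 1)"
definition T_three where
  "T_three \<rho> = drep \<rho> ((1 / 2) *\<^sub>R (matrix_unit 1 1 - matrix_unit 2 2))"
definition U_plus where "U_plus \<rho> = drep \<rho> (matrix_unit 2 3)"
definition U_minus where "U_minus \<rho> = drep \<rho> (matrix_unit 3 2)"
definition U_three where
  "U_three \<rho> = drep \<rho> ((1 / 2) *\<^sub>R (matrix_unit 2 2 - matrix_unit 3 3))"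

section \<open>Gelfand-Tsetlin bases\<close>

type_synonym weight = "int \<times> int \<times> int"

fun t_of :: "weight \<Rightarrow> real" where "t_of (\<nu>1, \<nu>2, \<nu>3) = real_of_int (\<nu>1 - \<nu>2) / 2"
fun u_of :: "weight \<Rightarrow> real" where "u_of (\<nu>1, \<nu>2, \<nu>3) = real_of_int (\<nu>2 - \<nu>3) / 2"

definition irrep_dim :: "nat \<Rightarrow> nat \<Rightarrow> real" where
  "irrep_dim p q = real ((p + 1) * (q + 1) * (p + q + 2)) / 2"

definition gt_labels :: "nat \<Rightarrow> nat \<Rightarrow> (weight \<times> real) set" where
  "gt_labels p q =
     {((int p + 2 * int q - (rp + rm), rp + rm - \<nu>3, \<nu>3), real_of_int (rp - rm) / 2) | rm rp \<nu>3.
        0 \<le> rm \<and> rm \<le> int q \<and> int q \<le> rp \<and> rp \<le> int p + int q \<and> rm \<le> \<nu>3 \<and> \<nu>3 \<le> rp}"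

text \<open>\<open>ip\<close> is the inner product of the space carrying \<open>\<rho>\<close>. The family need not
  span that space: the predicate says that it is a Gelfand-Tsetlin basis of a subrepresentation of
  type \<open>(p, q)\<close>. Divisions by \<open>J = 0\<close> only occur with a zero numerator, and values of
  \<open>e\<close> at non-labels only occur with coefficient zero.\<close>

definition gt_family ::
  "(('i \<Rightarrow> complex) \<Rightarrow> ('i \<Rightarrow> complex) \<Rightarrow> complex) \<Rightarrow>
   (complex^3^3 \<Rightarrow> ('i \<Rightarrow> complex) \<Rightarrow> 'i \<Rightarrow> complex) \<Rightarrow> nat \<Rightarrow> nat \<Rightarrow>
   (weight \<Rightarrow> real \<Rightarrow> 'i \<Rightarrow> complex) \<Rightarrow> bool" where
  "gt_family ip \<rho> p q e \<longleftrightarrow>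
     (\<forall>(\<nu>, J)\<in>gt_labels p q. \<forall>(\<nu>', J')\<in>gt_labels p q.
        ip (e \<nu> J) (e \<nu>' J') = (if \<nu> = \<nu>' \<and> J = J' then 1 else 0)) \<and>
     (let h = e (int p + int q, int q, 0) (real q / 2) in
        T_plus \<rho> h = (\<lambda>_. 0) \<and> U_plus \<rho> h = (\<lambda>_. 0) \<and>
        T_three \<rho> h = (\<lambda>i. of_real (real p / 2) * h i) \<and>
        U_three \<rho> h = (\<lambda>i. of_real (real q / 2) * h i)) \<and>
     (\<forall>((\<nu>1, \<nu>2, \<nu>3), J)\<in>gt_labels p q.
        let u = u_of (\<nu>1, \<nu>2, \<nu>3); n3 = real_of_int \<nu>3; p' = real p; q' = real q in
        U_minus \<rho> (e (\<nu>1, \<nu>2, \<nu>3) J) =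
          (\<lambda>i. of_real (sqrt ((J + u) * (J - u + 1))) * e (\<nu>1, \<nu>2 - 1, \<nu>3 + 1) J i) \<and>
        T_minus \<rho> (e (\<nu>1, \<nu>2, \<nu>3) J) =
          (\<lambda>i. of_real (sqrt ((J - u) * (p' + q' + J - u - n3 + 1) * (q' + J - u - n3) *
                    (u - J + n3 + 1) / (2 * J * (2 * J + 1)))) *
                 e (\<nu>1 - 1, \<nu>2 + 1, \<nu>3) (J - 1 / 2) i +
               of_real (sqrt ((J + u + 1) * (p' + q' - J - u - n3) * (J + u + 1 + n3 - q') *
                    (J + u + 2 + n3) / (2 * (J + 1) * (2 * J + 1)))) *
                 e (\<nu>1 - 1, \<nu>2 + 1, \<nu>3) (J + 1 / 2) i))"

section \<open>The irrep \<open>(0, p)\<close> on symmetric tensors over the dual space\<close>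

text \<open>Covectors and tensors over the dual of the defining representation are given by their
  coefficients with respect to the dual standard basis and its tensor products; a word of length
  \<open>p\<close> over the three indices labels a tensor product of dual basis vectors.\<close>

definition words :: "nat \<Rightarrow> 3 list set" where
  "words p = {w. length w = p}"

definition check_e :: "3 \<Rightarrow> complex^3" where
  "check_e a = (if a = 1 then - axis 3 1 else if a = 2 then axis 2 1 else - axis 1 1)"

definition check_tensor :: "3 list \<Rightarrow> 3 list \<Rightarrow> complex" where
  "check_tensor a = (\<lambda>w.
     if length w = length a then \<Prod>k<length a. check_e (a ! k) $ (w ! k) else 0)"

text \<open>Covectors transform by \<open>\<phi> \<mapsto> \<phi> \<circ> g\<inverse>\<close>, so the dual basis vector with index
  \<open>a\<close> goes to the covector with coefficients given by row \<open>a\<close> of \<open>g\<inverse>\<close>.\<close>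

definition tensor_act :: "nat \<Rightarrow> complex^3^3 \<Rightarrow> (3 list \<Rightarrow> complex) \<Rightarrow> 3 list \<Rightarrow> complex" where
  "tensor_act p g T = (\<lambda>w. if w \<in> words p
     then \<Sum>a\<in>words p. (\<Prod>k<p. matrix_inv g $ (a ! k) $ (w ! k)) * T a else 0)"

definition symmetrize :: "nat \<Rightarrow> (3 list \<Rightarrow> complex) \<Rightarrow> 3 list \<Rightarrow> complex" where
  "symmetrize p T = (\<lambda>w. if w \<in> words p
     then (\<Sum>\<sigma> | \<sigma> permutes {..<p}. T (permute_list \<sigma> w)) / fact p else 0)"

type_synonym mono = "nat \<times> nat \<times> nat"
type_synonym operator = "mono \<times> mono \<Rightarrow> complex"

definition mono_index :: "nat \<Rightarrow> mono set" where
  "mono_index p = {(j, k, l). j + k + l = p}"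

definition sym_basis :: "nat \<Rightarrow> mono \<Rightarrow> 3 list \<Rightarrow> complex" where
  "sym_basis p = (\<lambda>(j, k, l).
     let T = symmetrize p (check_tensor (replicate j 1 @ replicate k 2 @ replicate l 3))
     in (\<lambda>w. T w / of_real (sqrt (Re (cinner (words p) T T)))))"

text \<open>The matrix of the action on symmetric tensors with respect to the orthonormal basis
  \<open>sym_basis p\<close>; from here on the irrep \<open>(0, p)\<close> lives on
  \<open>cspace (mono_index p)\<close>.\<close>

definition rho :: "nat \<Rightarrow> complex^3^3 \<Rightarrow> operator" where
  "rho p g = (\<lambda>(\<alpha>, \<beta>). if \<alpha> \<in> mono_index p \<and> \<beta> \<in> mono_index p
     then cinner (words p) (sym_basis p \<alpha>) (tensor_act p g (sym_basis p \<beta>)) else 0)"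

definition vec_act :: "nat \<Rightarrow> complex^3^3 \<Rightarrow> (mono \<Rightarrow> complex) \<Rightarrow> mono \<Rightarrow> complex" where
  "vec_act p g = op_apply (mono_index p) (rho p g)"

definition op_act :: "nat \<Rightarrow> complex^3^3 \<Rightarrow> operator \<Rightarrow> operator" where
  "op_act p g A = op_mult (mono_index p) (rho p g) (op_mult (mono_index p) A (rho p (matrix_inv g)))"

definition weight_space :: "nat \<Rightarrow> weight \<Rightarrow> (mono \<Rightarrow> complex) set" where
  "weight_space p \<nu> = {v \<in> cspace (mono_index p).
     T_three (vec_act p) v = (\<lambda>i. of_real (t_of \<nu>) * v i) \<and>
     U_three (vec_act p) v = (\<lambda>i. of_real (u_of \<nu>) * v i)}"

definition weight_projection :: "nat \<Rightarrow> weight \<Rightarrow> operator" where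
  "weight_projection p \<nu> = orth_projection (mono_index p) (weight_space p \<nu>)"

definition gt_basis :: "nat \<Rightarrow> (weight \<Rightarrow> real \<Rightarrow> mono \<Rightarrow> complex) \<Rightarrow> bool" where
  "gt_basis p e \<longleftrightarrow>
     gt_family (cinner (mono_index p)) (vec_act p) 0 p e \<and>
     (\<forall>(\<nu>, J)\<in>gt_labels 0 p. e \<nu> J \<in> cspace (mono_index p)) \<and>
     (\<forall>v\<in>cspace (mono_index p).
        v = (\<lambda>i. \<Sum>(\<nu>, J)\<in>gt_labels 0 p. cinner (mono_index p) (e \<nu> J) v * e \<nu> J i))"

section \<open>Coupled basis and Clebsch-Gordan coefficients\<close>

text \<open>For the irrep \<open>(0, p)\<close> the label \<open>J\<close> is determined by the weight.\<close>

lemma gt_labels_0_J: "(\<nu>, J) \<in> gt_labels 0 p \<Longrightarrow> J = real_of_int (fst \<nu>) / 2"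
  by (auto simp: gt_labels_def)

definition gt_vec :: "(weight \<Rightarrow> real \<Rightarrow> mono \<Rightarrow> complex) \<Rightarrow> weight \<Rightarrow> mono \<Rightarrow> complex" where
  "gt_vec e \<nu> = e \<nu> (real_of_int (fst \<nu>) / 2)"

fun dual_weight :: "nat \<Rightarrow> weight \<Rightarrow> weight" where
  "dual_weight p (\<nu>1, \<nu>2, \<nu>3) = (int p - \<nu>1, int p - \<nu>2, int p - \<nu>3)"

text \<open>The induced basis of the dual irrep \<open>(p, 0)\<close>, as functionals in coordinates. The sign
  is \<open>(-1)\<close> to the power \<open>2 (t + u) = \<nu>1 - \<nu>3\<close>, where \<open>\<nu>\<close> is the
  label of \<open>(0, p)\<close> dual to the given label \<open>\<mu>\<close> of \<open>(p, 0)\<close>.\<close>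

definition dual_gt_vec ::
  "nat \<Rightarrow> (weight \<Rightarrow> real \<Rightarrow> mono \<Rightarrow> complex) \<Rightarrow> weight \<Rightarrow> mono \<Rightarrow> complex" where
  "dual_gt_vec p e \<mu> = (\<lambda>i. case dual_weight p \<mu> of (\<nu>1, \<nu>2, \<nu>3) \<Rightarrow>
     (-1) powi (\<nu>1 - \<nu>3) * cnj (gt_vec e (\<nu>1, \<nu>2, \<nu>3) i))"

text \<open>A vector tensored with a functional, seen as an operator.\<close>

definition op_tensor :: "(mono \<Rightarrow> complex) \<Rightarrow> (mono \<Rightarrow> complex) \<Rightarrow> operator" where
  "op_tensor v \<phi> = (\<lambda>(i, j). v i * \<phi> j)"

definition clebsch_gordan ::
  "nat \<Rightarrow> (weight \<Rightarrow> real \<Rightarrow> mono \<Rightarrow> complex) \<Rightarrow> (nat \<Rightarrow> weight \<Rightarrow> real \<Rightarrow> operator) \<Rightarrow>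
   nat \<Rightarrow> weight \<Rightarrow> weight \<Rightarrow> weight \<Rightarrow> real \<Rightarrow> complex" where
  "clebsch_gordan p e E n \<nu>1 \<nu>2 \<nu> J =
     op_inner (mono_index p) (E n \<nu> J) (op_tensor (gt_vec e \<nu>1) (dual_gt_vec p e \<nu>2))"

definition coupled_basis ::
  "nat \<Rightarrow> (weight \<Rightarrow> real \<Rightarrow> mono \<Rightarrow> complex) \<Rightarrow> (nat \<Rightarrow> weight \<Rightarrow> real \<Rightarrow> operator) \<Rightarrow> bool" where
  "coupled_basis p e E \<longleftrightarrow>
     (\<forall>n\<le>p. gt_family (op_inner (mono_index p)) (op_act p) n n (E n) \<and>
        (\<forall>(\<nu>, J)\<in>gt_labels n n. E n \<nu> J \<in> ops (mono_index p))) \<and>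
     (\<forall>n\<le>p. \<forall>m\<le>p. n \<noteq> m \<longrightarrow> (\<forall>(\<nu>, J)\<in>gt_labels n n. \<forall>(\<nu>', J')\<in>gt_labels m m.
        op_inner (mono_index p) (E n \<nu> J) (E m \<nu>' J') = 0)) \<and>
     (\<forall>A\<in>ops (mono_index p). A = (\<lambda>i. \<Sum>n\<le>p. \<Sum>(\<nu>, J)\<in>gt_labels n n.
        op_inner (mono_index p) (E n \<nu> J) A * E n \<nu> J i)) \<and>
     (\<forall>n\<le>p. \<forall>(\<nu>, J)\<in>gt_labels n n. \<forall>\<nu>1\<in>fst ` gt_labels 0 p. \<forall>\<nu>2\<in>fst ` gt_labels p 0.
        clebsch_gordan p e E n \<nu>1 \<nu>2 \<nu> J \<in> \<real>) \<and>
     E 0 (0, 0, 0) 0 = (\<lambda>i. op_id (mono_index p) i / of_real (sqrt (irrep_dim 0 p)))"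

section \<open>Symbol correspondences\<close>

definition symbol_correspondence :: "nat \<Rightarrow> (operator \<Rightarrow> cp2 \<Rightarrow> complex) \<Rightarrow> bool" where
  "symbol_correspondence p W \<longleftrightarrow>
     (\<forall>A\<in>ops (mono_index p). smooth_cp2 (W A)) \<and>
     (\<forall>A\<in>ops (mono_index p). \<forall>B\<in>ops (mono_index p). \<forall>a b.
        W (\<lambda>i. a * A i + b * B i) = (\<lambda>x. a * W A x + b * W B x)) \<and>
     inj_on W (ops (mono_index p)) \<and>
     (\<forall>A\<in>ops (mono_index p). \<forall>g\<in>SU3. \<forall>x. W (op_act p g A) x = W A (act (matrix_inv g) x)) \<and>
     (\<forall>A\<in>ops (mono_index p). \<forall>x. W (op_adj A) x = cnj (W A x)) \<and>
     (\<forall>A\<in>ops (mono_index p).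
        cp2_integral (W A) = op_trace (mono_index p) A / of_real (irrep_dim 0 p))"

definition mapping_positive :: "nat \<Rightarrow> (operator \<Rightarrow> cp2 \<Rightarrow> complex) \<Rightarrow> bool" where
  "mapping_positive p W \<longleftrightarrow>
     (\<forall>A. positive_op (mono_index p) A \<longrightarrow> (\<forall>x. W A x \<in> \<real> \<and> 0 \<le> Re (W A x))) \<and>
     (\<forall>A. positive_definite_op (mono_index p) A \<longrightarrow> (\<forall>x. W A x \<in> \<real> \<and> 0 < Re (W A x)))"

definition is_operator_kernel :: "nat \<Rightarrow> (operator \<Rightarrow> cp2 \<Rightarrow> complex) \<Rightarrow> operator \<Rightarrow> bool" where
  "is_operator_kernel p W K \<longleftrightarrow> K \<in> ops (mono_index p) \<and>
     (\<forall>h\<in>isotropy_group. op_act p h K = K) \<and>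
     (\<forall>A\<in>ops (mono_index p). \<forall>g\<in>SU3.
        W A (act g base_point) = op_trace (mono_index p) (op_mult (mono_index p) A (op_act p g K)))"

definition characteristic_numbers ::
  "nat \<Rightarrow> (nat \<Rightarrow> weight \<Rightarrow> real \<Rightarrow> operator) \<Rightarrow> (operator \<Rightarrow> cp2 \<Rightarrow> complex) \<Rightarrow>
   (nat \<Rightarrow> complex) \<Rightarrow> bool" where
  "characteristic_numbers p E W c \<longleftrightarrow>
     c 0 = 1 \<and> (\<forall>n\<le>p. c n \<in> \<real> \<and> c n \<noteq> 0) \<and>
     is_operator_kernel p W (\<lambda>i. \<Sum>n\<le>p.
       c n * of_real (sqrt (real ((n + 1) ^ 3) / irrep_dim 0 p)) * E n (int n, int n, int n) 0 i)"

section \<open>The maps \<open>\<Phi>\<close>, \<open>\<theta>\<close> and \<open>B\<^sup>-\<close>\<close>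

definition Phi :: "nat \<Rightarrow> complex^3 \<Rightarrow> mono \<Rightarrow> complex" where
  "Phi p z = (\<lambda>(j, k, l). if (j, k, l) \<in> mono_index p
     then of_real (sqrt (fact p / (fact j * fact k * fact l))) * (z $ 1) ^ j * (z $ 2) ^ k * (z $ 3) ^ l
     else 0)"

definition theta :: "complex^3 \<Rightarrow> complex^3" where
  "theta z = vector [- cnj (z $ 3), cnj (z $ 2), - cnj (z $ 1)]"

definition husimi :: "nat \<Rightarrow> operator \<Rightarrow> complex^3 \<Rightarrow> complex" where
  "husimi p A n =
     cinner (mono_index p) (Phi p (theta n)) (op_apply (mono_index p) A (Phi p (theta n)))"

text \<open>The value is computed from a chosen unit vector over \<open>x\<close>; independence of the choice
  is not built into the definition.\<close>

definition B_minus :: "nat \<Rightarrow> operator \<Rightarrow> cp2 \<Rightarrow> complex" where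
  "B_minus p A x = husimi p A (SOME n. norm n = 1 \<and> proj n = x)"

end

theory Submission
  imports Defs "HOL-Combinatorics.Multiset_Permutations"
begin

text \<open>The vector \<open>Phi p (theta n)\<close> is the coherent state \<open>\<langle>n| \<otimes> \<dots> \<otimes> \<langle>n|\<close>, so a
  unitary \<open>g\<close> carries the coherent state of \<open>n\<close> to that of \<open>g n\<close>, and the projection onto the
  coherent state of the base point is the projection onto the lowest weight space. Equivariance,
  positivity and the operator kernel follow. Injectivity is the vanishing of a polynomial in \<open>n\<close>
  and its conjugate; it also says that the coherent projections span all operators, so that the
  invariance of the integral forces it to be a multiple of the trace.

  For the characteristic numbers the projection is expanded in the coupled basis. It has weight
  zero and is annihilated by \<open>U_minus\<close>, which leaves only the elements with label
  \<open>((n, n, n), 0)\<close>. The coefficients do not vanish because the lowest weight vector is cyclic for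
  the raising operators.\<close>

section \<open>Coherent states\<close>

text \<open>The difficulty is that the objects are given implicitly: \<open>rho\<close> by inner
  products of normalised symmetrisations, its derivative as a limit along \<open>mexp\<close>, and a
  Gelfand-Tsetlin family only by conditions on its highest weight vector and a recursion for the
  lowering operators. Coherent states settle the first two: the group acts on them in closed form,
  and, being total, they determine a matrix by its values on them, so the derivative of
  \<open>rho\<close> is never computed from symmetrised tensors. For the families, weights are
  propagated from the highest weight vector along the recursion. After that a single matrix entry
  matters, the diagonal one at the lowest monomial (0, 0, p). Its conjugate is the coefficient of
  the projection along a family element. The Clebsch-Gordan coefficient is the same number times
  (-1)^p, the sign that the induced dual basis attaches to the label (0, p, p); the factor (-1)^p in
  the formula cancels it.\<close>

lemma finite_mono_index [simp]: "finite (mono_index p)"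
proof (rule finite_subset)
  show "mono_index p \<subseteq> {..p} \<times> {..p} \<times> {..p}" by (auto simp: mono_index_def)
qed simp

lemma mono_index_iff [simp]: "(j, k, l) \<in> mono_index p \<longleftrightarrow> j + k + l = p"
  by (simp add: mono_index_def)

text \<open>Eliminating the third exponent gives a sum over a square, padded with zeros. The
  dimension count and the polynomial argument for injectivity both work with this form.\<close>

lemma sum_mono_index:
  "sum f (mono_index p) = (\<Sum>j\<le>p. \<Sum>k\<le>p. if j + k \<le> p then f (j, k, p - (j + k)) else 0)"
proof -
  let ?S = "{(j, k). j \<le> p \<and> k \<le> p \<and> j + k \<le> p}"
  have "sum f (mono_index p) = (\<Sum>(j, k)\<in>?S. f (j, k, p - (j + k)))"
    by (rule sum.reindex_bij_witness[of _ "\<lambda>(j, k). (j, k, p - (j + k))" "\<lambda>(j, k, l). (j, k)"])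
      (auto simp: mono_index_def)
  also have "\<dots> = (\<Sum>(j, k)\<in>{..p} \<times> {..p}. if j + k \<le> p then f (j, k, p - (j + k)) else 0)"
    by (rule sum.mono_neutral_cong_left) (auto split: if_splits)
  also have "\<dots> = (\<Sum>j\<le>p. \<Sum>k\<le>p. if j + k \<le> p then f (j, k, p - (j + k)) else 0)"
    by (simp add: sum.cartesian_product)
  finally show ?thesis .
qed

lemma card_mono_index: "real (card (mono_index p)) = irrep_dim 0 p"
proof -
  have "real (card (mono_index p)) = (\<Sum>i\<in>mono_index p. 1)" by simp
  also have "\<dots> = (\<Sum>j\<le>p. \<Sum>k\<le>p. if j + k \<le> p then 1 else 0)" by (rule sum_mono_index)
  also have "\<dots> = (\<Sum>j\<le>p. real (p - j + 1))"
  proof (rule sum.cong)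
    fix j assume "j \<in> {..p}"
    then have "{..p} \<inter> {k. j + k \<le> p} = {..p - j}" by auto
    then show "(\<Sum>k\<le>p. if j + k \<le> p then 1 else 0) = real (p - j + 1)"
      by (simp add: sum.If_cases)
  qed simp
  also have "\<dots> = (\<Sum>j\<le>p. real (j + 1))"
    by (rule sum.reindex_bij_witness[of _ "\<lambda>j. p - j" "\<lambda>j. p - j"]) auto
  also have "\<dots> = irrep_dim 0 p"
    by (induction p) (auto simp: irrep_dim_def field_simps)
  finally show ?thesis .
qed

section \<open>Polynomials in a complex variable and its conjugate\<close>

lemma poly_eq_0_of_real:
  fixes q :: "complex poly"
  assumes "\<And>x :: real. poly q (of_real x) = 0"
  shows "q = 0"
proof (rule ccontr)
  assume "q \<noteq> 0"
  then have "finite {x. poly q x = 0}" by (rule poly_roots_finite)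
  moreover have "range complex_of_real \<subseteq> {x. poly q x = 0}" using assms by auto
  ultimately have "finite (range complex_of_real)" using finite_subset by blast
  then show False by (auto dest!: finite_imageD simp: inj_on_def infinite_UNIV_char_0)
qed

text \<open>As a polynomial in the real and imaginary parts of \<open>z\<close> the sum vanishes for complex values
  of these as well, which makes \<open>z\<close> and its conjugate independent variables.\<close>

lemma cnj_polynomial_eq_0:
  fixes a :: "nat \<Rightarrow> nat \<Rightarrow> complex"
  assumes zero: "\<And>z. (\<Sum>i\<le>N. \<Sum>j\<le>N. a i j * z ^ i * cnj z ^ j) = 0"
    and "i \<le> N" "j \<le> N"
  shows "a i j = 0"
proof -
  let ?P = "\<lambda>x y. \<Sum>i\<le>N. \<Sum>j\<le>N. a i j * (x + \<i> * y) ^ i * (x - \<i> * y) ^ j"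
  have real: "?P (of_real x) (of_real y) = 0" for x y
  proof -
    have "cnj (of_real x + \<i> * of_real y) = of_real x - \<i> * of_real y" by simp
    then show ?thesis using zero[of "of_real x + \<i> * of_real y"] by (simp only:)
  qed
  have half: "?P x (of_real y) = 0" for x y
  proof -
    define q where
      "q = (\<Sum>i\<le>N. \<Sum>j\<le>N. smult (a i j) ([:\<i> * of_real y, 1:] ^ i * [:- (\<i> * of_real y), 1:] ^ j))"
    have q: "poly q x = ?P x (of_real y)" for x
      by (simp add: q_def poly_sum algebra_simps)
    have "q = 0" using real by (intro poly_eq_0_of_real) (simp add: q)
    then show ?thesis using q[of x] by simp
  qed
  have full: "?P x y = 0" for x y
  proof -
    define q where
      "q = (\<Sum>i\<le>N. \<Sum>j\<le>N. smult (a i j) ([:x, \<i>:] ^ i * [:x, - \<i>:] ^ j))"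
    have q: "poly q y = ?P x y" for y
      by (simp add: q_def poly_sum algebra_simps)
    have "q = 0" using half by (intro poly_eq_0_of_real) (simp add: q)
    then show ?thesis using q[of y] by simp
  qed
  have zw: "(\<Sum>i\<le>N. \<Sum>j\<le>N. a i j * z ^ i * w ^ j) = 0" for z w
  proof -
    have "(z + w) / 2 + \<i> * ((z - w) / (2 * \<i>)) = z" "(z + w) / 2 - \<i> * ((z - w) / (2 * \<i>)) = w"
      by (simp_all add: field_simps)
    then show ?thesis using full[of "(z + w) / 2" "(z - w) / (2 * \<i>)"] by simp
  qed
  have "(\<Sum>j\<le>N. a i j * w ^ j) = 0" for w
  proof -
    let ?q = "\<Sum>i\<le>N. monom (\<Sum>j\<le>N. a i j * w ^ j) i"
    have "?q = 0"
      using zw[of _ w] by (intro poly_eq_0_of_real)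
        (simp add: poly_sum poly_monom sum_distrib_right mult.assoc mult.commute[of "w ^ _"])
    then have "coeff ?q i = 0" by simp
    then show ?thesis using \<open>i \<le> N\<close> by (simp add: coeff_sum)
  qed
  then have "(\<Sum>j\<le>N. monom (a i j) j) = 0"
    by (intro poly_eq_0_of_real) (simp add: poly_sum poly_monom)
  then have "coeff (\<Sum>j\<le>N. monom (a i j) j) j = 0" by simp
  then show ?thesis using \<open>j \<le> N\<close> by (simp add: coeff_sum)
qed

lemma exhaust_3_cases: obtains "i = (1::3)" | "i = 2" | "i = 3"
  using exhaust_3 by blast

text \<open>The covector dual to n has coefficients \<open>cnj (n $ i)\<close> in the dual standard
  basis. Since \<open>check_e\<close> lists that basis in reverse order with signs -, +, -, its
  coordinates are \<open>theta n\<close>, and \<open>Phi p\<close> takes the p-th tensor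
  power.\<close>

definition coherent :: "nat \<Rightarrow> complex^3 \<Rightarrow> mono \<Rightarrow> complex" where
  "coherent p n = Phi p (theta n)"

lemma coherent_apply:
  "coherent p n (j, k, l) = (if j + k + l = p
     then of_real (sqrt (fact p / (fact j * fact k * fact l))) *
       (- cnj (n $ 3)) ^ j * cnj (n $ 2) ^ k * (- cnj (n $ 1)) ^ l else 0)"
  by (simp add: coherent_def Phi_def theta_def)

lemma coherent_in_cspace [simp]: "coherent p n \<in> cspace (mono_index p)"
  by (auto simp: cspace_def coherent_apply mono_index_def)

lemma coherent_scale: "coherent p (c *s n) i = cnj c ^ p * coherent p n i"
proof (cases i)
  case (fields j k l)
  have neg: "- cnj ((c *s n) $ a) = cnj c * (- cnj (n $ a))" for a by simp
  show ?thesis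
    unfolding fields coherent_apply neg power_mult_distrib
    by (auto simp: power_add power_mult_distrib)
qed

lemma husimi_coherent:
  "husimi p A n = (\<Sum>i\<in>mono_index p. \<Sum>j\<in>mono_index p. cnj (coherent p n i) * A (i, j) * coherent p n j)"
  by (simp add: husimi_def coherent_def cinner_def op_apply_def sum_distrib_left mult.assoc)

text \<open>On an affine chart the symbol is a polynomial in two complex variables and their
  conjugates in which every matrix entry has its own monomial. The one-variable identity theorem is
  applied twice, once for each variable.\<close>

lemma husimi_eq_0_imp:
  assumes A: "A \<in> ops (mono_index p)" and zero: "\<And>n. husimi p A n = 0"
  shows "A = (\<lambda>_. 0)"
proof -
  define c :: "nat \<Rightarrow> nat \<Rightarrow> complex" where
    "c j k = of_real (sqrt (fact p / (fact j * fact k * fact (p - (j + k)))))" for j k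
  \<comment> \<open>The coefficients are set to zero outside the triangles so that all four
    exponents range over the full interval up to p.\<close>
  define G where "G j k j' k' = (if j + k \<le> p \<and> j' + k' \<le> p
    then c j k * c j' k' * A ((j, k, p - (j + k)), (j', k', p - (j' + k'))) else 0)" for j k j' k'
  have "(\<Sum>j'\<le>p. \<Sum>j\<le>p. (\<Sum>k'\<le>p. \<Sum>k\<le>p. G j k j' k' * y ^ k' * cnj y ^ k) * x ^ j' * cnj x ^ j) = 0"
    for x y
  proof -
    \<comment> \<open>Chosen so that \<open>theta ?n\<close> is (x, y, 1): the third exponent then
      leaves no trace.\<close>
    let ?n = "vector [- 1, cnj y, - cnj x] :: complex^3"
    have "0 = husimi p A ?n" using zero by simp
    also have "\<dots> = (\<Sum>j\<le>p. \<Sum>k\<le>p. \<Sum>j'\<le>p. \<Sum>k'\<le>p.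
        G j k j' k' * y ^ k' * cnj y ^ k * x ^ j' * cnj x ^ j)"
      unfolding husimi_coherent sum_mono_index
      by (intro sum.cong refl) (auto simp: coherent_apply G_def c_def sum_distrib_left intro!: sum.cong)
    also have "\<dots> = (\<Sum>j\<le>p. \<Sum>j'\<le>p. \<Sum>k\<le>p. \<Sum>k'\<le>p.
        G j k j' k' * y ^ k' * cnj y ^ k * x ^ j' * cnj x ^ j)"
      by (intro sum.cong refl sum.swap)
    also have "\<dots> = (\<Sum>j'\<le>p. \<Sum>j\<le>p. \<Sum>k\<le>p. \<Sum>k'\<le>p.
        G j k j' k' * y ^ k' * cnj y ^ k * x ^ j' * cnj x ^ j)"
      by (rule sum.swap)
    also have "\<dots> = (\<Sum>j'\<le>p. \<Sum>j\<le>p. \<Sum>k'\<le>p. \<Sum>k\<le>p.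
        G j k j' k' * y ^ k' * cnj y ^ k * x ^ j' * cnj x ^ j)"
      by (intro sum.cong refl sum.swap)
    finally show ?thesis by (simp add: sum_distrib_right)
  qed
  then have "(\<Sum>k'\<le>p. \<Sum>k\<le>p. G j k j' k' * y ^ k' * cnj y ^ k) = 0" if "j \<le> p" "j' \<le> p" for j j' y
    by (rule cnj_polynomial_eq_0[where N = p and a = "\<lambda>j' j. \<Sum>k'\<le>p. \<Sum>k\<le>p. G j k j' k' * y ^ k' * cnj y ^ k"])
      (use that in auto)
  then have G: "G j k j' k' = 0" if "j \<le> p" "j' \<le> p" "k \<le> p" "k' \<le> p" for j j' k k'
    by (rule cnj_polynomial_eq_0[where N = p and a = "\<lambda>k' k. G j k j' k'"]) (use that in auto)
  have "A (a, b) = 0" if ab: "a \<in> mono_index p" "b \<in> mono_index p" for a b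
  proof -
    obtain j k l j' k' l' where [simp]: "a = (j, k, l)" "b = (j', k', l')" by (metis surj_pair)
    have "l = p - (j + k)" "l' = p - (j' + k')" using ab by auto
    moreover have "c j k \<noteq> 0" "c j' k' \<noteq> 0" by (auto simp: c_def)
    ultimately show ?thesis using G[of j j' k k'] ab by (auto simp: G_def)
  qed
  moreover have "A (a, b) = 0" if "\<not> (a \<in> mono_index p \<and> b \<in> mono_index p)" for a b
    using A that unfolding cspace_def by blast
  ultimately have "A (a, b) = 0" for a b by blast
  then show ?thesis by (auto simp: fun_eq_iff)
qed

text \<open>The operator all of whose rows are x has at n the symbol (sum of
  \<open>cnj (coherent p n a)\<close> over a) times the given pairing of x with the coherent state.
  It therefore has zero symbol and vanishes.\<close>

lemma coherent_total:
  assumes "\<And>n. (\<Sum>i\<in>mono_index p. x i * coherent p n i) = 0" and "i \<in> mono_index p"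
  shows "x i = 0"
proof -
  define A where "A = (\<lambda>(a, b). if a \<in> mono_index p \<and> b \<in> mono_index p then x b else 0)"
  have "A = (\<lambda>_. 0)"
  proof (rule husimi_eq_0_imp)
    show "A \<in> ops (mono_index p)" by (auto simp: A_def cspace_def)
    show "husimi p A n = 0" for n
      using assms(1)[of n] by (simp add: husimi_coherent A_def mult.assoc sum_distrib_left[symmetric])
  qed
  then have "A (i, i) = 0" by simp
  then show ?thesis using assms(2) by (simp add: A_def)
qed

section \<open>Symmetric tensors in the monomial basis\<close>

lemma sum_if_card:
  fixes c :: "'a :: semiring_1"
  assumes "finite A"
  shows "(\<Sum>x\<in>A. if P x then c else 0) = of_nat (card {x \<in> A. P x}) * c"
  using assms by (simp add: sum.inter_filter[symmetric])

lemma prod_UNIV_3: "(\<Prod>a\<in>(UNIV :: 3 set). f a) = f 3 * f 2 * f 1"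
  unfolding UNIV_3 by (simp add: mult_ac)

lemma finite_words [simp]: "finite (words p)"
  using finite_lists_length_eq[of "UNIV :: 3 set" p] by (simp add: words_def)

text \<open>Distributivity. It is the reason why a tensor power of a matrix acts factor by factor on
  a product tensor.\<close>

lemma sum_words_prod:
  fixes f :: "nat \<Rightarrow> 3 \<Rightarrow> complex"
  shows "(\<Sum>a\<in>words p. \<Prod>k<p. f k (a ! k)) = (\<Prod>k<p. \<Sum>a\<in>UNIV. f k a)"
proof (induction p arbitrary: f)
  case 0
  then show ?case by (simp add: words_def)
next
  case (Suc p)
  have "(\<Sum>a\<in>words (Suc p). \<Prod>k<Suc p. f k (a ! k)) =
      (\<Sum>(x, w)\<in>UNIV \<times> words p. \<Prod>k<Suc p. f k ((x # w) ! k))"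
    by (rule sum.reindex_bij_witness[of _ "\<lambda>(x, w). x # w" "\<lambda>w. (hd w, tl w)"])
      (auto simp: words_def length_Suc_conv)
  also have "\<dots> = (\<Sum>x\<in>UNIV. \<Sum>w\<in>words p. f 0 x * (\<Prod>k<p. f (Suc k) (w ! k)))"
    by (simp add: sum.cartesian_product[symmetric] prod.lessThan_Suc_shift del: prod.lessThan_Suc)
  also have "\<dots> = (\<Prod>k<Suc p. \<Sum>a\<in>UNIV. f k a)"
    using Suc.IH[of "\<lambda>k. f (Suc k)"]
    by (simp add: sum_distrib_left[symmetric] sum_distrib_right[symmetric] prod.lessThan_Suc_shift
        del: prod.lessThan_Suc)
  finally show ?case .
qed

text \<open>The reversal of the indices comes from the order of the dual basis \<open>check_e\<close>.\<close>

fun word_type :: "mono \<Rightarrow> 3 multiset" where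
  "word_type (j, k, l) = replicate_mset j 3 + replicate_mset k 2 + replicate_mset l 1"

lemma size_word_type [simp]: "size (word_type (j, k, l)) = j + k + l"
  by simp

lemma count_word_type [simp]:
  "count (word_type (j, k, l)) 1 = l" "count (word_type (j, k, l)) 2 = k"
  "count (word_type (j, k, l)) 3 = j"
  by simp_all

declare word_type.simps [simp del]

lemma word_type_eq_iff: "word_type i = word_type i' \<longleftrightarrow> i = i'"
  by (cases i; cases i') (metis count_word_type)

lemma word_type_cover:
  assumes "w \<in> words p"
  shows "\<exists>i\<in>mono_index p. mset w = word_type i"
proof
  let ?i = "(count (mset w) 3, count (mset w) 2, count (mset w) 1)"
  show eq: "mset w = word_type ?i"
  proof (rule multiset_eqI)
    fix x :: 3
    show "count (mset w) x = count (word_type ?i) x"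
      by (cases x rule: exhaust_3_cases) (simp_all del: count_mset)
  qed
  have "size (mset w) = count (mset w) 3 + count (mset w) 2 + count (mset w) 1"
    by (subst eq) (simp only: size_word_type)
  then show "?i \<in> mono_index p" using assms by (simp add: words_def del: count_mset)
qed

lemma prod_word:
  fixes f :: "3 \<Rightarrow> complex"
  assumes "mset w = word_type (j, k, l)"
  shows "(\<Prod>i<length w. f (w ! i)) = f 3 ^ j * f 2 ^ k * f 1 ^ l"
proof -
  have "(\<Prod>i<length w. f (w ! i)) = prod_list (map f w)"
    by (simp add: prod.list_conv_set_nth atLeast0LessThan)
  also have "\<dots> = prod_mset (image_mset f (mset w))" by (simp flip: mset_map add: prod_mset_prod_list)
  also have "\<dots> = f 3 ^ j * f 2 ^ k * f 1 ^ l" by (simp add: assms word_type.simps)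
  finally show ?thesis .
qed

text \<open>This is the multinomial coefficient, written as a product so that no division of natural
  numbers occurs.\<close>

lemma card_words_of_type:
  assumes "j + k + l = p"
  shows "card {w \<in> words p. mset w = word_type (j, k, l)} * (fact j * fact k * fact l) = fact p"
proof -
  have eq: "{w \<in> words p. mset w = word_type (j, k, l)} = permutations_of_multiset (word_type (j, k, l))"
  proof -
    have "length w = p" if "mset w = word_type (j, k, l)" for w
      using arg_cong[OF that, of size] assms by simp
    then show ?thesis by (auto simp: words_def permutations_of_multiset_def)
  qed
  \<comment> \<open>Letters that do not occur contribute the factorial of 0, so the product may run
    over all three letters.\<close>
  have "(\<Prod>x\<in>set_mset (word_type (j, k, l)). fact (count (word_type (j, k, l)) x)) =
      (\<Prod>x\<in>(UNIV :: 3 set). fact (count (word_type (j, k, l)) x))"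
    by (rule prod.mono_neutral_left) (auto simp: not_in_iff)
  also have "\<dots> = fact j * fact k * (fact l :: nat)" by (simp add: prod_UNIV_3)
  finally have prod: "(\<Prod>x\<in>set_mset (word_type (j, k, l)). fact (count (word_type (j, k, l)) x)) =
      fact j * fact k * (fact l :: nat)" .
  have "card (permutations_of_multiset (word_type (j, k, l))) *
      (\<Prod>x\<in>set_mset (word_type (j, k, l)). fact (count (word_type (j, k, l)) x)) =
      fact (size (word_type (j, k, l)))"
    by (simp only: card_permutations_of_multiset(1) dvd_div_mult_self[OF card_permutations_of_multiset(2)])
  then show ?thesis by (simp only: prod eq size_word_type assms)
qed

text \<open>Every word of the given type is hit by the same number of permutations, because the count
  is invariant under permuting the word.\<close>

lemma card_permutations_to_word:
  assumes b: "b \<in> words p" "mset b = word_type (j, k, l)"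
    and w: "w \<in> words p" "mset w = word_type (j, k, l)"
  shows "card {\<sigma>. \<sigma> permutes {..<p} \<and> permute_list \<sigma> w = b} = fact j * fact k * fact l"
proof -
  let ?W = "{w \<in> words p. mset w = word_type (j, k, l)}"
  let ?N = "\<lambda>w. card {\<sigma>. \<sigma> permutes {..<p} \<and> permute_list \<sigma> w = b}"
  have fin: "finite {\<sigma>. \<sigma> permutes {..<p}}" by (simp add: finite_permutations)
  have p: "j + k + l = p"
    using arg_cong[OF w(2), of size] w(1) by (simp add: words_def)
  have N: "?N v = ?N w" if v: "v \<in> ?W" for v
  proof -
    have len: "length v = p" "length w = p" using v w by (auto simp: words_def)
    obtain \<tau> where \<tau>: "\<tau> permutes {..<length w}" "permute_list \<tau> w = v"
      using v w mset_eq_permutation[of v w] by auto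
    have \<tau>': "\<tau> permutes {..<p}" using \<tau> len by simp
    show ?thesis
    proof (rule bij_betw_same_card[of "\<lambda>\<sigma>. \<tau> \<circ> \<sigma>"], rule bij_betw_byWitness[where f' = "\<lambda>\<sigma>. inv \<tau> \<circ> \<sigma>"])
      show "\<forall>\<sigma>\<in>{\<sigma>. \<sigma> permutes {..<p} \<and> permute_list \<sigma> v = b}. inv \<tau> \<circ> (\<tau> \<circ> \<sigma>) = \<sigma>"
        "\<forall>\<sigma>\<in>{\<sigma>. \<sigma> permutes {..<p} \<and> permute_list \<sigma> w = b}. \<tau> \<circ> (inv \<tau> \<circ> \<sigma>) = \<sigma>"
        by (simp_all add: o_assoc permutes_inv_o[OF \<tau>'])
      show "(\<lambda>\<sigma>. \<tau> \<circ> \<sigma>) ` {\<sigma>. \<sigma> permutes {..<p} \<and> permute_list \<sigma> v = b} \<subseteq>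
          {\<sigma>. \<sigma> permutes {..<p} \<and> permute_list \<sigma> w = b}"
      proof safe
        fix \<sigma> assume s: "\<sigma> permutes {..<p}" "b = permute_list \<sigma> v"
        show "(\<tau> \<circ> \<sigma>) permutes {..<p}" by (rule permutes_compose[OF s(1) \<tau>'])
        show "permute_list (\<tau> \<circ> \<sigma>) w = permute_list \<sigma> v"
          using s \<tau> len by (simp add: permute_list_compose)
      qed
      show "(\<lambda>\<sigma>. inv \<tau> \<circ> \<sigma>) ` {\<sigma>. \<sigma> permutes {..<p} \<and> permute_list \<sigma> w = b} \<subseteq>
          {\<sigma>. \<sigma> permutes {..<p} \<and> permute_list \<sigma> v = b}"
      proof safe
        fix \<sigma> assume s: "\<sigma> permutes {..<p}" "b = permute_list \<sigma> w"
        show i: "(inv \<tau> \<circ> \<sigma>) permutes {..<p}" by (rule permutes_compose[OF s(1) permutes_inv[OF \<tau>']])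
        have "permute_list (inv \<tau> \<circ> \<sigma>) v = permute_list (\<tau> \<circ> (inv \<tau> \<circ> \<sigma>)) w"
          using i \<tau> len by (simp add: permute_list_compose)
        then show "permute_list (inv \<tau> \<circ> \<sigma>) v = permute_list \<sigma> w"
          by (simp add: o_assoc permutes_inv_o[OF \<tau>'])
      qed
    qed
  qed
  have one: "card {v \<in> ?W. permute_list \<sigma> v = b} = 1" if s: "\<sigma> permutes {..<p}" for \<sigma>
  proof -
    have "{v \<in> ?W. permute_list \<sigma> v = b} = {permute_list (inv \<sigma>) b}"
    proof safe
      fix v assume v: "v \<in> words p"
      show "v = permute_list (inv \<sigma>) (permute_list \<sigma> v)"
        using v s permute_list_compose[of "inv \<sigma>" v \<sigma>]
        by (simp add: words_def permutes_inv permutes_inv_o[OF s])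
    next
      have i: "inv \<sigma> permutes {..<length b}" using b s by (simp add: words_def permutes_inv)
      show "permute_list (inv \<sigma>) b \<in> words p" "mset (permute_list (inv \<sigma>) b) = word_type (j, k, l)"
        using b i by (auto simp: words_def)
      show "permute_list \<sigma> (permute_list (inv \<sigma>) b) = b"
        using b s permute_list_compose[of \<sigma> b "inv \<sigma>"]
        by (simp add: words_def permutes_inv_o[OF s])
    qed
    then show ?thesis by simp
  qed
  \<comment> \<open>Double counting of the pairs of a permutation \<sigma> and a word v of the type
    with \<open>permute_list \<sigma> v = b\<close>: each permutation belongs to exactly one such
    pair, so there are p! of them.\<close>
  have "card ?W * ?N w = (\<Sum>v\<in>?W. ?N v)" using N by simp
  also have "\<dots> = (\<Sum>v\<in>?W. \<Sum>\<sigma> | \<sigma> permutes {..<p}. if permute_list \<sigma> v = b then 1 else 0)"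
    using fin by (intro sum.cong refl) (simp add: sum_if_card)
  also have "\<dots> = (\<Sum>\<sigma> | \<sigma> permutes {..<p}. \<Sum>v\<in>?W. if permute_list \<sigma> v = b then 1 else 0)"
    by (rule sum.swap)
  also have "\<dots> = (\<Sum>\<sigma> | \<sigma> permutes {..<p}. card {v \<in> ?W. permute_list \<sigma> v = b})"
    by (intro sum.cong refl) (simp add: sum_if_card)
  also have "\<dots> = (\<Sum>\<sigma> | \<sigma> permutes {..<p}. 1)"
    by (rule sum.cong) (use one in auto)
  also have "\<dots> = fact p" using card_permutations[of "{..<p}" p] by simp
  finally have "card ?W * ?N w = card ?W * (fact j * fact k * fact l)"
    by (simp only: card_words_of_type[OF p])
  moreover have "card ?W \<noteq> 0"
  proof -
    have "finite ?W" "w \<in> ?W" using w by (auto intro: finite_subset[OF _ finite_words[of p]])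
    then show ?thesis using card_0_eq by blast
  qed
  ultimately show ?thesis by (simp only: mult_cancel1) simp
qed

text \<open>Each \<open>check_e a\<close> is plus or minus a single dual basis vector, so a product
  of them is supported on one word. The letters 1 and 3 are exchanged, and each of them brings a
  factor -1.\<close>

lemma check_tensor_basis_word:
  "check_tensor (replicate j 1 @ replicate k 2 @ replicate l 3) w =
    (if w = replicate j 3 @ replicate k 2 @ replicate l 1 then (-1) ^ (j + l) else 0)"
proof -
  define flip :: "3 \<Rightarrow> 3" where "flip a = (if a = 1 then 3 else if a = 2 then 2 else 1)" for a
  define sgn3 :: "3 \<Rightarrow> complex" where "sgn3 a = (if a = 2 then 1 else - 1)" for a
  have e: "check_e a $ b = (if b = flip a then sgn3 a else 0)" for a b
  proof (cases a rule: exhaust_3_cases)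
    case 1
    show ?thesis unfolding 1 by (simp add: check_e_def flip_def sgn3_def axis_def)
  next
    case 2
    show ?thesis unfolding 2 by (simp add: check_e_def flip_def sgn3_def axis_def)
  next
    case 3
    show ?thesis unfolding 3 by (simp add: check_e_def flip_def sgn3_def axis_def)
  qed
  have "check_tensor a w = (if w = map flip a then prod_list (map sgn3 a) else 0)" for a
  proof (cases "w = map flip a")
    case True
    then have "check_tensor a w = (\<Prod>k<length a. sgn3 (a ! k))"
      by (simp add: check_tensor_def e)
    then show ?thesis using True by (simp add: prod.list_conv_set_nth atLeast0LessThan)
  next
    case False
    show ?thesis
    proof (cases "length w = length a")
      case True
      then obtain k where k: "k < length a" "w ! k \<noteq> flip (a ! k)"
        using False by (auto simp: list_eq_iff_nth_eq)
      then have "check_e (a ! k) $ (w ! k) = 0" by (simp add: e)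
      then have "(\<Prod>k<length a. check_e (a ! k) $ (w ! k)) = 0" using k(1) by (intro prod_zero) auto
      then show ?thesis using False by (simp add: check_tensor_def)
    qed (use False in \<open>simp add: check_tensor_def\<close>)
  qed
  then show ?thesis
    by (simp add: flip_def sgn3_def power_add)
qed

lemma mset_basis_word: "mset (replicate j 3 @ replicate k 2 @ replicate l 1) = word_type (j, k, l)"
  by (simp add: word_type.simps)

lemma minus_one_power_mult_self: "(-1) ^ m * x * ((-1) ^ m * y) = x * (y :: complex)"
  by (cases "even m") auto

lemma symmetrize_basis_word:
  assumes "j + k + l = p"
  shows "symmetrize p (check_tensor (replicate j 1 @ replicate k 2 @ replicate l 3)) w =
    (if w \<in> words p \<and> mset w = word_type (j, k, l)
     then (-1) ^ (j + l) * (fact j * fact k * fact l) / fact p else 0)"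
proof (cases "w \<in> words p")
  case w: True
  let ?b = "replicate j 3 @ replicate k 2 @ replicate l (1::3)"
  define S where "S = {\<sigma>. \<sigma> permutes {..<p} \<and> permute_list \<sigma> w = ?b}"
  have fin: "finite {\<sigma>. \<sigma> permutes {..<p}}" by (simp add: finite_permutations)
  have b: "?b \<in> words p" using assms by (simp add: words_def)
  have sum: "(\<Sum>\<sigma> | \<sigma> permutes {..<p}. check_tensor (replicate j 1 @ replicate k 2 @ replicate l 3) (permute_list \<sigma> w))
      = of_nat (card S) * (-1) ^ (j + l)"
    unfolding check_tensor_basis_word S_def
    using sum_if_card[OF fin] by (simp only: mem_Collect_eq)
  have card: "card S = (if mset w = word_type (j, k, l) then fact j * fact k * fact l else 0)"
  proof (cases "mset w = word_type (j, k, l)")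
    case True
    then show ?thesis using card_permutations_to_word[OF b mset_basis_word w True] by (simp only: S_def if_True simp_thms)
  next
    case False
    have "permute_list \<sigma> w \<noteq> ?b" if "\<sigma> permutes {..<p}" for \<sigma>
    proof
      assume "permute_list \<sigma> w = ?b"
      moreover have "mset (permute_list \<sigma> w) = mset w"
        using that w by (intro mset_permute_list) (simp add: words_def)
      ultimately show False using False mset_basis_word[of j k l] by simp
    qed
    then have "S = {}" unfolding S_def by blast
    then show ?thesis using False by (simp only: card.empty if_False)
  qed
  show ?thesis unfolding symmetrize_def sum card using w by simp
qed (simp add: symmetrize_def)

text \<open>The symmetrisation has constant modulus r = j! k! l! / p! on its 1 / r words. Its
  squared norm is therefore r, and normalising turns the value r into the square root of r.\<close>

lemma sym_basis_eq:
  assumes "j + k + l = p"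
  shows "sym_basis p (j, k, l) w =
    (if w \<in> words p \<and> mset w = word_type (j, k, l)
     then (-1) ^ (j + l) * of_real (sqrt (fact j * fact k * fact l / fact p)) else 0)"
proof -
  let ?T = "symmetrize p (check_tensor (replicate j 1 @ replicate k 2 @ replicate l 3))"
  define r :: real where "r = fact j * fact k * fact l / fact p"
  have r: "r > 0" by (simp add: r_def)
  let ?W = "{w \<in> words p. mset w = word_type (j, k, l)}"
  have T: "?T w = (if w \<in> ?W then (-1) ^ (j + l) * of_real r else 0)" for w
    by (simp add: symmetrize_basis_word[OF assms] r_def)
  have card: "real (card ?W) * r = 1"
  proof -
    have "real (card ?W * (fact j * fact k * fact l)) = fact p"
      by (simp only: card_words_of_type[OF assms] of_nat_fact)
    then show ?thesis by (simp add: r_def)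
  qed
  have "cinner (words p) ?T ?T = (\<Sum>w\<in>words p. if w \<in> ?W then of_real (r * r) else 0)"
    unfolding cinner_def T
    by (intro sum.cong refl) (simp add: minus_one_power_mult_self)
  also have "\<dots> = of_real (real (card ?W) * r * r)"
    by (simp add: sum_if_card)
  also have "\<dots> = of_real r" by (simp only: card mult_1)
  finally have norm: "sqrt (Re (cinner (words p) ?T ?T)) = sqrt r" by simp
  have "sym_basis p (j, k, l) w = ?T w / of_real (sqrt r)"
    by (simp add: sym_basis_def norm Let_def)
  also have "\<dots> = (if w \<in> ?W then (-1) ^ (j + l) * of_real (r / sqrt r) else 0)"
    unfolding T by simp
  also have "r / sqrt r = sqrt r" using r by (simp add: real_div_sqrt)
  finally show ?thesis by (simp add: r_def)
qed

lemma cnj_sym_basis: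
  assumes "i \<in> mono_index p" shows "cnj (sym_basis p i w) = sym_basis p i w"
  using assms by (cases i) (simp add: sym_basis_eq)

text \<open>The sum over the 1 / r words of constant value \<open>sqrt r\<close> yields
  \<open>sqrt (1 / r)\<close>, which is the multinomial root in \<open>Phi\<close>. The basis is
  real, so this sum is the coordinate of the product tensor of n.\<close>

lemma sym_basis_pairing:
  assumes "i \<in> mono_index p"
  shows "(\<Sum>w\<in>words p. sym_basis p i w * (\<Prod>m<p. cnj (n $ (w ! m)))) = coherent p n i"
proof (cases i)
  case (fields j k l)
  then have p: "j + k + l = p" using assms by simp
  let ?W = "{w \<in> words p. mset w = word_type (j, k, l)}"
  define r :: real where "r = fact j * fact k * fact l / fact p"
  have r: "r > 0" by (simp add: r_def)
  have card: "real (card ?W) * r = 1"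
  proof -
    have "real (card ?W * (fact j * fact k * fact l)) = fact p"
      by (simp only: card_words_of_type[OF p] of_nat_fact)
    then show ?thesis by (simp add: r_def)
  qed
  let ?c = "cnj (n $ 3) ^ j * cnj (n $ 2) ^ k * cnj (n $ 1) ^ l"
  have "(\<Sum>w\<in>words p. sym_basis p i w * (\<Prod>m<p. cnj (n $ (w ! m)))) =
      (\<Sum>w\<in>words p. if w \<in> ?W then (-1) ^ (j + l) * of_real (sqrt r) * ?c else 0)"
  proof (intro sum.cong refl)
    fix w assume w: "w \<in> words p"
    show "sym_basis p i w * (\<Prod>m<p. cnj (n $ (w ! m))) =
        (if w \<in> ?W then (-1) ^ (j + l) * of_real (sqrt r) * ?c else 0)"
      using w prod_word[of w j k l "\<lambda>a. cnj (n $ a)"]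
      by (auto simp: fields sym_basis_eq[OF p] r_def words_def)
  qed
  also have "\<dots> = of_real (real (card ?W) * sqrt r) * ((-1) ^ (j + l) * ?c)"
    by (simp add: sum_if_card)
  also have "real (card ?W) * sqrt r = sqrt (1 / r)"
  proof -
    have "real (card ?W) * sqrt r * sqrt r = 1" using card r by (simp add: mult.assoc)
    then show ?thesis using r by (simp add: real_sqrt_divide eq_divide_eq)
  qed
  also have "of_real (sqrt (1 / r)) * ((-1) ^ (j + l) * ?c) = coherent p n i"
    using p by (simp add: fields coherent_apply r_def power_add power_minus[of "cnj _"])
  finally show ?thesis .
qed

text \<open>Converse of the pairing: the coordinates rebuild the product tensor, which is thus
  symmetric. Every word lies in the support of exactly one basis vector, so one term survives, and
  there the two square roots and the signs cancel.\<close>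

lemma coherent_tensor:
  assumes w: "w \<in> words p"
  shows "(\<Sum>i\<in>mono_index p. sym_basis p i w * coherent p n i) = (\<Prod>m<p. cnj (n $ (w ! m)))"
proof -
  obtain i where i: "i \<in> mono_index p" "mset w = word_type i" using word_type_cover[OF w] by blast
  obtain j k l where [simp]: "i = (j, k, l)" by (metis surj_pair)
  have p: "j + k + l = p" using i by simp
  have "sym_basis p i' w = 0" if "i' \<in> mono_index p - {i}" for i'
  proof -
    have "word_type i \<noteq> word_type i'" using that by (auto simp: word_type_eq_iff)
    then show ?thesis using that i by (cases i') (simp add: sym_basis_eq)
  qed
  then have "(\<Sum>i\<in>mono_index p. sym_basis p i w * coherent p n i) = sym_basis p i w * coherent p n i"
    using i by (subst sum.remove[of _ i]) (auto intro: sum.neutral)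
  also have "\<dots> = of_real (sqrt (fact j * fact k * fact l / fact p) * sqrt (fact p / (fact j * fact k * fact l))) *
      (((-1) ^ (j + l)) * ((- cnj (n $ 3)) ^ j * cnj (n $ 2) ^ k * (- cnj (n $ 1)) ^ l))"
    using i w p by (simp add: sym_basis_eq coherent_apply)
  also have "sqrt (fact j * fact k * fact l / fact p) * sqrt (fact p / (fact j * fact k * fact l)) = 1"
    by (simp add: real_sqrt_mult[symmetric])
  also have "of_real 1 * (((-1) ^ (j + l)) * ((- cnj (n $ 3)) ^ j * cnj (n $ 2) ^ k * (- cnj (n $ 1)) ^ l)) =
      cnj (n $ 3) ^ j * cnj (n $ 2) ^ k * cnj (n $ 1) ^ l"
  proof -
    have "(-1) ^ (j + l) * ((- 1) ^ j * x * y * ((- 1) ^ l * z)) = x * y * z" for x y z :: complex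
      by (cases "even j"; cases "even l") auto
    then show ?thesis by (simp only: power_minus[of "cnj _"] of_real_1 mult_1_left)
  qed
  also have "\<dots> = (\<Prod>m<p. cnj (n $ (w ! m)))"
    using prod_word[of w j k l "\<lambda>a. cnj (n $ a)"] i w by (simp add: words_def)
  finally show ?thesis .
qed

section \<open>The unitary action\<close>

lemma matrix_inv_unitary:
  fixes g :: "complex^'n^'n"
  assumes "g \<in> unitary_group"
  shows "matrix_inv g = cadjoint g"
proof -
  have u: "g ** cadjoint g = mat 1" "cadjoint g ** g = mat 1"
    using assms by (auto simp: unitary_group_def)
  then have "\<exists>A'. g ** A' = mat 1 \<and> A' ** g = mat 1" by blast
  from someI_ex[OF this] have "g ** matrix_inv g = mat 1" unfolding matrix_inv_def by blast
  then have "cadjoint g ** (g ** matrix_inv g) = cadjoint g" by simp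
  then show ?thesis by (simp only: matrix_mul_assoc u matrix_mul_lid)
qed

lemma cadjoint_nth [simp]: "cadjoint g $ i $ j = cnj (g $ j $ i)"
  by (simp add: cadjoint_def)

lemma cadjoint_cadjoint [simp]: "cadjoint (cadjoint g) = g"
  by (simp add: cadjoint_def vec_eq_iff)

lemma cadjoint_unitary: "g \<in> unitary_group \<Longrightarrow> cadjoint g \<in> unitary_group"
  by (simp add: unitary_group_def)

lemma cadjoint_mult: "cadjoint (A ** B) = cadjoint B ** cadjoint A"
  by (simp add: cadjoint_def vec_eq_iff matrix_matrix_mult_def mult.commute)

lemma mat_1_unitary [simp]: "(mat 1 :: complex^'n^'n) \<in> unitary_group"
proof -
  have "cadjoint (mat 1) = (mat 1 :: complex^'n^'n)"
    by (auto simp: vec_eq_iff mat_def)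
  then show ?thesis by (simp add: unitary_group_def)
qed

lemma unitary_cadjoint_mv:
  assumes "g \<in> unitary_group"
  shows "cadjoint g *v (g *v n) = n" "g *v (cadjoint g *v n) = n"
  using assms by (simp_all add: matrix_vector_mul_assoc unitary_group_def)

lemma SU3_unitary: "g \<in> SU3 \<Longrightarrow> g \<in> unitary_group"
  by (simp add: SU3_def)

lemma det_cadjoint: "det (cadjoint g) = cnj (det (g :: complex^3^3))"
  by (simp add: det_3 cadjoint_def)

lemma cadjoint_SU3: "g \<in> SU3 \<Longrightarrow> cadjoint g \<in> SU3"
  by (simp add: SU3_def cadjoint_unitary det_cadjoint)

lemma matrix_inv_SU3: "g \<in> SU3 \<Longrightarrow> matrix_inv g = cadjoint g"
  by (simp add: SU3_unitary matrix_inv_unitary)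

lemma op_apply_op_mult: "op_apply I (op_mult I A B) v = op_apply I A (op_apply I B v)"
proof
  fix i
  have "op_apply I (op_mult I A B) v i = (\<Sum>k\<in>I. \<Sum>j\<in>I. A (i, j) * B (j, k) * v k)"
    by (simp add: op_apply_def op_mult_def sum_distrib_right)
  also have "\<dots> = (\<Sum>j\<in>I. \<Sum>k\<in>I. A (i, j) * B (j, k) * v k)" by (rule sum.swap)
  finally show "op_apply I (op_mult I A B) v i = op_apply I A (op_apply I B v) i"
    by (simp add: op_apply_def sum_distrib_left mult.assoc)
qed

lemma cinner_op_apply: "cinner I v (op_apply I A w) = cinner I (op_apply I (op_adj A) v) w"
proof -
  have "cinner I v (op_apply I A w) = (\<Sum>i\<in>I. \<Sum>j\<in>I. cnj (v i) * A (i, j) * w j)"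
    by (simp add: cinner_def op_apply_def sum_distrib_left mult.assoc)
  also have "\<dots> = (\<Sum>j\<in>I. \<Sum>i\<in>I. cnj (v i) * A (i, j) * w j)" by (rule sum.swap)
  finally show ?thesis
    by (simp add: cinner_def op_apply_def op_adj_def sum_distrib_left sum_distrib_right mult_ac)
qed

lemma rho_unitary:
  assumes g: "g \<in> unitary_group" and "i \<in> mono_index p" "j \<in> mono_index p"
  shows "rho p g (i, j) = (\<Sum>w\<in>words p. \<Sum>a\<in>words p.
    sym_basis p i w * (\<Prod>k<p. cnj (g $ (w ! k) $ (a ! k))) * sym_basis p j a)"
  using assms
  by (simp add: rho_def cinner_def cnj_sym_basis tensor_act_def matrix_inv_unitary cadjoint_def
      sum_distrib_left mult.assoc)

text \<open>For unitary g the inverse has the entries \<open>cnj (g $ j $ i)\<close> and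
  \<open>sym_basis\<close> is real, so exchanging the two sums over words produces the
  adjoint.\<close>

lemma rho_matrix_inv:
  assumes g: "g \<in> unitary_group"
  shows "rho p (matrix_inv g) = op_adj (rho p g)"
proof
  fix x :: "mono \<times> mono"
  obtain i j where x: "x = (i, j)" by (rule prod.exhaust)
  show "rho p (matrix_inv g) x = op_adj (rho p g) x"
  proof (cases "i \<in> mono_index p \<and> j \<in> mono_index p")
    case True
    have "rho p (matrix_inv g) (i, j) = (\<Sum>w\<in>words p. \<Sum>a\<in>words p.
        sym_basis p i w * (\<Prod>k<p. g $ (a ! k) $ (w ! k)) * sym_basis p j a)"
      unfolding matrix_inv_unitary[OF g]
      using True by (simp add: rho_unitary[OF cadjoint_unitary[OF g]])
    also have "\<dots> = (\<Sum>a\<in>words p. \<Sum>w\<in>words p.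
        sym_basis p i w * (\<Prod>k<p. g $ (a ! k) $ (w ! k)) * sym_basis p j a)"
      by (rule sum.swap)
    also have "\<dots> = op_adj (rho p g) (i, j)"
      using True by (simp add: op_adj_def rho_unitary[OF g] cnj_sym_basis mult_ac)
    finally show ?thesis by (simp add: x)
  qed (auto simp: x rho_def op_adj_def)
qed

lemma rho_outside: "i \<notin> mono_index p \<or> j \<notin> mono_index p \<Longrightarrow> rho p g (i, j) = 0"
  by (auto simp: rho_def)

lemma coherent_outside: "i \<notin> mono_index p \<Longrightarrow> coherent p n i = 0"
  using coherent_in_cspace[of p n] unfolding cspace_def by blast

text \<open>For unitary g the covector of n composed with the inverse of g is the covector of g n.
  The coordinates are turned back into a product tensor, on which the action factors over the
  letters, and the result is paired with the basis again.\<close>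

lemma vec_act_coherent:
  assumes g: "g \<in> unitary_group"
  shows "vec_act p g (coherent p n) = coherent p (g *v n)"
proof
  fix i
  show "vec_act p g (coherent p n) i = coherent p (g *v n) i"
  proof (cases "i \<in> mono_index p")
    case True
    have tensor: "(\<Sum>j\<in>mono_index p. \<Sum>a\<in>words p.
          (\<Prod>k<p. cnj (g $ (w ! k) $ (a ! k))) * sym_basis p j a * coherent p n j) =
        (\<Prod>k<p. cnj ((g *v n) $ (w ! k)))" for w
    proof -
      have "(\<Sum>j\<in>mono_index p. \<Sum>a\<in>words p.
          (\<Prod>k<p. cnj (g $ (w ! k) $ (a ! k))) * sym_basis p j a * coherent p n j) =
        (\<Sum>a\<in>words p. \<Sum>j\<in>mono_index p.
          (\<Prod>k<p. cnj (g $ (w ! k) $ (a ! k))) * sym_basis p j a * coherent p n j)"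
        by (rule sum.swap)
      also have "\<dots> = (\<Sum>a\<in>words p. (\<Prod>k<p. cnj (g $ (w ! k) $ (a ! k))) * (\<Prod>k<p. cnj (n $ (a ! k))))"
        by (intro sum.cong refl) (simp add: coherent_tensor[symmetric] sum_distrib_left mult.assoc)
      also have "\<dots> = (\<Sum>a\<in>words p. \<Prod>k<p. cnj (g $ (w ! k) $ (a ! k)) * cnj (n $ (a ! k)))"
        by (simp add: prod.distrib)
      also have "\<dots> = (\<Prod>k<p. \<Sum>b\<in>UNIV. cnj (g $ (w ! k) $ b) * cnj (n $ b))"
        by (rule sum_words_prod)
      finally show ?thesis by (simp add: matrix_vector_mult_def)
    qed
    have "vec_act p g (coherent p n) i = (\<Sum>j\<in>mono_index p. \<Sum>w\<in>words p. \<Sum>a\<in>words p.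
        sym_basis p i w * ((\<Prod>k<p. cnj (g $ (w ! k) $ (a ! k))) * sym_basis p j a * coherent p n j))"
      using True by (simp add: vec_act_def op_apply_def rho_unitary[OF g] sum_distrib_right mult.assoc)
    also have "\<dots> = (\<Sum>w\<in>words p. \<Sum>j\<in>mono_index p. \<Sum>a\<in>words p.
        sym_basis p i w * ((\<Prod>k<p. cnj (g $ (w ! k) $ (a ! k))) * sym_basis p j a * coherent p n j))"
      by (rule sum.swap)
    also have "\<dots> = (\<Sum>w\<in>words p. sym_basis p i w * (\<Prod>k<p. cnj ((g *v n) $ (w ! k))))"
      unfolding tensor[symmetric] sum_distrib_left ..
    also have "\<dots> = coherent p (g *v n) i" by (rule sym_basis_pairing[OF True])
    finally show ?thesis .
  next
    case False
    then show ?thesis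
      by (simp add: vec_act_def op_apply_def rho_outside coherent_outside)
  qed
qed

lemma op_act_unitary:
  assumes "g \<in> unitary_group"
  shows "op_act p g A =
    op_mult (mono_index p) (rho p g) (op_mult (mono_index p) A (op_adj (rho p g)))"
  by (simp add: op_act_def rho_matrix_inv[OF assms])

lemma husimi_op_act:
  assumes g: "g \<in> unitary_group"
  shows "husimi p (op_act p g A) n = husimi p A (cadjoint g *v n)"
proof -
  have R: "op_apply (mono_index p) (op_adj (rho p g)) (coherent p n) = coherent p (cadjoint g *v n)"
    using vec_act_coherent[OF cadjoint_unitary[OF g]] rho_matrix_inv[OF g]
    by (simp add: vec_act_def matrix_inv_unitary[OF g])
  then show ?thesis
    unfolding husimi_def coherent_def[symmetric] op_act_unitary[OF g]
    by (simp add: op_apply_op_mult cinner_op_apply[of _ _ "rho p g"])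
qed

text \<open>For a unit vector this is the projection onto the line of the coherent state. Scaling n
  by c multiplies it by the 2p-th power of the modulus of c.\<close>

definition coherent_proj :: "nat \<Rightarrow> complex^3 \<Rightarrow> operator" where
  "coherent_proj p n = (\<lambda>(i, j). coherent p n i * cnj (coherent p n j))"

lemma coherent_proj_in_ops [simp]: "coherent_proj p n \<in> ops (mono_index p)"
  using coherent_in_cspace[of p n] by (auto simp: coherent_proj_def cspace_def)

lemma op_act_coherent_proj:
  assumes g: "g \<in> unitary_group"
  shows "op_act p g (coherent_proj p n) = coherent_proj p (g *v n)"
proof
  fix x :: "mono \<times> mono"
  obtain i j where x: "x = (i, j)" by (rule prod.exhaust)
  have R: "coherent p (g *v n) i = (\<Sum>j\<in>mono_index p. rho p g (i, j) * coherent p n j)" for i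
    unfolding vec_act_coherent[OF g, symmetric] by (simp add: vec_act_def op_apply_def)
  let ?f = "\<lambda>k l. rho p g (i, k) * coherent p n k * (cnj (rho p g (j, l)) * cnj (coherent p n l))"
  have "op_act p g (coherent_proj p n) x = (\<Sum>k\<in>mono_index p. \<Sum>l\<in>mono_index p. ?f k l)"
    unfolding op_act_unitary[OF g]
    by (simp add: x coherent_proj_def op_mult_def op_adj_def sum_distrib_left mult_ac)
  also have "\<dots> = coherent p (g *v n) i * cnj (coherent p (g *v n) j)"
    by (simp add: R sum_product)
  finally show "op_act p g (coherent_proj p n) x = coherent_proj p (g *v n) x"
    by (simp add: x coherent_proj_def)
qed

lemma coherent_proj_phase:
  assumes "cmod c = 1"
  shows "coherent_proj p (c *s n) = coherent_proj p n"
proof -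
  have "cnj c ^ p * c ^ p = 1"
    using assms by (simp add: power_mult_distrib[symmetric] complex_norm_square[symmetric] mult.commute[of "cnj c"])
  then have c: "cnj c ^ p * x * (c ^ p * y) = x * y" for x y
    by (simp add: mult.left_commute[of x] mult.assoc[symmetric])
  show ?thesis
    by (simp only: coherent_proj_def coherent_scale complex_cnj_mult complex_cnj_power complex_cnj_cnj c)
qed

lemma op_trace_coherent_proj:
  "op_trace (mono_index p) (op_mult (mono_index p) A (coherent_proj p n)) = husimi p A n"
  by (simp add: op_trace_def op_mult_def husimi_coherent coherent_proj_def mult_ac)

section \<open>The matrix exponential\<close>

lemma matrix_scaleR_mult:
  fixes A :: "complex^'n^'n"
  shows "(t *\<^sub>R A) ** B = t *\<^sub>R (A ** B)" and "A ** (t *\<^sub>R B) = t *\<^sub>R (A ** B)"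
  by (simp_all add: vec_eq_iff matrix_matrix_mult_def scaleR_sum_right)

lemma matrix_power_scaleR:
  fixes X :: "complex^'n^'n"
  shows "(((**) (t *\<^sub>R X)) ^^ k) (mat 1) = t ^ k *\<^sub>R (((**) X) ^^ k) (mat 1)"
  by (induction k) (simp_all add: matrix_scaleR_mult)

text \<open>The norm on matrices here need not be submultiplicative. Bilinearity in finite dimension
  supplies a constant K, and the k-th power of X is dominated by the k-th power of
  \<open>norm X * K\<close>.\<close>

lemma summable_mexp:
  fixes X :: "complex^'n^'n"
  shows "summable (\<lambda>k. (1 / fact k) *\<^sub>R (((**) X) ^^ k) (mat 1))"
proof -
  have "(A + B) ** C = A ** C + B ** C" for A B C :: "complex^'n^'n"
    by (simp add: vec_eq_iff matrix_matrix_mult_def distrib_right sum.distrib)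
  then have "bilinear ((**) :: complex^'n^'n \<Rightarrow> complex^'n^'n \<Rightarrow> complex^'n^'n)"
    unfolding bilinear_def
    by (intro conjI allI linearI) (simp_all add: matrix_add_ldistrib matrix_scaleR_mult)
  then have "bounded_bilinear ((**) :: complex^'n^'n \<Rightarrow> complex^'n^'n \<Rightarrow> complex^'n^'n)"
    by (rule bilinear_conv_bounded_bilinear[THEN iffD1])
  from bounded_bilinear.pos_bounded[OF this]
  obtain K where K: "K > 0"
    "\<And>A B. norm ((A :: complex^'n^'n) ** (B :: complex^'n^'n)) \<le> norm A * norm B * K"
    by blast
  define r where "r = norm X * K"
  have bound: "norm ((((**) X) ^^ k) (mat 1)) \<le> norm (mat 1 :: complex^'n^'n) * r ^ k" for k
  proof (induction k)
    case (Suc k)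
    have "norm ((((**) X) ^^ Suc k) (mat 1)) \<le> norm X * norm ((((**) X) ^^ k) (mat 1)) * K"
      using K(2) by simp
    also have "\<dots> = r * norm ((((**) X) ^^ k) (mat 1))" by (simp add: r_def)
    also have "\<dots> \<le> r * (norm (mat 1 :: complex^'n^'n) * r ^ k)"
      using Suc K(1) by (intro mult_left_mono) (auto simp: r_def)
    finally show ?case by (simp add: mult_ac)
  qed simp
  show ?thesis
  proof (rule summable_comparison_test')
    show "summable (\<lambda>k. norm (mat 1 :: complex^'n^'n) * (r ^ k /\<^sub>R fact k))"
      by (intro summable_mult summable_exp_generic)
    show "norm ((1 / fact k) *\<^sub>R (((**) X) ^^ k) (mat 1)) \<le>
        norm (mat 1 :: complex^'n^'n) * (r ^ k /\<^sub>R fact k)" if "k \<ge> 0" for k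
      using bound[of k] by (simp add: field_simps)
  qed
qed

lemma mexp_nth_sums:
  fixes X :: "complex^'n^'n"
  shows "(\<lambda>k. (1 / fact k) *\<^sub>R ((((**) X) ^^ k) (mat 1) $ i $ j)) sums (mexp X $ i $ j)"
proof -
  have "(\<lambda>k. (1 / fact k) *\<^sub>R (((**) X) ^^ k) (mat 1)) sums mexp X"
    unfolding mexp_def by (rule summable_sums[OF summable_mexp])
  from bounded_linear.sums[OF bounded_linear_vec_nth[of i] this]
  have "(\<lambda>k. ((1 / fact k) *\<^sub>R (((**) X) ^^ k) (mat 1)) $ i) sums (mexp X $ i)" .
  from bounded_linear.sums[OF bounded_linear_vec_nth[of j] this] show ?thesis
    by (simp only: vector_scaleR_component)
qed

text \<open>Each entry is an everywhere convergent power series in t. Its formal derivative has the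
  coefficients of X times the exponential, because the recursion for powers multiplies by X on the
  left.\<close>

lemma mexp_has_vector_derivative:
  fixes X :: "complex^'n^'n"
  shows "((\<lambda>t. mexp (t *\<^sub>R X) $ i $ j) has_vector_derivative (X ** mexp (t *\<^sub>R X)) $ i $ j) (at t)"
proof -
  define c where "c i j k = (1 / fact k) *\<^sub>R ((((**) X) ^^ k) (mat 1) $ i $ j)" for i j k
  have sums: "(\<lambda>k. c i j k * of_real t ^ k) sums (mexp (t *\<^sub>R X) $ i $ j)" for i j and t :: real
  proof -
    have "(1 / fact k) *\<^sub>R ((t ^ k *\<^sub>R (((**) X) ^^ k) (mat 1)) $ i $ j) = c i j k * of_real t ^ k" for k
      unfolding c_def vector_scaleR_component by (simp add: scaleR_conv_of_real)
    then show ?thesis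
      using mexp_nth_sums[of "t *\<^sub>R X" i j] by (simp only: matrix_power_scaleR)
  qed
  \<comment> \<open>Convergence is known at real arguments only; a real point of modulus larger than
    that of z gives it at z.\<close>
  have summable: "summable (\<lambda>k. c i j k * z ^ k)" for i j and z :: complex
  proof -
    have "summable (\<lambda>k. c i j k * of_real (norm z + 1) ^ k)"
      using sums[of i j "norm z + 1"] by (rule sums_summable)
    moreover have "norm z < norm (of_real (norm z + 1) :: complex)"
      unfolding norm_of_real by simp
    ultimately show ?thesis by (rule powser_inside)
  qed
  have diffs: "diffs (c i j) k = (\<Sum>l\<in>UNIV. X $ i $ l * c l j k)" for k
  proof -
    have "diffs (c i j) k = (1 / fact k) *\<^sub>R ((((**) X) ^^ Suc k) (mat 1) $ i $ j)"
    proof -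
      have "of_nat (Suc k) * ((1 / fact (Suc k)) *\<^sub>R x) = (1 / fact k) *\<^sub>R x" for x :: complex
      proof -
        have "of_nat (Suc k) * ((1 / fact (Suc k)) *\<^sub>R x) = (real (Suc k) * (1 / fact (Suc k))) *\<^sub>R x"
          by (simp add: scaleR_conv_of_real del: of_nat_Suc fact_Suc)
        also have "real (Suc k) * (1 / fact (Suc k)) = 1 / fact k" by (simp del: of_nat_Suc)
        finally show ?thesis .
      qed
      then show ?thesis by (simp only: diffs_def c_def)
    qed
    also have "\<dots> = (\<Sum>l\<in>UNIV. X $ i $ l * c l j k)"
      by (simp add: c_def matrix_matrix_mult_def scaleR_sum_right)
    finally show ?thesis .
  qed
  have "((\<lambda>z. \<Sum>k. c i j k * z ^ k) has_field_derivative (\<Sum>k. diffs (c i j) k * of_real t ^ k))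
      (at (of_real t))"
    by (rule termdiffs_strong_converges_everywhere[OF summable])
  then have "((\<lambda>t. \<Sum>k. c i j k * of_real t ^ k) has_vector_derivative
      (\<Sum>k. diffs (c i j) k * of_real t ^ k)) (at t)"
    by (rule has_vector_derivative_real_field)
  moreover have "(\<Sum>k. c i j k * of_real t ^ k) = mexp (t *\<^sub>R X) $ i $ j" for i j t
    using sums[of i j t] by (rule sums_unique[symmetric])
  moreover have "(\<Sum>k. diffs (c i j) k * of_real t ^ k) = (X ** mexp (t *\<^sub>R X)) $ i $ j"
  proof (rule sums_unique[symmetric])
    have "(\<lambda>k. \<Sum>l\<in>UNIV. X $ i $ l * (c l j k * of_real t ^ k)) sums
        (\<Sum>l\<in>UNIV. X $ i $ l * mexp (t *\<^sub>R X) $ l $ j)"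
      by (intro sums_sum sums_mult sums)
    then show "(\<lambda>k. diffs (c i j) k * of_real t ^ k) sums (X ** mexp (t *\<^sub>R X)) $ i $ j"
      by (simp add: diffs matrix_matrix_mult_def sum_distrib_right mult.assoc)
  qed
  ultimately show ?thesis by (simp only:)
qed

lemma mexp_0: "mexp (0 :: complex^'n^'n) = mat 1"
proof -
  have "(\<lambda>k. (1 / fact k) *\<^sub>R ((((**) (0 :: complex^'n^'n)) ^^ k) (mat 1))) = (\<lambda>k. if k = 0 then mat 1 else 0)"
  proof
    fix k show "(1 / fact k) *\<^sub>R ((((**) (0 :: complex^'n^'n)) ^^ k) (mat 1)) = (if k = 0 then mat 1 else 0)"
      by (cases k) simp_all
  qed
  then show ?thesis
    unfolding mexp_def using sums_unique[OF sums_single[of 0 "\<lambda>_. mat 1 :: complex^'n^'n"]] by simp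
qed

text \<open>With G the exponential, the derivative of \<open>cadjoint G ** G\<close> is
  \<open>cadjoint G ** (cadjoint X + X) ** G\<close>, which is zero. The product is thus constant
  and equal to its value at t = 0.\<close>

lemma mexp_unitary:
  fixes X :: "complex^'n^'n"
  assumes X: "cadjoint X = - X"
  shows "mexp (t *\<^sub>R X) \<in> unitary_group"
proof -
  let ?G = "\<lambda>t. mexp (t *\<^sub>R X)"
  have const: "(cadjoint (?G t) ** ?G t) $ i $ j = (cadjoint (?G 0) ** ?G 0) $ i $ j" for i j
  proof -
    have "((\<lambda>t. (cadjoint (?G t) ** ?G t) $ i $ j) has_vector_derivative 0) (at t)" for t
    proof -
      have "((\<lambda>t. \<Sum>k\<in>UNIV. cnj (?G t $ k $ i) * ?G t $ k $ j) has_vector_derivative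
          (\<Sum>k\<in>UNIV. cnj (?G t $ k $ i) * (X ** ?G t) $ k $ j + cnj ((X ** ?G t) $ k $ i) * ?G t $ k $ j)) (at t)"
        by (intro has_vector_derivative_sum has_vector_derivative_mult
            bounded_linear.has_vector_derivative[OF bounded_linear_cnj] mexp_has_vector_derivative)
      also have "(\<Sum>k\<in>UNIV. cnj (?G t $ k $ i) * (X ** ?G t) $ k $ j + cnj ((X ** ?G t) $ k $ i) * ?G t $ k $ j)
          = (cadjoint (?G t) ** (X ** ?G t) + cadjoint (X ** ?G t) ** ?G t) $ i $ j"
        by (simp add: matrix_matrix_mult_def sum.distrib)
      also have "cadjoint (?G t) ** (X ** ?G t) + cadjoint (X ** ?G t) ** ?G t = 0"
      proof -
        have "cadjoint (X ** ?G t) ** ?G t = cadjoint (?G t) ** (- X ** ?G t)"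
          by (simp add: cadjoint_mult X matrix_mul_assoc)
        moreover have "- X ** ?G t = - (X ** ?G t)"
          by (simp add: matrix_matrix_mult_def vec_eq_iff sum_negf)
        moreover have "A ** (- B) = - (A ** B)" for A B :: "complex^'n^'n"
          by (simp add: matrix_matrix_mult_def vec_eq_iff sum_negf)
        ultimately show ?thesis by simp
      qed
      finally show ?thesis by (simp add: matrix_matrix_mult_def)
    qed
    then have "((\<lambda>t. (cadjoint (?G t) ** ?G t) $ i $ j) has_derivative (\<lambda>h. 0)) (at t within UNIV)" for t
      by (simp add: has_vector_derivative_def)
    from has_derivative_zero_unique[OF convex_UNIV this] show ?thesis by blast
  qed
  have "cadjoint (?G t) ** ?G t = cadjoint (?G 0) ** ?G 0" using const by (simp add: vec_eq_iff)
  also have "\<dots> = mat 1"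
    using mat_1_unitary by (simp add: mexp_0 unitary_group_def)
  finally have "cadjoint (?G t) ** ?G t = mat 1" .
  moreover from this have "?G t ** cadjoint (?G t) = mat 1" by (simp add: matrix_left_right_inverse)
  ultimately show ?thesis by (simp add: unitary_group_def)
qed

section \<open>The derived representation\<close>

text \<open>The derived action of a matrix in the basis \<open>sym_basis\<close>: a covector with polynomial
  \<open>P\<close> goes to the one with polynomial \<open>- (\<Sum>a b. X $ a $ b * x\<^sub>b * \<partial>P / \<partial>x\<^sub>a)\<close>; the
  signs of the \<open>(1, 3)\<close> and \<open>(3, 1)\<close> entries come from \<open>check_e\<close>.\<close>

fun ladder :: "nat \<Rightarrow> complex^3^3 \<Rightarrow> mono \<times> mono \<Rightarrow> complex" where
  "ladder p X ((j, k, l), (j', k', l')) = of_bool (j + k + l = p \<and> j' + k' + l' = p) * (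
     of_bool (j = j' \<and> k = k' \<and> l = l') *
       - (of_nat j * X $ 3 $ 3 + of_nat k * X $ 2 $ 2 + of_nat l * X $ 1 $ 1) +
     of_bool (j = Suc j' \<and> k' = Suc k \<and> l = l') * (X $ 2 $ 3 * of_real (sqrt (real j * real k'))) +
     of_bool (j = Suc j' \<and> l' = Suc l \<and> k = k') * (- X $ 1 $ 3 * of_real (sqrt (real j * real l'))) +
     of_bool (k = Suc k' \<and> j' = Suc j \<and> l = l') * (X $ 3 $ 2 * of_real (sqrt (real k * real j'))) +
     of_bool (k = Suc k' \<and> l' = Suc l \<and> j = j') * (X $ 1 $ 2 * of_real (sqrt (real k * real l'))) +
     of_bool (l = Suc l' \<and> j' = Suc j \<and> k = k') * (- X $ 3 $ 1 * of_real (sqrt (real l * real j'))) +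
     of_bool (l = Suc l' \<and> k' = Suc k \<and> j = j') * (X $ 2 $ 1 * of_real (sqrt (real l * real k'))))"

lemma ladder_outside: "i \<notin> mono_index p \<or> j \<notin> mono_index p \<Longrightarrow> ladder p X (i, j) = 0"
proof -
  obtain a b c a' b' c' where ij: "i = (a, b, c)" "j = (a', b', c')" by (metis surj_pair)
  assume "i \<notin> mono_index p \<or> j \<notin> mono_index p"
  then have no: "(a + b + c = p \<and> a' + b' + c' = p) = False" by (auto simp: ij)
  show ?thesis unfolding ij ladder.simps no by simp
qed

lemma ladder_add: "ladder p (X + Y) x = ladder p X x + ladder p Y x"
proof -
  obtain j k l j' k' l' where x: "x = ((j, k, l), (j', k', l'))" by (metis surj_pair)
  show ?thesis unfolding x ladder.simps by (simp only: vector_add_component) algebra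
qed

lemma ladder_scale: "ladder p (\<chi> a b. c * X $ a $ b) x = c * ladder p X x"
proof -
  obtain j k l j' k' l' where x: "x = ((j, k, l), (j', k', l'))" by (metis surj_pair)
  show ?thesis unfolding x ladder.simps by (simp only: vec_lambda_beta) algebra
qed

text \<open>The square roots are symmetric in the two monomials, so exchanging row and column
  exchanges the terms of \<open>X $ a $ b\<close> and \<open>X $ b $ a\<close>.\<close>

lemma ladder_cadjoint: "ladder p (cadjoint X) = op_adj (ladder p X)"
proof
  fix x :: "mono \<times> mono"
  obtain j k l j' k' l' where x: "x = ((j, k, l), (j', k', l'))" by (metis surj_pair)
  have b: "cnj (of_bool Q) = of_bool Q" for Q by (cases Q) simp_all
  show "ladder p (cadjoint X) x = op_adj (ladder p X) x"
    unfolding x op_adj_def prod.case ladder.simps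
    by (cases "j = j' \<and> k = k' \<and> l = l'")
      (simp_all only: cadjoint_nth complex_cnj_mult complex_cnj_add complex_cnj_minus b
        complex_cnj_of_nat complex_cnj_complex_of_real eq_commute[of j' j] eq_commute[of k' k]
        eq_commute[of l' l] conj_ac add_ac mult_ac of_bool_eq mult_zero_left mult_zero_right
        complex_cnj_zero)
qed

definition multinomial_root :: "nat \<Rightarrow> nat \<Rightarrow> nat \<Rightarrow> nat \<Rightarrow> real" where
  "multinomial_root p j k l = sqrt (fact p / (fact j * fact k * fact l))"

text \<open>One unit moves from exponent b to exponent a. The matrix element times the normalisation
  of the source monomial is the factor produced by differentiation times the normalisation of the
  target monomial.\<close>

lemma hop_coefficient:
  assumes "c > 0"
  shows "sqrt (real (Suc a) * real (Suc b)) * sqrt (P / (fact a * fact (Suc b) * c)) =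
    real (Suc a) * sqrt (P / (fact (Suc a) * fact b * c))"
proof -
  have "real (Suc a) * real (Suc b) * (P / (fact a * fact (Suc b) * c)) =
      (real (Suc a))\<^sup>2 * (P / (fact (Suc a) * fact b * c))"
    using assms by (simp add: divide_simps power2_eq_square)
  then have "sqrt (real (Suc a) * real (Suc b) * (P / (fact a * fact (Suc b) * c))) =
      sqrt ((real (Suc a))\<^sup>2 * (P / (fact (Suc a) * fact b * c)))" by (simp only:)
  then show ?thesis by (simp only: real_sqrt_mult real_sqrt_abs abs_of_nat)
qed

lemma multinomial_root_hops:
  "sqrt (real (Suc j) * real (Suc k)) * multinomial_root p j (Suc k) l = real (Suc j) * multinomial_root p (Suc j) k l"
  "sqrt (real (Suc j) * real (Suc l)) * multinomial_root p j k (Suc l) = real (Suc j) * multinomial_root p (Suc j) k l"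
  "sqrt (real (Suc k) * real (Suc j)) * multinomial_root p (Suc j) k l = real (Suc k) * multinomial_root p j (Suc k) l"
  "sqrt (real (Suc k) * real (Suc l)) * multinomial_root p j k (Suc l) = real (Suc k) * multinomial_root p j (Suc k) l"
  "sqrt (real (Suc l) * real (Suc j)) * multinomial_root p (Suc j) k l = real (Suc l) * multinomial_root p j k (Suc l)"
  "sqrt (real (Suc l) * real (Suc k)) * multinomial_root p j (Suc k) l = real (Suc l) * multinomial_root p j k (Suc l)"
proof -
  note hop = hop_coefficient[where P = "fact p", OF fact_gt_zero]
  show "sqrt (real (Suc j) * real (Suc k)) * multinomial_root p j (Suc k) l = real (Suc j) * multinomial_root p (Suc j) k l"
    using hop[of j k l] by (simp only: multinomial_root_def)
  show "sqrt (real (Suc j) * real (Suc l)) * multinomial_root p j k (Suc l) = real (Suc j) * multinomial_root p (Suc j) k l"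
    using hop[of j l k] by (simp only: multinomial_root_def mult_ac)
  show "sqrt (real (Suc k) * real (Suc j)) * multinomial_root p (Suc j) k l = real (Suc k) * multinomial_root p j (Suc k) l"
    using hop[of k j l] by (simp only: multinomial_root_def mult_ac)
  show "sqrt (real (Suc k) * real (Suc l)) * multinomial_root p j k (Suc l) = real (Suc k) * multinomial_root p j (Suc k) l"
    using hop[of k l j] by (simp only: multinomial_root_def mult_ac)
  show "sqrt (real (Suc l) * real (Suc j)) * multinomial_root p (Suc j) k l = real (Suc l) * multinomial_root p j k (Suc l)"
    using hop[of l j k] by (simp only: multinomial_root_def mult_ac)
  show "sqrt (real (Suc l) * real (Suc k)) * multinomial_root p j (Suc k) l = real (Suc l) * multinomial_root p j k (Suc l)"
    using hop[of l k j] by (simp only: multinomial_root_def mult_ac)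
qed

text \<open>The guard Q handles hops that would make an exponent negative: there b, computed with
  truncated subtraction, need not be an index.\<close>

lemma sum_hop:
  assumes "finite I" "Q \<Longrightarrow> b \<in> I"
  shows "(\<Sum>i\<in>I. of_bool (Q \<and> i = b) * c * f i) = of_bool Q * c * (f b :: complex)"
proof -
  have "(\<Sum>i\<in>I. of_bool (Q \<and> i = b) * c * f i) = (\<Sum>i\<in>I. if i = b then of_bool Q * c * f b else 0)"
    by (intro sum.cong refl) auto
  then show ?thesis using assms by auto
qed

lemma ladder_row:
  assumes "j + k + l = p" "i \<in> mono_index p"
  shows "ladder p X ((j, k, l), i) =
     of_bool (True \<and> i = (j, k, l)) * - (of_nat j * X $ 3 $ 3 + of_nat k * X $ 2 $ 2 + of_nat l * X $ 1 $ 1) +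
     of_bool (j > 0 \<and> i = (j - 1, Suc k, l)) * (X $ 2 $ 3 * of_real (sqrt (real j * real (Suc k)))) +
     of_bool (j > 0 \<and> i = (j - 1, k, Suc l)) * (- X $ 1 $ 3 * of_real (sqrt (real j * real (Suc l)))) +
     of_bool (k > 0 \<and> i = (Suc j, k - 1, l)) * (X $ 3 $ 2 * of_real (sqrt (real k * real (Suc j)))) +
     of_bool (k > 0 \<and> i = (j, k - 1, Suc l)) * (X $ 1 $ 2 * of_real (sqrt (real k * real (Suc l)))) +
     of_bool (l > 0 \<and> i = (Suc j, k, l - 1)) * (- X $ 3 $ 1 * of_real (sqrt (real l * real (Suc j)))) +
     of_bool (l > 0 \<and> i = (j, Suc k, l - 1)) * (X $ 2 $ 1 * of_real (sqrt (real l * real (Suc k))))"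
proof -
  obtain j' k' l' where i: "i = (j', k', l')" by (metis surj_pair)
  have one: "(j + k + l = p \<and> j' + k' + l' = p) = True" using assms by (simp add: i)
  have hop: "of_bool (a = Suc a' \<and> b' = Suc b \<and> c = c') * (x * of_real (sqrt (real a * real b'))) =
      of_bool (a > 0 \<and> (a', b', c') = (a - 1, Suc b, c)) * (x * of_real (sqrt (real a * real (Suc b))))"
    for a b c a' b' c' :: nat and x :: complex
    by (cases "a = Suc a' \<and> b' = Suc b \<and> c = c'") auto
  show ?thesis
    unfolding i ladder.simps one hop by (simp only: of_bool_eq mult_1_left prod.inject conj_ac simp_thms eq_commute)
qed

lemma hop_swap:
  assumes "s * w' = real m * w"
  shows "(x * of_real s) * (of_real w' * y) = of_real w * (of_nat m * (x * (y :: complex)))"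
proof -
  have "of_real s * of_real w' = of_nat m * (of_real w :: complex)"
    using arg_cong[OF assms, of complex_of_real] by simp
  then show ?thesis by (simp add: mult.assoc mult.left_commute[of x])
qed

text \<open>The right-hand side is the product rule for y1^j y2^k y3^l along a linear vector field
  in (y1, y2, y3) = \<open>theta n\<close>. The truncated exponents j - 1, k - 1, l - 1 are harmless
  because of the factors j, k, l in front.\<close>

lemma ladder_coherent:
  fixes n :: "complex^3"
  assumes p: "j + k + l = p"
  defines "y1 \<equiv> - cnj (n $ 3)" and "y2 \<equiv> cnj (n $ 2)" and "y3 \<equiv> - cnj (n $ 1)"
  shows "op_apply (mono_index p) (ladder p X) (coherent p n) (j, k, l) =
    of_real (multinomial_root p j k l) *
     (of_nat j * y1 ^ (j - 1) * (- (X $ 3 $ 3) * y1 + X $ 2 $ 3 * y2 - X $ 1 $ 3 * y3) * y2 ^ k * y3 ^ l +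
      y1 ^ j * (of_nat k * y2 ^ (k - 1) * (X $ 3 $ 2 * y1 - X $ 2 $ 2 * y2 + X $ 1 $ 2 * y3)) * y3 ^ l +
      y1 ^ j * y2 ^ k * (of_nat l * y3 ^ (l - 1) * (- (X $ 3 $ 1) * y1 + X $ 2 $ 1 * y2 - X $ 1 $ 1 * y3)))"
proof -
  let ?w = "of_real (multinomial_root p j k l) :: complex"
  let ?c = "coherent p n"
  have coh: "?c (a, b, c) = of_real (multinomial_root p a b c) * (y1 ^ a * y2 ^ b * y3 ^ c)"
    if "a + b + c = p" for a b c
    using that by (simp add: coherent_apply multinomial_root_def y1_def y2_def y3_def)
  have h1: "of_bool (j > 0) * (x * of_real (sqrt (real j * real (Suc k)))) * ?c (j - 1, Suc k, l) =
      ?w * (of_nat j * (x * y2) * (y1 ^ (j - 1) * y2 ^ k * y3 ^ l))" for x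
  proof (cases j)
    case (Suc a)
    have c: "?c (a, Suc k, l) = of_real (multinomial_root p a (Suc k) l) * (y1 ^ a * y2 ^ (Suc k) * y3 ^ l)"
      using p Suc by (intro coh) simp
    have "(x * of_real (sqrt (real (Suc a) * real (Suc k)))) * ?c (a, Suc k, l) =
        of_real (multinomial_root p (Suc a) k l) * (of_nat (Suc a) * (x * (y1 ^ a * y2 ^ (Suc k) * y3 ^ l)))"
      unfolding c by (rule hop_swap[OF multinomial_root_hops(1)])
    then show ?thesis
      by (simp only: Suc diff_Suc_1 zero_less_Suc of_bool_eq mult_1_left power_Suc mult_ac)
  qed simp
  have h2: "of_bool (j > 0) * (x * of_real (sqrt (real j * real (Suc l)))) * ?c (j - 1, k, Suc l) =
      ?w * (of_nat j * (x * y3) * (y1 ^ (j - 1) * y2 ^ k * y3 ^ l))" for x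
  proof (cases j)
    case (Suc a)
    have c: "?c (a, k, Suc l) = of_real (multinomial_root p a k (Suc l)) * (y1 ^ a * y2 ^ k * y3 ^ (Suc l))"
      using p Suc by (intro coh) simp
    have "(x * of_real (sqrt (real (Suc a) * real (Suc l)))) * ?c (a, k, Suc l) =
        of_real (multinomial_root p (Suc a) k l) * (of_nat (Suc a) * (x * (y1 ^ a * y2 ^ k * y3 ^ (Suc l))))"
      unfolding c by (rule hop_swap[OF multinomial_root_hops(2)])
    then show ?thesis
      by (simp only: Suc diff_Suc_1 zero_less_Suc of_bool_eq mult_1_left power_Suc mult_ac)
  qed simp
  have h3: "of_bool (k > 0) * (x * of_real (sqrt (real k * real (Suc j)))) * ?c (Suc j, k - 1, l) =
      ?w * (of_nat k * (x * y1) * (y1 ^ j * y2 ^ (k - 1) * y3 ^ l))" for x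
  proof (cases k)
    case (Suc a)
    have c: "?c (Suc j, a, l) = of_real (multinomial_root p (Suc j) a l) * (y1 ^ (Suc j) * y2 ^ a * y3 ^ l)"
      using p Suc by (intro coh) simp
    have "(x * of_real (sqrt (real (Suc a) * real (Suc j)))) * ?c (Suc j, a, l) =
        of_real (multinomial_root p j (Suc a) l) * (of_nat (Suc a) * (x * (y1 ^ (Suc j) * y2 ^ a * y3 ^ l)))"
      unfolding c by (rule hop_swap[OF multinomial_root_hops(3)])
    then show ?thesis
      by (simp only: Suc diff_Suc_1 zero_less_Suc of_bool_eq mult_1_left power_Suc mult_ac)
  qed simp
  have h4: "of_bool (k > 0) * (x * of_real (sqrt (real k * real (Suc l)))) * ?c (j, k - 1, Suc l) =
      ?w * (of_nat k * (x * y3) * (y1 ^ j * y2 ^ (k - 1) * y3 ^ l))" for x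
  proof (cases k)
    case (Suc a)
    have c: "?c (j, a, Suc l) = of_real (multinomial_root p j a (Suc l)) * (y1 ^ j * y2 ^ a * y3 ^ (Suc l))"
      using p Suc by (intro coh) simp
    have "(x * of_real (sqrt (real (Suc a) * real (Suc l)))) * ?c (j, a, Suc l) =
        of_real (multinomial_root p j (Suc a) l) * (of_nat (Suc a) * (x * (y1 ^ j * y2 ^ a * y3 ^ (Suc l))))"
      unfolding c by (rule hop_swap[OF multinomial_root_hops(4)])
    then show ?thesis
      by (simp only: Suc diff_Suc_1 zero_less_Suc of_bool_eq mult_1_left power_Suc mult_ac)
  qed simp
  have h5: "of_bool (l > 0) * (x * of_real (sqrt (real l * real (Suc j)))) * ?c (Suc j, k, l - 1) =
      ?w * (of_nat l * (x * y1) * (y1 ^ j * y2 ^ k * y3 ^ (l - 1)))" for x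
  proof (cases l)
    case (Suc a)
    have c: "?c (Suc j, k, a) = of_real (multinomial_root p (Suc j) k a) * (y1 ^ (Suc j) * y2 ^ k * y3 ^ a)"
      using p Suc by (intro coh) simp
    have "(x * of_real (sqrt (real (Suc a) * real (Suc j)))) * ?c (Suc j, k, a) =
        of_real (multinomial_root p j k (Suc a)) * (of_nat (Suc a) * (x * (y1 ^ (Suc j) * y2 ^ k * y3 ^ a)))"
      unfolding c by (rule hop_swap[OF multinomial_root_hops(5)])
    then show ?thesis
      by (simp only: Suc diff_Suc_1 zero_less_Suc of_bool_eq mult_1_left power_Suc mult_ac)
  qed simp
  have h6: "of_bool (l > 0) * (x * of_real (sqrt (real l * real (Suc k)))) * ?c (j, Suc k, l - 1) =
      ?w * (of_nat l * (x * y2) * (y1 ^ j * y2 ^ k * y3 ^ (l - 1)))" for x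
  proof (cases l)
    case (Suc a)
    have c: "?c (j, Suc k, a) = of_real (multinomial_root p j (Suc k) a) * (y1 ^ j * y2 ^ (Suc k) * y3 ^ a)"
      using p Suc by (intro coh) simp
    have "(x * of_real (sqrt (real (Suc a) * real (Suc k)))) * ?c (j, Suc k, a) =
        of_real (multinomial_root p j k (Suc a)) * (of_nat (Suc a) * (x * (y1 ^ j * y2 ^ (Suc k) * y3 ^ a)))"
      unfolding c by (rule hop_swap[OF multinomial_root_hops(6)])
    then show ?thesis
      by (simp only: Suc diff_Suc_1 zero_less_Suc of_bool_eq mult_1_left power_Suc mult_ac)
  qed simp
  have pow: "of_nat m * z ^ m = of_nat m * z ^ (m - 1) * z" for m and z :: complex
    by (cases m) simp_all
  have "op_apply (mono_index p) (ladder p X) ?c (j, k, l) =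
     (\<Sum>i\<in>mono_index p. ladder p X ((j, k, l), i) * ?c i)" by (simp add: op_apply_def)
  also have "\<dots> = (\<Sum>i\<in>mono_index p. of_bool (True \<and> i = (j, k, l)) * - (of_nat j * X $ 3 $ 3 + of_nat k * X $ 2 $ 2 + of_nat l * X $ 1 $ 1) * ?c i) +
     (\<Sum>i\<in>mono_index p. of_bool (j > 0 \<and> i = (j - 1, Suc k, l)) * (X $ 2 $ 3 * of_real (sqrt (real j * real (Suc k)))) * ?c i) +
     (\<Sum>i\<in>mono_index p. of_bool (j > 0 \<and> i = (j - 1, k, Suc l)) * (- X $ 1 $ 3 * of_real (sqrt (real j * real (Suc l)))) * ?c i) +
     (\<Sum>i\<in>mono_index p. of_bool (k > 0 \<and> i = (Suc j, k - 1, l)) * (X $ 3 $ 2 * of_real (sqrt (real k * real (Suc j)))) * ?c i) +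
     (\<Sum>i\<in>mono_index p. of_bool (k > 0 \<and> i = (j, k - 1, Suc l)) * (X $ 1 $ 2 * of_real (sqrt (real k * real (Suc l)))) * ?c i) +
     (\<Sum>i\<in>mono_index p. of_bool (l > 0 \<and> i = (Suc j, k, l - 1)) * (- X $ 3 $ 1 * of_real (sqrt (real l * real (Suc j)))) * ?c i) +
     (\<Sum>i\<in>mono_index p. of_bool (l > 0 \<and> i = (j, Suc k, l - 1)) * (X $ 2 $ 1 * of_real (sqrt (real l * real (Suc k)))) * ?c i)"
    by (simp only: ladder_row[OF p] distrib_right sum.distrib cong: sum.cong)
  also have "\<dots> = of_bool (True) * - (of_nat j * X $ 3 $ 3 + of_nat k * X $ 2 $ 2 + of_nat l * X $ 1 $ 1) * ?c (j, k, l) +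
     of_bool (j > 0) * (X $ 2 $ 3 * of_real (sqrt (real j * real (Suc k)))) * ?c (j - 1, Suc k, l) +
     of_bool (j > 0) * (- X $ 1 $ 3 * of_real (sqrt (real j * real (Suc l)))) * ?c (j - 1, k, Suc l) +
     of_bool (k > 0) * (X $ 3 $ 2 * of_real (sqrt (real k * real (Suc j)))) * ?c (Suc j, k - 1, l) +
     of_bool (k > 0) * (X $ 1 $ 2 * of_real (sqrt (real k * real (Suc l)))) * ?c (j, k - 1, Suc l) +
     of_bool (l > 0) * (- X $ 3 $ 1 * of_real (sqrt (real l * real (Suc j)))) * ?c (Suc j, k, l - 1) +
     of_bool (l > 0) * (X $ 2 $ 1 * of_real (sqrt (real l * real (Suc k)))) * ?c (j, Suc k, l - 1)"
    by (intro arg_cong2[of _ _ _ _ "(+)"] sum_hop finite_mono_index) (use p in auto)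
  also have "\<dots> = ?w * (- (of_nat j * X $ 3 $ 3 + of_nat k * X $ 2 $ 2 + of_nat l * X $ 1 $ 1) * (y1 ^ j * y2 ^ k * y3 ^ l) +
     of_nat j * (X $ 2 $ 3 * y2) * (y1 ^ (j - 1) * y2 ^ k * y3 ^ l) +
     of_nat j * (- X $ 1 $ 3 * y3) * (y1 ^ (j - 1) * y2 ^ k * y3 ^ l) +
     of_nat k * (X $ 3 $ 2 * y1) * (y1 ^ j * y2 ^ (k - 1) * y3 ^ l) +
     of_nat k * (X $ 1 $ 2 * y3) * (y1 ^ j * y2 ^ (k - 1) * y3 ^ l) +
     of_nat l * (- X $ 3 $ 1 * y1) * (y1 ^ j * y2 ^ k * y3 ^ (l - 1)) +
     of_nat l * (X $ 2 $ 1 * y2) * (y1 ^ j * y2 ^ k * y3 ^ (l - 1)))"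
    unfolding h1 h2 h3 h4 h5 h6 coh[OF p] by (simp only: of_bool_eq mult_1_left distrib_left mult_ac)
  also have "\<dots> = ?w * (- X $ 3 $ 3 * (of_nat j * y1 ^ j) * y2 ^ k * y3 ^ l
     - X $ 2 $ 2 * (of_nat k * y2 ^ k) * y1 ^ j * y3 ^ l - X $ 1 $ 1 * (of_nat l * y3 ^ l) * y1 ^ j * y2 ^ k +
     of_nat j * (X $ 2 $ 3 * y2) * (y1 ^ (j - 1) * y2 ^ k * y3 ^ l) +
     of_nat j * (- X $ 1 $ 3 * y3) * (y1 ^ (j - 1) * y2 ^ k * y3 ^ l) +
     of_nat k * (X $ 3 $ 2 * y1) * (y1 ^ j * y2 ^ (k - 1) * y3 ^ l) +
     of_nat k * (X $ 1 $ 2 * y3) * (y1 ^ j * y2 ^ (k - 1) * y3 ^ l) +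
     of_nat l * (- X $ 3 $ 1 * y1) * (y1 ^ j * y2 ^ k * y3 ^ (l - 1)) +
     of_nat l * (X $ 2 $ 1 * y2) * (y1 ^ j * y2 ^ k * y3 ^ (l - 1)))"
    by (simp add: algebra_simps)
  also have "\<dots> = ?w * (of_nat j * y1 ^ (j - 1) * (- (X $ 3 $ 3) * y1 + X $ 2 $ 3 * y2 - X $ 1 $ 3 * y3) * y2 ^ k * y3 ^ l +
      y1 ^ j * (of_nat k * y2 ^ (k - 1) * (X $ 3 $ 2 * y1 - X $ 2 $ 2 * y2 + X $ 1 $ 2 * y3)) * y3 ^ l +
      y1 ^ j * y2 ^ k * (of_nat l * y3 ^ (l - 1) * (- (X $ 3 $ 1) * y1 + X $ 2 $ 1 * y2 - X $ 1 $ 1 * y3)))"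
    unfolding pow[of j y1] pow[of k y2] pow[of l y3] by (simp add: algebra_simps)
  finally show ?thesis .
qed

lemma has_vector_derivative_power_complex:
  fixes f :: "real \<Rightarrow> complex"
  assumes "(f has_vector_derivative f') (at x)"
  shows "((\<lambda>t. f t ^ m) has_vector_derivative of_nat m * f x ^ (m - 1) * f') (at x)"
proof -
  have "((\<lambda>z. z ^ m) has_field_derivative of_nat m * f x ^ (m - 1)) (at (f x))"
    by (auto intro!: derivative_eq_intros)
  from field_vector_diff_chain_at[OF assms this] show ?thesis by (simp add: o_def mult.commute)
qed

text \<open>The coherent state depends on the conjugate of n, so its derivative involves conjugated
  entries of X. For anti-Hermitian X these are \<open>- X $ b $ a\<close>, which makes the result
  linear in X and matches \<open>ladder\<close>.\<close>

lemma coherent_mexp_has_vector_derivative: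
  assumes X: "cadjoint X = - X"
  shows "((\<lambda>t. coherent p (mexp (t *\<^sub>R X) *v n) i) has_vector_derivative
    op_apply (mono_index p) (ladder p X) (coherent p n) i) (at 0)"
proof -
  obtain j k l where i: "i = (j, k, l)" by (metis surj_pair)
  show ?thesis
  proof (cases "j + k + l = p")
    case False
    then have "i \<notin> mono_index p" by (simp add: i)
    then have "op_apply (mono_index p) (ladder p X) (coherent p n) i = 0"
      and "coherent p m i = 0" for m
      by (simp_all add: op_apply_def ladder_outside coherent_outside)
    then show ?thesis by simp
  next
    case True
    define m where "m t = mexp (t *\<^sub>R X) *v n" for t
    have m0: "m 0 = n" by (simp add: m_def mexp_0)
    have m: "((\<lambda>t. cnj (m t $ a)) has_vector_derivative (\<Sum>b\<in>UNIV. - X $ b $ a * cnj (n $ b))) (at 0)" for a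
    proof -
      have "((\<lambda>t. \<Sum>b\<in>UNIV. mexp (t *\<^sub>R X) $ a $ b * n $ b) has_vector_derivative
          (\<Sum>b\<in>UNIV. (X ** mexp (0 *\<^sub>R X)) $ a $ b * n $ b)) (at 0)"
        by (intro has_vector_derivative_sum has_vector_derivative_mult_left mexp_has_vector_derivative)
      then have "((\<lambda>t. m t $ a) has_vector_derivative (\<Sum>b\<in>UNIV. X $ a $ b * n $ b)) (at 0)"
        by (simp add: m_def matrix_vector_mult_def mexp_0)
      from bounded_linear.has_vector_derivative[OF bounded_linear_cnj this]
      have "((\<lambda>t. cnj (m t $ a)) has_vector_derivative (\<Sum>b\<in>UNIV. cnj (X $ a $ b) * cnj (n $ b))) (at 0)"
        by simp
      moreover have "cnj (X $ a $ b) = - X $ b $ a" for b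
        using arg_cong[OF X, of "\<lambda>M. M $ b $ a"] by simp
      ultimately show ?thesis by simp
    qed
    define w :: complex where "w = of_real (multinomial_root p j k l)"
    define y1 y2 y3 where "y1 = - cnj (n $ 3)" and "y2 = cnj (n $ 2)" and "y3 = - cnj (n $ 1)"
    note y_def = y1_def y2_def y3_def
    have d1: "((\<lambda>t. - cnj (m t $ 3)) has_vector_derivative - (X $ 3 $ 3) * y1 + X $ 2 $ 3 * y2 - X $ 1 $ 3 * y3) (at 0)"
      using has_vector_derivative_minus[OF m[of 3]] by (simp add: sum_3 y_def algebra_simps)
    have d2: "((\<lambda>t. cnj (m t $ 2)) has_vector_derivative X $ 3 $ 2 * y1 - X $ 2 $ 2 * y2 + X $ 1 $ 2 * y3) (at 0)"
      using m[of 2] by (simp add: sum_3 y_def algebra_simps)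
    have d3: "((\<lambda>t. - cnj (m t $ 1)) has_vector_derivative - (X $ 3 $ 1) * y1 + X $ 2 $ 1 * y2 - X $ 1 $ 1 * y3) (at 0)"
      using has_vector_derivative_minus[OF m[of 1]] by (simp add: sum_3 y_def algebra_simps)
    note d = has_vector_derivative_mult_right[OF has_vector_derivative_mult[OF
          has_vector_derivative_mult[OF has_vector_derivative_power_complex[OF d1, of j]
            has_vector_derivative_power_complex[OF d2, of k]]
          has_vector_derivative_power_complex[OF d3, of l]], of w]
    have f: "(\<lambda>t. coherent p (m t) i) =
        (\<lambda>t. w * ((- cnj (m t $ 3)) ^ j * cnj (m t $ 2) ^ k * (- cnj (m t $ 1)) ^ l))"
      using True by (simp add: i coherent_apply w_def multinomial_root_def mult.assoc)
    show ?thesis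
      unfolding m_def[symmetric] f unfolding i ladder_coherent[OF True] w_def[symmetric] y_def[symmetric]
      by (rule has_vector_derivative_eq_rhs[OF d]) (simp add: m0 flip: y_def, simp add: algebra_simps)
  qed
qed

lemma differentiable_prod_lessThan:
  fixes f :: "nat \<Rightarrow> real \<Rightarrow> complex"
  assumes "\<And>k. f k differentiable at x"
  shows "(\<lambda>t. \<Prod>k<p. f k t) differentiable at x"
  by (induction p) (auto intro!: differentiable_mult assms)

text \<open>Only existence is needed: it follows from the explicit finite sum, and the value is
  identified afterwards by testing on coherent states.\<close>

lemma rho_mexp_differentiable:
  assumes X: "cadjoint X = - X"
  shows "(\<lambda>t. rho p (mexp (t *\<^sub>R X)) (i, j)) differentiable at 0"
proof (cases "i \<in> mono_index p \<and> j \<in> mono_index p")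
  case True
  have "(\<lambda>t. cnj (mexp (t *\<^sub>R X) $ a $ b)) differentiable at 0" for a b
    using bounded_linear.has_vector_derivative[OF bounded_linear_cnj mexp_has_vector_derivative]
    by (rule differentiableI_vector)
  then show ?thesis
    using True unfolding rho_unitary[OF mexp_unitary[OF X] conjunct1[OF True] conjunct2[OF True]]
    by (intro differentiable_sum ballI differentiable_mult differentiable_prod_lessThan
        differentiable_const finite_words) auto
qed (simp add: rho_outside)

text \<open>Applied to a coherent state, the derivative of the representation and
  \<open>ladder p X\<close> give the same vector, since the curve of coherent states is known. Each
  row of their difference is thus annihilated by all coherent states and vanishes.\<close>

lemma rho_mexp_has_vector_derivative:
  assumes X: "cadjoint X = - X"
  shows "((\<lambda>t. rho p (mexp (t *\<^sub>R X)) (i, j)) has_vector_derivative ladder p X (i, j)) (at 0)"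
proof (cases "i \<in> mono_index p \<and> j \<in> mono_index p")
  case True
  define D where "D j = vector_derivative (\<lambda>t. rho p (mexp (t *\<^sub>R X)) (i, j)) (at 0)" for j
  have D: "((\<lambda>t. rho p (mexp (t *\<^sub>R X)) (i, j)) has_vector_derivative D j) (at 0)" for j
    unfolding D_def using rho_mexp_differentiable[OF X] vector_derivative_works by blast
  have "D j - ladder p X (i, j) = 0"
  proof (rule coherent_total[where p = p and x = "\<lambda>j. D j - ladder p X (i, j)"])
    fix n
    have "((\<lambda>t. vec_act p (mexp (t *\<^sub>R X)) (coherent p n) i) has_vector_derivative
        (\<Sum>j\<in>mono_index p. D j * coherent p n j)) (at 0)"
      unfolding vec_act_def op_apply_def
      by (intro has_vector_derivative_sum has_vector_derivative_mult_left D)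
    moreover have "((\<lambda>t. vec_act p (mexp (t *\<^sub>R X)) (coherent p n) i) has_vector_derivative
        op_apply (mono_index p) (ladder p X) (coherent p n) i) (at 0)"
      unfolding vec_act_coherent[OF mexp_unitary[OF X]] by (rule coherent_mexp_has_vector_derivative[OF X])
    ultimately have "(\<Sum>j\<in>mono_index p. D j * coherent p n j) =
        op_apply (mono_index p) (ladder p X) (coherent p n) i"
      by (rule vector_derivative_unique_at)
    then show "(\<Sum>j\<in>mono_index p. (D j - ladder p X (i, j)) * coherent p n j) = 0"
      by (simp add: op_apply_def left_diff_distrib sum_subtractf)
  qed (use True in simp)
  then show ?thesis using D[of j] by simp
qed (simp add: rho_outside ladder_outside)

text \<open>Both sides fix every coherent state, and these are total; this replaces a proof that the
  symmetrised words are orthonormal.\<close>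

lemma rho_mat_1: "rho p (mat 1) = op_id (mono_index p)"
proof
  fix x :: "mono \<times> mono"
  obtain i j where x: "x = (i, j)" by (rule prod.exhaust)
  show "rho p (mat 1) x = op_id (mono_index p) x"
  proof (cases "i \<in> mono_index p \<and> j \<in> mono_index p")
    case True
    have "rho p (mat 1) (i, j) - op_id (mono_index p) (i, j) = 0"
    proof (rule coherent_total[where p = p and x = "\<lambda>j. rho p (mat 1) (i, j) - op_id (mono_index p) (i, j)"])
      fix n
      have "(\<Sum>j\<in>mono_index p. rho p (mat 1) (i, j) * coherent p n j) = coherent p n i"
        using fun_cong[OF vec_act_coherent[OF mat_1_unitary, of p n], of i]
        by (simp add: vec_act_def op_apply_def)
      moreover have "(\<Sum>j\<in>mono_index p. op_id (mono_index p) (i, j) * coherent p n j) = coherent p n i"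
        using True by (simp add: op_id_def if_distrib[of "\<lambda>x. x * _"] cong: if_cong)
      ultimately show "(\<Sum>j\<in>mono_index p. (rho p (mat 1) (i, j) - op_id (mono_index p) (i, j)) * coherent p n j) = 0"
        by (simp add: left_diff_distrib sum_subtractf)
    qed (use True in simp)
    then show ?thesis by (simp add: x)
  qed (auto simp: x rho_outside op_id_def)
qed

lemma drep_su_vec_act:
  assumes "cadjoint X = - X"
  shows "drep_su (vec_act p) X v = op_apply (mono_index p) (ladder p X) v"
proof
  fix i
  have "((\<lambda>t. vec_act p (mexp (t *\<^sub>R X)) v i) has_vector_derivative
      op_apply (mono_index p) (ladder p X) v i) (at 0)"
    unfolding vec_act_def op_apply_def
    by (intro has_vector_derivative_sum has_vector_derivative_mult_left
        rho_mexp_has_vector_derivative[OF assms])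
  then show "drep_su (vec_act p) X v i = op_apply (mono_index p) (ladder p X) v i"
    unfolding drep_su_def by (rule vector_derivative_at)
qed

definition commutator :: "nat \<Rightarrow> operator \<Rightarrow> operator \<Rightarrow> operator" where
  "commutator p M A = (\<lambda>x. op_mult (mono_index p) M A x - op_mult (mono_index p) A M x)"

text \<open>Product rule for conjugation by the unitary R(t) at t = 0, where R is the identity. The
  right factor contributes the adjoint of \<open>ladder p X\<close>, which is its negative because X
  is anti-Hermitian.\<close>

lemma drep_su_op_act:
  assumes X: "cadjoint X = - X" and A: "A \<in> ops (mono_index p)"
  shows "drep_su (op_act p) X A = commutator p (ladder p X) A"
proof
  fix x :: "mono \<times> mono"
  obtain i j where x: "x = (i, j)" by (rule prod.exhaust)
  let ?I = "mono_index p" and ?R = "\<lambda>t. rho p (mexp (t *\<^sub>R X))"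
  have "((\<lambda>t. \<Sum>k\<in>?I. ?R t (i, k) * (\<Sum>l\<in>?I. A (k, l) * cnj (?R t (j, l)))) has_vector_derivative
      (\<Sum>k\<in>?I. ?R 0 (i, k) * (\<Sum>l\<in>?I. A (k, l) * cnj (ladder p X (j, l))) +
        ladder p X (i, k) * (\<Sum>l\<in>?I. A (k, l) * cnj (?R 0 (j, l))))) (at 0)"
    by (intro has_vector_derivative_sum has_vector_derivative_mult has_vector_derivative_mult_right
        bounded_linear.has_vector_derivative[OF bounded_linear_cnj] rho_mexp_has_vector_derivative[OF X])
  moreover have "(\<lambda>t. \<Sum>k\<in>?I. ?R t (i, k) * (\<Sum>l\<in>?I. A (k, l) * cnj (?R t (j, l)))) =
      (\<lambda>t. op_act p (mexp (t *\<^sub>R X)) A (i, j))"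
    by (simp add: op_act_unitary[OF mexp_unitary[OF X]] op_mult_def op_adj_def)
  ultimately have "drep_su (op_act p) X A (i, j) =
      (\<Sum>k\<in>?I. ?R 0 (i, k) * (\<Sum>l\<in>?I. A (k, l) * cnj (ladder p X (j, l))) +
        ladder p X (i, k) * (\<Sum>l\<in>?I. A (k, l) * cnj (?R 0 (j, l))))"
    unfolding drep_su_def by (simp only: vector_derivative_at)
  also have "\<dots> = (\<Sum>k\<in>?I. ?R 0 (i, k) * (\<Sum>l\<in>?I. A (k, l) * cnj (ladder p X (j, l)))) +
      (\<Sum>k\<in>?I. ladder p X (i, k) * (\<Sum>l\<in>?I. A (k, l) * cnj (?R 0 (j, l))))"
    by (rule sum.distrib)
  also have "(\<Sum>k\<in>?I. ?R 0 (i, k) * (\<Sum>l\<in>?I. A (k, l) * cnj (ladder p X (j, l)))) =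
      (\<Sum>l\<in>?I. A (i, l) * cnj (ladder p X (j, l)))"
  proof (cases "i \<in> ?I")
    case True
    then show ?thesis
      by (simp add: mexp_0 rho_mat_1 op_id_def if_distrib[of "\<lambda>x. x * _"] cong: if_cong)
  next
    case False
    then have "A (i, l) = 0" for l using A unfolding cspace_def by blast
    then show ?thesis using False by (simp add: rho_outside)
  qed
  also have "(\<Sum>l\<in>?I. A (i, l) * cnj (ladder p X (j, l))) = - op_mult ?I A (ladder p X) (i, j)"
  proof -
    have neg: "- X = (\<chi> a b. - 1 * X $ a $ b)" by (simp add: vec_eq_iff)
    have "cnj (ladder p X (j, l)) = - ladder p X (l, j)" for l
    proof -
      have "cnj (ladder p X (j, l)) = ladder p (cadjoint X) (l, j)"
        by (simp add: ladder_cadjoint op_adj_def)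
      also have "\<dots> = - ladder p X (l, j)" unfolding X neg ladder_scale by simp
      finally show ?thesis .
    qed
    then show ?thesis by (simp add: op_mult_def sum_negf)
  qed
  also have "(\<Sum>k\<in>?I. ladder p X (i, k) * (\<Sum>l\<in>?I. A (k, l) * cnj (?R 0 (j, l)))) =
      op_mult ?I (ladder p X) A (i, j)"
  proof -
    have "(\<Sum>l\<in>?I. A (k, l) * cnj (?R 0 (j, l))) = A (k, j)" for k
    proof (cases "j \<in> ?I")
      case True
      then show ?thesis
        by (simp add: mexp_0 rho_mat_1 op_id_def if_distrib[of cnj] if_distrib[of "\<lambda>x. _ * x"] cong: if_cong)
    next
      case False
      then have "A (k, j) = 0" using A unfolding cspace_def by blast
      then show ?thesis using False by (simp add: rho_outside)
    qed
    then show ?thesis by (simp add: op_mult_def)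
  qed
  finally show "drep_su (op_act p) X A x = commutator p (ladder p X) A x"
    by (simp add: x commutator_def)
qed

lemma half_scaleR: "(1 / 2) *\<^sub>R z = z / (2 :: complex)"
  by (simp add: scaleR_conv_of_real)

lemma antihermitian_parts:
  fixes Z :: "complex^'n^'n"
  shows "cadjoint ((1 / 2) *\<^sub>R (Z - cadjoint Z)) = - ((1 / 2) *\<^sub>R (Z - cadjoint Z))"
    and "cadjoint (\<chi> a b. (Z + cadjoint Z) $ a $ b / (2 * \<i>)) = - (\<chi> a b. (Z + cadjoint Z) $ a $ b / (2 * \<i>))"
  by (simp_all add: vec_eq_iff half_scaleR field_simps)

text \<open>The two anti-Hermitian parts recombine to Z because \<open>ladder\<close> is
  complex-linear in the matrix; so the complex extension made in \<open>drep\<close> is again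
  \<open>ladder\<close>.\<close>

lemma ladder_parts:
  "ladder p ((1 / 2) *\<^sub>R (Z - cadjoint Z)) x + \<i> * ladder p (\<chi> a b. (Z + cadjoint Z) $ a $ b / (2 * \<i>)) x =
    ladder p Z x"
proof -
  have "(1 / 2) *\<^sub>R (Z - cadjoint Z) + (\<chi> a b. \<i> * (\<chi> a b. (Z + cadjoint Z) $ a $ b / (2 * \<i>)) $ a $ b) = Z"
    by (simp add: vec_eq_iff half_scaleR field_simps)
  then show ?thesis by (simp only: ladder_scale[symmetric] ladder_add[symmetric])
qed

lemma drep_vec_act: "drep (vec_act p) Z v = op_apply (mono_index p) (ladder p Z) v"
  unfolding drep_def drep_su_vec_act[OF antihermitian_parts(1)] drep_su_vec_act[OF antihermitian_parts(2)]
  by (simp only: op_apply_def sum_distrib_left sum.distrib[symmetric] mult.assoc[symmetric]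
      distrib_right[symmetric] ladder_parts)

lemma drep_op_act:
  assumes "A \<in> ops (mono_index p)"
  shows "drep (op_act p) Z A = commutator p (ladder p Z) A"
proof
  fix x :: "mono \<times> mono"
  obtain i j where x: "x = (i, j)" by (rule prod.exhaust)
  let ?X = "(1 / 2) *\<^sub>R (Z - cadjoint Z)" and ?Y = "\<chi> a b. (Z + cadjoint Z) $ a $ b / (2 * \<i>)"
  have "op_mult (mono_index p) (ladder p Z) A x =
      op_mult (mono_index p) (ladder p ?X) A x + \<i> * op_mult (mono_index p) (ladder p ?Y) A x"
    by (simp add: x op_mult_def ladder_parts[of p Z, symmetric] sum_distrib_left sum.distrib
        distrib_right mult.assoc)
  moreover have "op_mult (mono_index p) A (ladder p Z) x =
      op_mult (mono_index p) A (ladder p ?X) x + \<i> * op_mult (mono_index p) A (ladder p ?Y) x"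
    by (simp add: x op_mult_def ladder_parts[of p Z, symmetric] sum_distrib_left sum.distrib
        distrib_left mult.left_commute)
  ultimately show "drep (op_act p) Z A x = commutator p (ladder p Z) A x"
    unfolding drep_def drep_su_op_act[OF antihermitian_parts(1) assms]
      drep_su_op_act[OF antihermitian_parts(2) assms]
    by (simp add: commutator_def right_diff_distrib)
qed

section \<open>Gelfand-Tsetlin families\<close>

text \<open>Labels are handled through r_+, r_- and the third weight entry instead of weight and J.
  With J + u = r_+ - \<nu>3 and J - u = \<nu>3 - r_- the recursion coefficients become roots of
  quotients of integers, whose zeros and signs can be read off from the range conditions.\<close>

definition gt_weight :: "nat \<Rightarrow> nat \<Rightarrow> int \<Rightarrow> int \<Rightarrow> int \<Rightarrow> weight" where
  "gt_weight p q rp rm n3 = (int p + 2 * int q - (rp + rm), rp + rm - n3, n3)"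

definition gt_elem :: "nat \<Rightarrow> nat \<Rightarrow> (weight \<Rightarrow> real \<Rightarrow> 'a) \<Rightarrow> int \<Rightarrow> int \<Rightarrow> int \<Rightarrow> 'a" where
  "gt_elem p q e rp rm n3 = e (gt_weight p q rp rm n3) (real_of_int (rp - rm) / 2)"

definition gt_range :: "nat \<Rightarrow> nat \<Rightarrow> int \<Rightarrow> int \<Rightarrow> int \<Rightarrow> bool" where
  "gt_range p q rp rm n3 \<longleftrightarrow>
     0 \<le> rm \<and> rm \<le> int q \<and> int q \<le> rp \<and> rp \<le> int p + int q \<and> rm \<le> n3 \<and> n3 \<le> rp"

lemma gt_labels_iff:
  "(\<nu>, J) \<in> gt_labels p q \<longleftrightarrow>
    (\<exists>rp rm n3. gt_range p q rp rm n3 \<and> \<nu> = gt_weight p q rp rm n3 \<and> J = real_of_int (rp - rm) / 2)"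
  unfolding gt_labels_def gt_range_def gt_weight_def by blast

lemma gt_family_U_minus:
  assumes gt: "gt_family ip \<rho> p q e" and r: "gt_range p q rp rm n3"
  shows "U_minus \<rho> (gt_elem p q e rp rm n3) =
    (\<lambda>i. of_real (sqrt (real_of_int ((rp - n3) * (n3 - rm + 1)))) * gt_elem p q e rp rm (n3 + 1) i)"
proof -
  define J where "J = real_of_int (rp - rm) / 2"
  define u where "u = u_of (gt_weight p q rp rm n3)"
  have "(gt_weight p q rp rm n3, J) \<in> gt_labels p q" using r gt_labels_iff J_def by blast
  with gt have "U_minus \<rho> (e (gt_weight p q rp rm n3) J) =
      (\<lambda>i. of_real (sqrt ((J + u) * (J - u + 1))) *
        e (int p + 2 * int q - (rp + rm), rp + rm - n3 - 1, n3 + 1) J i)"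
    unfolding gt_family_def gt_weight_def u_def Let_def by blast
  moreover have "J + u = real_of_int (rp - n3)" "J - u + 1 = real_of_int (n3 - rm + 1)"
    by (simp_all add: J_def u_def gt_weight_def field_simps)
  moreover have "gt_weight p q rp rm (n3 + 1) = (int p + 2 * int q - (rp + rm), rp + rm - n3 - 1, n3 + 1)"
    by (simp add: gt_weight_def)
  ultimately show ?thesis unfolding gt_elem_def J_def[symmetric] by (simp only: of_int_mult)
qed

lemma of_real_sqrt_quotient_nonzero:
  "0 < a \<Longrightarrow> 0 < b \<Longrightarrow> complex_of_real (sqrt (real_of_int a / real_of_int b)) \<noteq> 0"
  by simp

lemma gt_family_T_minus:
  assumes gt: "gt_family ip \<rho> p q e" and r: "gt_range p q rp rm n3"
  shows "T_minus \<rho> (gt_elem p q e rp rm n3) =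
    (\<lambda>i. of_real (sqrt (real_of_int ((n3 - rm) * (int p + int q - rm + 1) * (int q - rm) * (rm + 1)) /
             real_of_int ((rp - rm) * (rp - rm + 1)))) * gt_elem p q e rp (rm + 1) n3 i +
         of_real (sqrt (real_of_int ((rp - n3 + 1) * (int p + int q - rp) * (rp + 1 - int q) * (rp + 2)) /
             real_of_int ((rp - rm + 2) * (rp - rm + 1)))) * gt_elem p q e (rp + 1) rm n3 i)"
proof -
  define J where "J = real_of_int (rp - rm) / 2"
  define u where "u = u_of (gt_weight p q rp rm n3)"
  have "(gt_weight p q rp rm n3, J) \<in> gt_labels p q" using r gt_labels_iff J_def by blast
  with gt have "T_minus \<rho> (e (gt_weight p q rp rm n3) J) =
      (\<lambda>i. of_real (sqrt ((J - u) * (real p + real q + J - u - real_of_int n3 + 1) * (real q + J - u - real_of_int n3) *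
                (u - J + real_of_int n3 + 1) / (2 * J * (2 * J + 1)))) *
             e (int p + 2 * int q - (rp + rm) - 1, rp + rm - n3 + 1, n3) (J - 1 / 2) i +
           of_real (sqrt ((J + u + 1) * (real p + real q - J - u - real_of_int n3) * (J + u + 1 + real_of_int n3 - real q) *
                (J + u + 2 + real_of_int n3) / (2 * (J + 1) * (2 * J + 1)))) *
             e (int p + 2 * int q - (rp + rm) - 1, rp + rm - n3 + 1, n3) (J + 1 / 2) i)"
    unfolding gt_family_def gt_weight_def u_def Let_def by blast
  moreover have Ju: "J + u = real_of_int (rp - n3)" "J - u = real_of_int (n3 - rm)"
    by (simp_all add: J_def u_def gt_weight_def field_simps)
  have "(J - u) * (real p + real q + J - u - real_of_int n3 + 1) * (real q + J - u - real_of_int n3) *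
                (u - J + real_of_int n3 + 1) / (2 * J * (2 * J + 1)) =
      real_of_int ((n3 - rm) * (int p + int q - rm + 1) * (int q - rm) * (rm + 1)) /
             real_of_int ((rp - rm) * (rp - rm + 1))"
  proof -
    have "real p + real q + J - u - real_of_int n3 + 1 = real_of_int (int p + int q - rm + 1)"
      "real q + J - u - real_of_int n3 = real_of_int (int q - rm)"
      "u - J + real_of_int n3 + 1 = real_of_int (rm + 1)"
      "2 * J = real_of_int (rp - rm)"
      using Ju(2) by (simp_all add: J_def)
    then show ?thesis unfolding Ju(2) by (simp only:) simp
  qed
  moreover have "(J + u + 1) * (real p + real q - J - u - real_of_int n3) * (J + u + 1 + real_of_int n3 - real q) *
                (J + u + 2 + real_of_int n3) / (2 * (J + 1) * (2 * J + 1)) =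
      real_of_int ((rp - n3 + 1) * (int p + int q - rp) * (rp + 1 - int q) * (rp + 2)) /
             real_of_int ((rp - rm + 2) * (rp - rm + 1))"
  proof -
    have "real p + real q - J - u - real_of_int n3 = real_of_int (int p + int q - rp)"
      "2 * (J + 1) = real_of_int (rp - rm + 2)" "2 * J = real_of_int (rp - rm)"
      using Ju(1) by (simp_all add: J_def)
    then show ?thesis unfolding Ju(1) by (simp only:) (simp add: algebra_simps)
  qed
  moreover have "J - 1 / 2 = real_of_int (rp - (rm + 1)) / 2" "J + 1 / 2 = real_of_int (rp + 1 - rm) / 2"
    by (simp_all add: J_def field_simps)
  moreover have "gt_weight p q rp (rm + 1) n3 = (int p + 2 * int q - (rp + rm) - 1, rp + rm - n3 + 1, n3)"
    "gt_weight p q (rp + 1) rm n3 = (int p + 2 * int q - (rp + rm) - 1, rp + rm - n3 + 1, n3)"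
    by (simp_all add: gt_weight_def)
  ultimately show ?thesis unfolding gt_elem_def J_def[symmetric] by (simp only:)
qed

lemma gt_family_highest:
  assumes "gt_family ip \<rho> p q e"
  defines "h \<equiv> gt_elem p q e (int q) 0 0"
  shows "T_plus \<rho> h = (\<lambda>_. 0)" "U_plus \<rho> h = (\<lambda>_. 0)"
    "T_three \<rho> h = (\<lambda>i. of_real (real p / 2) * h i)" "U_three \<rho> h = (\<lambda>i. of_real (real q / 2) * h i)"
proof -
  have "h = e (int p + int q, int q, 0) (real q / 2)"
    by (simp add: h_def gt_elem_def gt_weight_def add.commute[of "int q"])
  then show "T_plus \<rho> h = (\<lambda>_. 0)" "U_plus \<rho> h = (\<lambda>_. 0)"
    "T_three \<rho> h = (\<lambda>i. of_real (real p / 2) * h i)" "U_three \<rho> h = (\<lambda>i. of_real (real q / 2) * h i)"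
    using assms(1) by (simp_all add: gt_family_def Let_def)
qed

text \<open>Every basis vector is reached from the highest weight vector: \<open>T_minus\<close> at
  \<open>\<nu>\<^sub>3 = r\<^sub>-\<close> raises \<open>r\<^sub>+\<close>, at \<open>\<nu>\<^sub>3 = r\<^sub>- + 1\<close> it raises
  \<open>r\<^sub>-\<close> up to a vector already reached, and \<open>U_minus\<close> raises \<open>\<nu>\<^sub>3\<close>.\<close>

lemma gt_family_induct:
  fixes e :: "weight \<Rightarrow> real \<Rightarrow> 'i \<Rightarrow> complex"
  assumes gt: "gt_family ip \<rho> p q e"
    and highest: "P (gt_weight p q (int q) 0 0) (gt_elem p q e (int q) 0 0)"
    and lin: "\<And>\<nu> x y c. P \<nu> x \<Longrightarrow> P \<nu> y \<Longrightarrow> P \<nu> (\<lambda>i. c * (x i - y i))"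
    and U: "\<And>a b c x. P (a, b, c) x \<Longrightarrow> P (a, b - 1, c + 1) (U_minus \<rho> x)"
    and T: "\<And>a b c x. P (a, b, c) x \<Longrightarrow> P (a - 1, b + 1, c) (T_minus \<rho> x)"
    and r: "gt_range p q rp rm n3"
  shows "P (gt_weight p q rp rm n3) (gt_elem p q e rp rm n3)"
proof -
  let ?Q = "\<lambda>rp rm n3. P (gt_weight p q rp rm n3) (gt_elem p q e rp rm n3)"
  \<comment> \<open>Scaling is the difference with the zero vector, and the zero vector is 0 times
    (x - x).\<close>
  have scale: "P \<nu> (\<lambda>i. c * x i)" if "P \<nu> x" for \<nu> x c
    using lin[OF that lin[OF that that, of 0], of c] by simp
  have U': "P (gt_weight p q rp rm (n3 + 1)) (U_minus \<rho> (gt_elem p q e rp rm n3))" if "?Q rp rm n3" for rp rm n3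
    using U[of "int p + 2 * int q - (rp + rm)" "rp + rm - n3" n3] that
    by (simp add: gt_weight_def algebra_simps)
  have T': "P (gt_weight p q rp (rm + 1) n3) (T_minus \<rho> (gt_elem p q e rp rm n3))"
    "P (gt_weight p q (rp + 1) rm n3) (T_minus \<rho> (gt_elem p q e rp rm n3))" if "?Q rp rm n3" for rp rm n3
    using T[of "int p + 2 * int q - (rp + rm)" "rp + rm - n3" n3] that
    by (simp_all add: gt_weight_def algebra_simps)
  have down: "?Q rp rm n3" if "?Q rp rm rm" and "rm \<le> n3" and r: "gt_range p q rp rm n3" for rp rm n3
    using that(2) r
  proof (induction n3 rule: int_ge_induct)
    case base
    then show ?case using that(1) by simp
  next
    case (step n)
    then have rn: "gt_range p q rp rm n" by (auto simp: gt_range_def)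
    then have Q: "?Q rp rm n" using step by simp
    define c where "c = complex_of_real (sqrt (real_of_int ((rp - n) * (n - rm + 1))))"
    have "(rp - n) * (n - rm + 1) > 0" using step by (auto simp: gt_range_def)
    then have "c \<noteq> 0"
      using of_real_sqrt_quotient_nonzero[of "(rp - n) * (n - rm + 1)" 1]
      unfolding c_def of_int_1 div_by_1 by simp
    moreover have "P (gt_weight p q rp rm (n + 1)) (\<lambda>i. inverse c * (c * gt_elem p q e rp rm (n + 1) i))"
      using scale[OF U'[OF Q], of "inverse c"] unfolding gt_family_U_minus[OF gt rn] c_def by simp
    ultimately show ?case by (simp add: mult.assoc[symmetric])
  qed
  have "\<forall>rp n3. gt_range p q rp rm n3 \<longrightarrow> ?Q rp rm n3" if "0 \<le> rm" "rm \<le> int q" for rm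
    using that
  proof (induction rm rule: int_ge_induct)
    case base
    have "?Q rp 0 0" if "int q \<le> rp" "rp \<le> int p + int q" for rp
      using that
    proof (induction rp rule: int_ge_induct)
      case base
      then show ?case using highest by simp
    next
      case (step rp)
      then have r: "gt_range p q rp 0 0" by (auto simp: gt_range_def)
      have Q: "?Q rp 0 0" using step by simp
      define c where "c = complex_of_real (sqrt (real_of_int ((rp - 0 + 1) * (int p + int q - rp) * (rp + 1 - int q) * (rp + 2)) /
             real_of_int ((rp - 0 + 2) * (rp - 0 + 1))))"
      have "(rp - 0 + 1) * (int p + int q - rp) * (rp + 1 - int q) * (rp + 2) > 0"
        "(rp - 0 + 2) * (rp - 0 + 1) > 0"
        using step by (auto intro!: mult_pos_pos)
      then have "c \<noteq> 0" unfolding c_def by (rule of_real_sqrt_quotient_nonzero)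
      moreover have "P (gt_weight p q (rp + 1) 0 0) (\<lambda>i. inverse c * (c * gt_elem p q e (rp + 1) 0 0 i))"
        using scale[OF T'(2)[OF Q], of "inverse c"] unfolding gt_family_T_minus[OF gt r] c_def by simp
      ultimately show ?case by (simp add: mult.assoc[symmetric])
    qed
    then show ?case using down by (auto simp: gt_range_def)
  next
    case (step rm)
    then have IH: "?Q rp rm n3" if "gt_range p q rp rm n3" for rp n3 using that by simp
    have "?Q rp (rm + 1) (rm + 1)" if rp: "int q \<le> rp" "rp \<le> int p + int q" for rp
    proof -
      have r: "gt_range p q rp rm (rm + 1)" using rp step by (auto simp: gt_range_def)
      define c where "c = complex_of_real (sqrt (real_of_int ((rm + 1 - rm) * (int p + int q - rm + 1) * (int q - rm) * (rm + 1)) /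
             real_of_int ((rp - rm) * (rp - rm + 1))))"
      define d where "d = complex_of_real (sqrt (real_of_int ((rp - (rm + 1) + 1) * (int p + int q - rp) * (rp + 1 - int q) * (rp + 2)) /
             real_of_int ((rp - rm + 2) * (rp - rm + 1))))"
      have "(rm + 1 - rm) * (int p + int q - rm + 1) * (int q - rm) * (rm + 1) > 0" "(rp - rm) * (rp - rm + 1) > 0"
        using step rp by (auto intro!: mult_pos_pos)
      then have c: "c \<noteq> 0" unfolding c_def by (rule of_real_sqrt_quotient_nonzero)
      have TT: "T_minus \<rho> (gt_elem p q e rp rm (rm + 1)) =
          (\<lambda>i. c * gt_elem p q e rp (rm + 1) (rm + 1) i + d * gt_elem p q e (rp + 1) rm (rm + 1) i)"
        unfolding gt_family_T_minus[OF gt r] c_def d_def by simp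
      \<comment> \<open>The weight depends on r_+ and r_- only through their sum, so this vector has
        the same weight as the one sought. At r_+ = p + q it is not a label and nothing is known
        about it, but d = 0 there.\<close>
      have Pd: "P (gt_weight p q rp (rm + 1) (rm + 1)) (\<lambda>i. d * gt_elem p q e (rp + 1) rm (rm + 1) i)"
      proof (cases "rp = int p + int q")
        case True
        then have "d = 0" by (simp add: d_def)
        then show ?thesis using scale[OF T'(1)[OF IH[OF r]], of 0] by simp
      next
        case False
        then have "gt_range p q (rp + 1) rm (rm + 1)" using rp step by (auto simp: gt_range_def)
        from scale[OF IH[OF this], of d] show ?thesis
          by (simp add: gt_weight_def algebra_simps)
      qed
      have "P (gt_weight p q rp (rm + 1) (rm + 1)) (\<lambda>i. inverse c * (c * gt_elem p q e rp (rm + 1) (rm + 1) i))"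
        using lin[OF T'(1)[OF IH[OF r]] Pd, of "inverse c"] unfolding TT by simp
      then show ?thesis using c by (simp add: mult.assoc[symmetric])
    qed
    then show ?case using down by (auto simp: gt_range_def)
  qed
  then show ?thesis using r by (auto simp: gt_range_def)
qed

section \<open>Weights and ladder matrix elements in the monomial basis\<close>

fun mono_t :: "mono \<Rightarrow> real" where "mono_t (j, k, l) = (real k - real l) / 2"
fun mono_u :: "mono \<Rightarrow> real" where "mono_u (j, k, l) = (real j - real k) / 2"

lemma matrix_unit_nth: "matrix_unit a b $ i $ j = of_bool (i = a \<and> j = b)"
  by (simp add: matrix_unit_def)

lemma ladder_T_minus_entry:
  "ladder p (matrix_unit 2 1) ((j, k, l), (j', k', l')) =
    of_bool (j + k + l = p \<and> j' + k' + l' = p \<and> l = Suc l' \<and> k' = Suc k \<and> j = j') *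
      of_real (sqrt (real l * real k'))"
  by (cases "j = j'") (auto simp: matrix_unit_nth)

lemma ladder_U_minus_entry:
  "ladder p (matrix_unit 3 2) ((j, k, l), (j', k', l')) =
    of_bool (j + k + l = p \<and> j' + k' + l' = p \<and> k = Suc k' \<and> j' = Suc j \<and> l = l') *
      of_real (sqrt (real k * real j'))"
  by (cases "l = l'") (auto simp: matrix_unit_nth)

lemma ladder_T_plus_entry:
  "ladder p (matrix_unit 1 2) ((j, k, l), (j', k', l')) =
    of_bool (j + k + l = p \<and> j' + k' + l' = p \<and> k = Suc k' \<and> l' = Suc l \<and> j = j') *
      of_real (sqrt (real k * real l'))"
  by (cases "j = j'") (auto simp: matrix_unit_nth)

lemma ladder_U_plus_entry:
  "ladder p (matrix_unit 2 3) ((j, k, l), (j', k', l')) =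
    of_bool (j + k + l = p \<and> j' + k' + l' = p \<and> j = Suc j' \<and> k' = Suc k \<and> l = l') *
      of_real (sqrt (real j * real k'))"
  by (cases "l = l'") (auto simp: matrix_unit_nth)

lemma ladder_diagonal:
  assumes "\<And>a b. a \<noteq> b \<Longrightarrow> X $ a $ b = 0"
  shows "ladder p X ((j, k, l), i') = of_bool (i' = (j, k, l) \<and> (j, k, l) \<in> mono_index p) *
    - (of_nat j * X $ 3 $ 3 + of_nat k * X $ 2 $ 2 + of_nat l * X $ 1 $ 1)"
proof -
  obtain j' k' l' where i': "i' = (j', k', l')" by (metis surj_pair)
  have "X $ 2 $ 3 = 0" "X $ 1 $ 3 = 0" "X $ 3 $ 2 = 0" "X $ 1 $ 2 = 0" "X $ 3 $ 1 = 0" "X $ 2 $ 1 = 0"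
    using assms by simp_all
  then have "ladder p X ((j, k, l), i') = of_bool (j + k + l = p \<and> j' + k' + l' = p) *
      (of_bool (j = j' \<and> k = k' \<and> l = l') * - (of_nat j * X $ 3 $ 3 + of_nat k * X $ 2 $ 2 + of_nat l * X $ 1 $ 1))"
    unfolding i' ladder.simps by simp
  also have "of_bool (j + k + l = p \<and> j' + k' + l' = p) * (of_bool (j = j' \<and> k = k' \<and> l = l') * x) =
      of_bool (i' = (j, k, l) \<and> (j, k, l) \<in> mono_index p) * x" for x :: complex
    by (cases "j = j' \<and> k = k' \<and> l = l'") (auto simp: i')
  finally show ?thesis .
qed

lemma ladder_T_three:
  "ladder p ((1 / 2) *\<^sub>R (matrix_unit 1 1 - matrix_unit 2 2)) (i, i') =
    of_bool (i' = i \<and> i \<in> mono_index p) * of_real (mono_t i)"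
proof -
  obtain j k l where i: "i = (j, k, l)" by (metis surj_pair)
  show ?thesis unfolding i by (subst ladder_diagonal) (auto simp: matrix_unit_nth half_scaleR field_simps)
qed

lemma ladder_U_three:
  "ladder p ((1 / 2) *\<^sub>R (matrix_unit 2 2 - matrix_unit 3 3)) (i, i') =
    of_bool (i' = i \<and> i \<in> mono_index p) * of_real (mono_u i)"
proof -
  obtain j k l where i: "i = (j, k, l)" by (metis surj_pair)
  show ?thesis unfolding i by (subst ladder_diagonal) (auto simp: matrix_unit_nth half_scaleR field_simps)
qed

lemma ladder_T_minus_weight:
  assumes "ladder p (matrix_unit 2 1) (i, i') \<noteq> 0"
  shows "mono_t i = mono_t i' + - 1 \<and> mono_u i = mono_u i' + 1 / 2"
proof -
  obtain j k l j' k' l' where i: "i = (j, k, l)" "i' = (j', k', l')" by (metis surj_pair)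
  show ?thesis using assms unfolding i ladder_T_minus_entry by (auto simp: field_simps)
qed

lemma ladder_U_minus_weight:
  assumes "ladder p (matrix_unit 3 2) (i, i') \<noteq> 0"
  shows "mono_t i = mono_t i' + 1 / 2 \<and> mono_u i = mono_u i' + - 1"
proof -
  obtain j k l j' k' l' where i: "i = (j, k, l)" "i' = (j', k', l')" by (metis surj_pair)
  show ?thesis using assms unfolding i ladder_U_minus_entry by (auto simp: field_simps)
qed

lemma cspace_nonzero: "v \<in> cspace I \<Longrightarrow> v i \<noteq> 0 \<Longrightarrow> i \<in> I"
  by (auto simp: cspace_def)

lemma cspace_eq_0: "v \<in> cspace I \<Longrightarrow> i \<notin> I \<Longrightarrow> v i = 0"
  by (auto simp: cspace_def)

lemma drep_three:
  assumes "v \<in> cspace (mono_index p)"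
  shows "T_three (vec_act p) v = (\<lambda>i. of_real (mono_t i) * v i)"
    and "U_three (vec_act p) v = (\<lambda>i. of_real (mono_u i) * v i)"
proof -
  have "(\<Sum>i'\<in>mono_index p. of_bool (i' = i \<and> i \<in> mono_index p) * c * v i') = c * v i" for i c
  proof (cases "i \<in> mono_index p")
    case True
    then show ?thesis using sum_hop[of "mono_index p" True i c v] by simp
  qed (use assms in \<open>simp add: cspace_eq_0\<close>)
  then show "T_three (vec_act p) v = (\<lambda>i. of_real (mono_t i) * v i)"
    and "U_three (vec_act p) v = (\<lambda>i. of_real (mono_u i) * v i)"
    unfolding T_three_def U_three_def drep_vec_act op_apply_def ladder_T_three ladder_U_three by simp_all
qed

lemma op_mult_diagonal:
  assumes A: "A \<in> ops (mono_index p)" and D: "\<And>i i'. D (i, i') = of_bool (i' = i \<and> i \<in> mono_index p) * d i"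
  shows "commutator p D A (i, j) = (d i - d j) * A (i, j)"
proof -
  have "op_mult (mono_index p) D A (i, j) = d i * A (i, j)"
  proof (cases "i \<in> mono_index p")
    case True
    then show ?thesis
      using sum_hop[of "mono_index p" True i "d i" "\<lambda>k. A (k, j)"] by (simp add: op_mult_def D)
  next
    case False
    then have "A (i, j) = 0" using A by (simp add: cspace_eq_0)
    then show ?thesis using False by (simp add: op_mult_def D)
  qed
  moreover have "op_mult (mono_index p) A D (i, j) = A (i, j) * d j"
  proof (cases "j \<in> mono_index p")
    case True
    have "op_mult (mono_index p) A D (i, j) = (\<Sum>k\<in>mono_index p. of_bool (True \<and> k = j) * d j * A (i, k))"
      unfolding op_mult_def prod.case by (intro sum.cong refl) (auto simp: D)
    then show ?thesis
      using True sum_hop[of "mono_index p" True j "d j" "\<lambda>k. A (i, k)"] by simp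
  next
    case False
    then have "A (i, j) = 0" using A by (simp add: cspace_eq_0)
    moreover have "D (k, j) = 0" for k using False by (auto simp: D)
    ultimately show ?thesis by (simp add: op_mult_def)
  qed
  ultimately show ?thesis by (simp add: commutator_def algebra_simps)
qed

lemma ops_eq_0: "A \<in> ops I \<Longrightarrow> i \<notin> I \<or> j \<notin> I \<Longrightarrow> A (i, j) = 0"
  by (auto simp: cspace_def)

lemma op_mult_in_ops:
  assumes "A \<in> ops I" "B \<in> ops I"
  shows "op_mult I A B \<in> ops I"
proof -
  have "op_mult I A B (i, j) = 0" if "i \<notin> I \<or> j \<notin> I" for i j
    using that ops_eq_0[OF assms(1), of i] ops_eq_0[OF assms(2), of _ j]
    by (auto simp: op_mult_def intro!: sum.neutral)
  then show ?thesis by (auto simp: cspace_def)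
qed

lemma commutator_in_ops:
  assumes "M \<in> ops (mono_index p)" "A \<in> ops (mono_index p)"
  shows "commutator p M A \<in> ops (mono_index p)"
proof -
  have "commutator p M A x = 0" if "x \<notin> mono_index p \<times> mono_index p" for x
    using cspace_eq_0[OF op_mult_in_ops[OF assms] that] cspace_eq_0[OF op_mult_in_ops[OF assms(2,1)] that]
    by (simp add: commutator_def)
  then show ?thesis unfolding cspace_def by blast
qed

lemma ladder_in_ops: "ladder p X \<in> ops (mono_index p)"
proof -
  have "ladder p X x = 0" if "x \<notin> mono_index p \<times> mono_index p" for x
  proof -
    obtain i j where x: "x = (i, j)" by (rule prod.exhaust)
    with that have "i \<notin> mono_index p \<or> j \<notin> mono_index p" by blast
    then show ?thesis unfolding x by (rule ladder_outside)
  qed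
  then show ?thesis unfolding cspace_def by blast
qed

text \<open>Weight vectors are described by their support. The zero vector has every weight, as it
  must for the predicate to be stable under linear combinations and lowering operators.\<close>

definition vec_weight :: "nat \<Rightarrow> weight \<Rightarrow> (mono \<Rightarrow> complex) \<Rightarrow> bool" where
  "vec_weight p \<nu> v \<longleftrightarrow> v \<in> cspace (mono_index p) \<and>
     (\<forall>i. v i \<noteq> 0 \<longrightarrow> mono_t i = t_of \<nu> \<and> mono_u i = u_of \<nu>)"

text \<open>Under conjugation the matrix unit at (i, j) has the difference of the weights of i and j
  as its weight.\<close>

definition op_weight :: "nat \<Rightarrow> weight \<Rightarrow> operator \<Rightarrow> bool" where
  "op_weight p \<nu> A \<longleftrightarrow> A \<in> ops (mono_index p) \<and>
     (\<forall>i j. A (i, j) \<noteq> 0 \<longrightarrow> mono_t i - mono_t j = t_of \<nu> \<and> mono_u i - mono_u j = u_of \<nu>)"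

lemma cspace_lin: "x \<in> cspace I \<Longrightarrow> y \<in> cspace I \<Longrightarrow> (\<lambda>i. c * (x i - y i)) \<in> cspace I"
  by (simp add: cspace_def)

lemma vec_weight_lin:
  assumes x: "vec_weight p \<nu> x" and y: "vec_weight p \<nu> y"
  shows "vec_weight p \<nu> (\<lambda>i. c * (x i - y i))"
  unfolding vec_weight_def
proof (intro conjI cspace_lin allI impI)
  show "x \<in> cspace (mono_index p)" "y \<in> cspace (mono_index p)"
    using x y by (simp_all only: vec_weight_def)
  fix i assume "c * (x i - y i) \<noteq> 0"
  then have "x i \<noteq> 0 \<or> y i \<noteq> 0" by auto
  then show "mono_t i = t_of \<nu>" "mono_u i = u_of \<nu>"
    using x y unfolding vec_weight_def by blast+
qed

lemma op_weight_lin: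
  assumes x: "op_weight p \<nu> x" and y: "op_weight p \<nu> y"
  shows "op_weight p \<nu> (\<lambda>i. c * (x i - y i))"
  unfolding op_weight_def
proof (intro conjI cspace_lin allI impI)
  show "x \<in> ops (mono_index p)" "y \<in> ops (mono_index p)"
    using x y by (simp_all only: op_weight_def)
  fix i j assume "c * (x (i, j) - y (i, j)) \<noteq> 0"
  then have "x (i, j) \<noteq> 0 \<or> y (i, j) \<noteq> 0" by auto
  then show "mono_t i - mono_t j = t_of \<nu>" "mono_u i - mono_u j = u_of \<nu>"
    using x y unfolding op_weight_def by blast+
qed

lemma vec_weight_shift:
  assumes "vec_weight p \<nu> v"
    and L: "\<And>i i'. ladder p X (i, i') \<noteq> 0 \<Longrightarrow> mono_t i = mono_t i' + dt \<and> mono_u i = mono_u i' + du"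
    and "t_of \<nu>' = t_of \<nu> + dt" "u_of \<nu>' = u_of \<nu> + du"
  shows "vec_weight p \<nu>' (op_apply (mono_index p) (ladder p X) v)"
proof -
  have out: "ladder p X (i, k) * v k = 0" if "i \<notin> mono_index p" for i k
    using ladder_outside[of i p k X] that by simp
  have "op_apply (mono_index p) (ladder p X) v \<in> cspace (mono_index p)"
    unfolding cspace_def op_apply_def mem_Collect_eq using out by (intro allI impI sum.neutral ballI)
  moreover have "mono_t i = t_of \<nu>' \<and> mono_u i = u_of \<nu>'"
    if "op_apply (mono_index p) (ladder p X) v i \<noteq> 0" for i
  proof -
    have "(\<Sum>k\<in>mono_index p. ladder p X (i, k) * v k) \<noteq> 0" using that by (simp add: op_apply_def)
    then obtain k where "ladder p X (i, k) * v k \<noteq> 0"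
      by (rule sum.not_neutral_contains_not_neutral)
    then have "ladder p X (i, k) \<noteq> 0" "v k \<noteq> 0" by auto
    then have k: "mono_t k = t_of \<nu> \<and> mono_u k = u_of \<nu>"
      "mono_t i = mono_t k + dt \<and> mono_u i = mono_u k + du"
      using L assms(1) unfolding vec_weight_def by blast+
    show ?thesis using k unfolding assms(3,4) by linarith
  qed
  ultimately show ?thesis unfolding vec_weight_def by blast
qed

lemma op_weight_shift:
  assumes A: "op_weight p \<nu> A"
    and L: "\<And>i i'. ladder p X (i, i') \<noteq> 0 \<Longrightarrow> mono_t i = mono_t i' + dt \<and> mono_u i = mono_u i' + du"
    and "t_of \<nu>' = t_of \<nu> + dt" "u_of \<nu>' = u_of \<nu> + du"
  shows "op_weight p \<nu>' (commutator p (ladder p X) A)"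
proof -
  have "commutator p (ladder p X) A \<in> ops (mono_index p)"
    using A commutator_in_ops[OF ladder_in_ops] unfolding op_weight_def by blast
  moreover have "mono_t i - mono_t j = t_of \<nu>' \<and> mono_u i - mono_u j = u_of \<nu>'"
    if nz: "commutator p (ladder p X) A (i, j) \<noteq> 0" for i j
  proof -
    have "op_mult (mono_index p) (ladder p X) A (i, j) \<noteq> 0 \<or> op_mult (mono_index p) A (ladder p X) (i, j) \<noteq> 0"
      using nz by (auto simp: commutator_def)
    then show ?thesis
    proof
      assume "op_mult (mono_index p) (ladder p X) A (i, j) \<noteq> 0"
      then obtain k where "ladder p X (i, k) * A (k, j) \<noteq> 0"
        unfolding op_mult_def prod.case by (meson sum.not_neutral_contains_not_neutral)
      then have "ladder p X (i, k) \<noteq> 0" "A (k, j) \<noteq> 0" by auto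
      then have "mono_t k - mono_t j = t_of \<nu> \<and> mono_u k - mono_u j = u_of \<nu>"
        "mono_t i = mono_t k + dt \<and> mono_u i = mono_u k + du"
        using L A unfolding op_weight_def by blast+
      then show ?thesis unfolding assms(3,4) by linarith
    next
      assume "op_mult (mono_index p) A (ladder p X) (i, j) \<noteq> 0"
      then obtain k where "A (i, k) * ladder p X (k, j) \<noteq> 0"
        unfolding op_mult_def prod.case by (meson sum.not_neutral_contains_not_neutral)
      then have "A (i, k) \<noteq> 0" "ladder p X (k, j) \<noteq> 0" by auto
      then have k: "mono_t i - mono_t k = t_of \<nu> \<and> mono_u i - mono_u k = u_of \<nu>"
        "mono_t k = mono_t j + dt \<and> mono_u k = mono_u j + du"
        using L A unfolding op_weight_def by blast+
      show ?thesis using k unfolding assms(3,4) by linarith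
    qed
  qed
  ultimately show ?thesis unfolding op_weight_def by blast
qed

text \<open>A Gelfand-Tsetlin family postulates eigenvalues of \<open>T_three\<close> and
  \<open>U_three\<close> only at its highest weight vector. The other weights follow by induction,
  since each lowering operator shifts the support by a fixed amount.\<close>

lemma vec_weight_gt_elem:
  assumes gt: "gt_family ip (vec_act p) a b e" and h: "gt_elem a b e (int b) 0 0 \<in> cspace (mono_index p)"
    and r: "gt_range a b rp rm n3"
  shows "vec_weight p (gt_weight a b rp rm n3) (gt_elem a b e rp rm n3)"
proof (rule gt_family_induct[where P = "vec_weight p", OF gt _ _ _ _ r])
  let ?h = "gt_elem a b e (int b) 0 0"
  have wt: "t_of (gt_weight a b (int b) 0 0) = real a / 2" "u_of (gt_weight a b (int b) 0 0) = real b / 2"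
    by (simp_all add: gt_weight_def)
  have "of_real (mono_t i) * ?h i = of_real (real a / 2) * ?h i"
    "of_real (mono_u i) * ?h i = of_real (real b / 2) * ?h i" for i
    using fun_cong[OF gt_family_highest(3)[OF gt], of i] fun_cong[OF gt_family_highest(4)[OF gt], of i]
    unfolding drep_three[OF h] by simp_all
  then have "?h i = 0 \<or> mono_t i = real a / 2" "?h i = 0 \<or> mono_u i = real b / 2" for i
    by (simp_all only: mult_cancel_right of_real_eq_iff)
  then show "vec_weight p (gt_weight a b (int b) 0 0) ?h"
    using h unfolding vec_weight_def wt by blast
next
  fix \<nu> x y c
  assume "vec_weight p \<nu> x" "vec_weight p \<nu> y"
  then show "vec_weight p \<nu> (\<lambda>i. c * (x i - y i))" by (rule vec_weight_lin)
next
  fix a b c x assume "vec_weight p (a, b, c) x"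
  then show "vec_weight p (a, b - 1, c + 1) (U_minus (vec_act p) x)"
    unfolding U_minus_def drep_vec_act
    by (rule vec_weight_shift[OF _ ladder_U_minus_weight]) (simp_all add: field_simps)
next
  fix a b c x assume "vec_weight p (a, b, c) x"
  then show "vec_weight p (a - 1, b + 1, c) (T_minus (vec_act p) x)"
    unfolding T_minus_def drep_vec_act
    by (rule vec_weight_shift[OF _ ladder_T_minus_weight]) (simp_all add: field_simps)
qed

lemma op_weight_gt_elem:
  assumes gt: "gt_family ip (op_act p) a b e" and h: "gt_elem a b e (int b) 0 0 \<in> ops (mono_index p)"
    and r: "gt_range a b rp rm n3"
  shows "op_weight p (gt_weight a b rp rm n3) (gt_elem a b e rp rm n3)"
proof (rule gt_family_induct[where P = "op_weight p", OF gt _ _ _ _ r])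
  let ?h = "gt_elem a b e (int b) 0 0"
  have wt: "t_of (gt_weight a b (int b) 0 0) = real a / 2" "u_of (gt_weight a b (int b) 0 0) = real b / 2"
    by (simp_all add: gt_weight_def)
  have "(of_real (mono_t i) - of_real (mono_t j)) * ?h (i, j) = of_real (real a / 2) * ?h (i, j)"
    "(of_real (mono_u i) - of_real (mono_u j)) * ?h (i, j) = of_real (real b / 2) * ?h (i, j)" for i j
    using fun_cong[OF gt_family_highest(3)[OF gt], of "(i, j)"] fun_cong[OF gt_family_highest(4)[OF gt], of "(i, j)"]
    unfolding T_three_def U_three_def drep_op_act[OF h] op_mult_diagonal[OF h ladder_T_three]
      op_mult_diagonal[OF h ladder_U_three] by simp_all
  then have "?h (i, j) = 0 \<or> mono_t i - mono_t j = real a / 2"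
    "?h (i, j) = 0 \<or> mono_u i - mono_u j = real b / 2" for i j
    by (simp_all only: mult_cancel_right of_real_diff[symmetric] of_real_eq_iff)
  then show "op_weight p (gt_weight a b (int b) 0 0) ?h"
    using h unfolding op_weight_def wt by blast
next
  fix \<nu> x y c
  assume "op_weight p \<nu> x" "op_weight p \<nu> y"
  then show "op_weight p \<nu> (\<lambda>i. c * (x i - y i))" by (rule op_weight_lin)
next
  fix a b c x assume w: "op_weight p (a, b, c) x"
  then have x: "x \<in> ops (mono_index p)" by (simp add: op_weight_def)
  show "op_weight p (a, b - 1, c + 1) (U_minus (op_act p) x)"
    unfolding U_minus_def drep_op_act[OF x]
    by (rule op_weight_shift[OF w ladder_U_minus_weight]) (simp_all add: field_simps)
next
  fix a b c x assume w: "op_weight p (a, b, c) x"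
  then have x: "x \<in> ops (mono_index p)" by (simp add: op_weight_def)
  show "op_weight p (a - 1, b + 1, c) (T_minus (op_act p) x)"
    unfolding T_minus_def drep_op_act[OF x]
    by (rule op_weight_shift[OF w ladder_T_minus_weight]) (simp_all add: field_simps)
qed

lemma gt_elem_label: "gt_range p q rp rm n3 \<Longrightarrow> (gt_weight p q rp rm n3, real_of_int (rp - rm) / 2) \<in> gt_labels p q"
  unfolding gt_labels_iff by blast

text \<open>From (0, 0, p) units are moved from the third exponent to the second and then from the
  second to the first, which reaches every monomial. This is the combinatorial form of the cyclicity
  of the lowest weight vector.\<close>

lemma mono_index_induct:
  assumes "i \<in> mono_index p" and "P (0, 0, p)"
    and T: "\<And>j k l. j + k + Suc l = p \<Longrightarrow> P (j, k, Suc l) \<Longrightarrow> P (j, Suc k, l)"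
    and U: "\<And>j k l. j + Suc k + l = p \<Longrightarrow> P (j, Suc k, l) \<Longrightarrow> P (Suc j, k, l)"
  shows "P i"
proof -
  obtain j k l where i: "i = (j, k, l)" by (metis surj_pair)
  have base: "P (0, k, l)" if "k + l = p" for k l
    using that
  proof (induction k arbitrary: l)
    case 0
    then show ?case using assms(2) by simp
  next
    case (Suc k)
    then show ?case using T[of 0 k l] Suc.IH[of "Suc l"] by simp
  qed
  have "P (j, k, l)" if "j + k + l = p"
    using that
  proof (induction j arbitrary: k)
    case 0
    then show ?case using base by simp
  next
    case (Suc j)
    then show ?case using U[of j k l] Suc.IH[of "Suc k"] by simp
  qed
  then show ?thesis using assms(1) i by simp
qed

section \<open>Commutators with ladder operators on the column of the lowest weight vector\<close>

lemma sum_single_hop: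
  assumes "\<And>i. i \<in> mono_index p \<Longrightarrow> f i = of_bool (i = b) * c" "b \<in> mono_index p"
  shows "(\<Sum>i\<in>mono_index p. f i * g i) = c * (g b :: complex)"
proof -
  have "(\<Sum>i\<in>mono_index p. f i * g i) = (\<Sum>i\<in>mono_index p. of_bool (True \<and> i = b) * c * g i)"
    by (intro sum.cong refl) (simp only: assms simp_thms)
  also have "\<dots> = of_bool True * c * g b" using assms(2) by (intro sum_hop) auto
  finally show ?thesis by simp
qed

lemma sum_T_minus_row:
  assumes "j + k + Suc l = p"
  shows "(\<Sum>i\<in>mono_index p. ladder p (matrix_unit 2 1) ((j, k, Suc l), i) * g i) =
    of_real (sqrt (real (Suc l) * real (Suc k))) * g (j, Suc k, l)"
proof (rule sum_single_hop)
  fix i assume i: "i \<in> mono_index p"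
  obtain j' k' l' where [simp]: "i = (j', k', l')" by (metis surj_pair)
  show "ladder p (matrix_unit 2 1) ((j, k, Suc l), i) =
      of_bool (i = (j, Suc k, l)) * of_real (sqrt (real (Suc l) * real (Suc k)))"
    using i assms by (auto simp del: ladder.simps of_nat_Suc simp: ladder_T_minus_entry)
qed (use assms in simp)

lemma sum_U_minus_row:
  assumes "j + Suc k + l = p"
  shows "(\<Sum>i\<in>mono_index p. ladder p (matrix_unit 3 2) ((j, Suc k, l), i) * g i) =
    of_real (sqrt (real (Suc k) * real (Suc j))) * g (Suc j, k, l)"
proof (rule sum_single_hop)
  fix i assume i: "i \<in> mono_index p"
  obtain j' k' l' where [simp]: "i = (j', k', l')" by (metis surj_pair)
  show "ladder p (matrix_unit 3 2) ((j, Suc k, l), i) =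
      of_bool (i = (Suc j, k, l)) * of_real (sqrt (real (Suc k) * real (Suc j)))"
    using i assms by (auto simp del: ladder.simps of_nat_Suc simp: ladder_U_minus_entry)
qed (use assms in simp)

lemma sum_T_plus_column:
  assumes "j + k + Suc l = p"
  shows "(\<Sum>i\<in>mono_index p. ladder p (matrix_unit 1 2) (i, (j, k, Suc l)) * g i) =
    of_real (sqrt (real (Suc k) * real (Suc l))) * g (j, Suc k, l)"
proof (rule sum_single_hop)
  fix i assume i: "i \<in> mono_index p"
  obtain j' k' l' where [simp]: "i = (j', k', l')" by (metis surj_pair)
  show "ladder p (matrix_unit 1 2) (i, (j, k, Suc l)) =
      of_bool (i = (j, Suc k, l)) * of_real (sqrt (real (Suc k) * real (Suc l)))"
    using i assms by (auto simp del: ladder.simps of_nat_Suc simp: ladder_T_plus_entry)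
qed (use assms in simp)

lemma sum_U_plus_column:
  assumes "j + Suc k + l = p"
  shows "(\<Sum>i\<in>mono_index p. ladder p (matrix_unit 2 3) (i, (j, Suc k, l)) * g i) =
    of_real (sqrt (real (Suc j) * real (Suc k))) * g (Suc j, k, l)"
proof (rule sum_single_hop)
  fix i assume i: "i \<in> mono_index p"
  obtain j' k' l' where [simp]: "i = (j', k', l')" by (metis surj_pair)
  show "ladder p (matrix_unit 2 3) (i, (j, Suc k, l)) =
      of_bool (i = (Suc j, k, l)) * of_real (sqrt (real (Suc j) * real (Suc k)))"
    using i assms by (auto simp del: ladder.simps of_nat_Suc simp: ladder_U_plus_entry)
qed (use assms in simp)

text \<open>Both lowering operators kill the lowest weight vector, so their columns there vanish.
  That vector is moreover a singlet for U-spin, so \<open>U_minus\<close> also has a zero row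
  there.\<close>

lemma ladder_minus_lowest:
  "ladder p (matrix_unit 2 1) (i, (0, 0, p)) = 0" "ladder p (matrix_unit 3 2) (i, (0, 0, p)) = 0"
  "ladder p (matrix_unit 3 2) ((0, 0, p), i) = 0"
proof -
  obtain j k l where "i = (j, k, l)" by (metis surj_pair)
  then show "ladder p (matrix_unit 2 1) (i, (0, 0, p)) = 0" "ladder p (matrix_unit 3 2) (i, (0, 0, p)) = 0"
    "ladder p (matrix_unit 3 2) ((0, 0, p), i) = 0"
    by (simp_all only: ladder_T_minus_entry ladder_U_minus_entry) auto
qed

text \<open>On this column the term with the ladder matrix on the right drops out, and the other
  reads off the entry of A at the raised index. Knowing the images under lowering at one index thus
  determines the elements at the next higher one.\<close>

lemma T_minus_lowest_column:
  assumes "j + k + Suc l = p"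
  shows "commutator p (ladder p (matrix_unit 2 1)) A ((j, k, Suc l), (0, 0, p)) =
    of_real (sqrt (real (Suc l) * real (Suc k))) * A ((j, Suc k, l), (0, 0, p))"
  using sum_T_minus_row[OF assms, of "\<lambda>i. A (i, (0, 0, p))"]
  by (simp add: commutator_def op_mult_def ladder_minus_lowest del: of_nat_Suc)

lemma U_minus_lowest_column:
  assumes "j + Suc k + l = p"
  shows "commutator p (ladder p (matrix_unit 3 2)) A ((j, Suc k, l), (0, 0, p)) =
    of_real (sqrt (real (Suc k) * real (Suc j))) * A ((Suc j, k, l), (0, 0, p))"
  using sum_U_minus_row[OF assms, of "\<lambda>i. A (i, (0, 0, p))"]
  by (simp add: commutator_def op_mult_def ladder_minus_lowest del: of_nat_Suc)

lemma U_minus_lowest_corner: "commutator p (ladder p (matrix_unit 3 2)) A ((0, 0, p), (0, 0, p)) = 0"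
  by (simp add: commutator_def op_mult_def ladder_minus_lowest)

section \<open>A Gelfand-Tsetlin family of type (n, n) inside the operator space\<close>

locale op_gt_family =
  fixes p n :: nat and e :: "weight \<Rightarrow> real \<Rightarrow> operator"
  assumes gt: "gt_family (op_inner (mono_index p)) (op_act p) n n e"
    and ops: "(\<nu>, J) \<in> gt_labels n n \<Longrightarrow> e \<nu> J \<in> ops (mono_index p)"
begin

abbreviation elem where "elem \<equiv> gt_elem n n e"
abbreviation lowest :: mono where "lowest \<equiv> (0, 0, p)"

lemma elem_in_ops: "gt_range n n rp rm n3 \<Longrightarrow> elem rp rm n3 \<in> ops (mono_index p)"
  unfolding gt_elem_def by (rule ops) (rule gt_elem_label)

lemma highest_range: "gt_range n n (int n) 0 0"
  by (simp add: gt_range_def)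

lemma U_minus_elem:
  assumes "gt_range n n rp rm n3"
  shows "commutator p (ladder p (matrix_unit 3 2)) (elem rp rm n3) i =
    of_real (sqrt (real_of_int ((rp - n3) * (n3 - rm + 1)))) * elem rp rm (n3 + 1) i"
  using fun_cong[OF gt_family_U_minus[OF gt assms], of i]
  unfolding U_minus_def drep_op_act[OF elem_in_ops[OF assms]] .

text \<open>A diagonal entry has weight zero, which forces the weight (n, n, n) and r_+ + r_- = 2n.
  If r_- < n, the element is a nonzero multiple of a \<open>U_minus\<close> image, and such an image
  has zero entry in this corner.\<close>

lemma lowest_corner:
  assumes r: "gt_range n n rp rm n3" and nz: "elem rp rm n3 (lowest, lowest) \<noteq> 0"
  shows "rp = int n \<and> rm = int n \<and> n3 = int n"
proof -
  have "op_weight p (gt_weight n n rp rm n3) (elem rp rm n3)"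
    by (rule op_weight_gt_elem[OF gt elem_in_ops[OF highest_range] r])
  then have "t_of (gt_weight n n rp rm n3) = 0" "u_of (gt_weight n n rp rm n3) = 0"
    using nz unfolding op_weight_def by fastforce+
  then have "3 * int n - (rp + rm) = rp + rm - n3" "rp + rm - n3 = n3"
    by (simp_all add: gt_weight_def)
  then have n3: "n3 = int n" "rp + rm = 2 * int n" by auto
  have "rm \<ge> int n"
  proof (rule ccontr)
    assume "\<not> rm \<ge> int n"
    then have r': "gt_range n n rp rm (n3 - 1)" using r n3 by (auto simp: gt_range_def)
    have "(rp - (n3 - 1)) * (n3 - 1 - rm + 1) > 0" using r r' by (auto simp: gt_range_def intro!: mult_pos_pos)
    moreover have "complex_of_real (sqrt (real_of_int ((rp - (n3 - 1)) * (n3 - 1 - rm + 1)))) * elem rp rm (n3 - 1 + 1) (lowest, lowest) = 0"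
      using U_minus_elem[OF r', of "(lowest, lowest)"] by (simp only: U_minus_lowest_corner)
    ultimately show False
      using nz by (simp only: diff_add_cancel mult_eq_0_iff of_real_eq_0_iff real_sqrt_eq_0_iff of_int_eq_0_iff) auto
  qed
  then show ?thesis using n3 r by (auto simp: gt_range_def)
qed

text \<open>At the edge \<nu>3 = r_+ the recursion refers to a value of \<open>e\<close> outside the
  labels, about which nothing is assumed; its coefficient is zero there.\<close>

lemma U_minus_closed:
  assumes zero: "\<And>rp rm n3. gt_range n n rp rm n3 \<Longrightarrow> elem rp rm n3 i = 0" and r: "gt_range n n rp rm n3"
  shows "commutator p (ladder p (matrix_unit 3 2)) (elem rp rm n3) i = 0"
proof (cases "n3 = rp")
  case False
  then have "gt_range n n rp rm (n3 + 1)" using r by (auto simp: gt_range_def)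
  then show ?thesis unfolding U_minus_elem[OF r] by (simp add: zero)
next
  case True
  then show ?thesis unfolding U_minus_elem[OF r] by simp
qed

text \<open>As for \<open>U_minus\<close>, with two neighbours: whenever one of them is not a label,
  a factor of its coefficient vanishes.\<close>

lemma T_minus_closed:
  assumes zero: "\<And>rp rm n3. gt_range n n rp rm n3 \<Longrightarrow> elem rp rm n3 i = 0" and r: "gt_range n n rp rm n3"
  shows "commutator p (ladder p (matrix_unit 2 1)) (elem rp rm n3) i = 0"
proof -
  have 1: "rm = int n \<or> n3 = rm \<or> elem rp (rm + 1) n3 i = 0"
  proof -
    have "gt_range n n rp (rm + 1) n3" if "rm \<noteq> int n" "n3 \<noteq> rm"
      using r that by (auto simp: gt_range_def)
    then show ?thesis using zero by blast
  qed
  have 2: "rp = int n + int n \<or> elem (rp + 1) rm n3 i = 0"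
  proof -
    have "gt_range n n (rp + 1) rm n3" if "rp \<noteq> int n + int n"
      using r that by (auto simp: gt_range_def)
    then show ?thesis using zero by blast
  qed
  show ?thesis
    using fun_cong[OF gt_family_T_minus[OF gt r], of i] 1 2
    unfolding T_minus_def drep_op_act[OF elem_in_ops[OF r]] by auto
qed

text \<open>If the family were orthogonal to the projection onto the lowest weight vector, it would be
  orthogonal to everything obtained from that projection by raising operators, so its highest
  weight element would kill the lowest weight vector. But the highest weight element commutes with
  the raising operators, and these generate the whole space from the lowest weight vector.\<close>

lemma corner_nonzero: "elem (int n) (int n) (int n) (lowest, lowest) \<noteq> 0"
proof
  assume zero0: "elem (int n) (int n) (int n) (lowest, lowest) = 0"
  \<comment> \<open>The claim is made for the whole family at once: the entry at a raised index is,
    up to a nonzero factor, the entry at the previous index of a lowered element, and that is a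
    combination of family elements.\<close>
  have col: "\<forall>rp rm n3. gt_range n n rp rm n3 \<longrightarrow> elem rp rm n3 (i, lowest) = 0"
    if "i \<in> mono_index p" for i
    using that
  proof (rule mono_index_induct)
    show "\<forall>rp rm n3. gt_range n n rp rm n3 \<longrightarrow> elem rp rm n3 (lowest, lowest) = 0"
      using lowest_corner zero0 by blast
  next
    fix j k l
    assume s: "j + k + Suc l = p"
      and IH: "\<forall>rp rm n3. gt_range n n rp rm n3 \<longrightarrow> elem rp rm n3 ((j, k, Suc l), lowest) = 0"
    show "\<forall>rp rm n3. gt_range n n rp rm n3 \<longrightarrow> elem rp rm n3 ((j, Suc k, l), lowest) = 0"
    proof (intro allI impI)
      fix rp rm n3 assume r: "gt_range n n rp rm n3"
      have "commutator p (ladder p (matrix_unit 2 1)) (elem rp rm n3) ((j, k, Suc l), lowest) = 0"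
        using IH r by (intro T_minus_closed) blast+
      then show "elem rp rm n3 ((j, Suc k, l), lowest) = 0"
        unfolding T_minus_lowest_column[OF s] by (simp del: of_nat_Suc)
    qed
  next
    fix j k l
    assume s: "j + Suc k + l = p"
      and IH: "\<forall>rp rm n3. gt_range n n rp rm n3 \<longrightarrow> elem rp rm n3 ((j, Suc k, l), lowest) = 0"
    show "\<forall>rp rm n3. gt_range n n rp rm n3 \<longrightarrow> elem rp rm n3 ((Suc j, k, l), lowest) = 0"
    proof (intro allI impI)
      fix rp rm n3 assume r: "gt_range n n rp rm n3"
      have "commutator p (ladder p (matrix_unit 3 2)) (elem rp rm n3) ((j, Suc k, l), lowest) = 0"
        using IH r by (intro U_minus_closed) blast+
      then show "elem rp rm n3 ((Suc j, k, l), lowest) = 0"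
        unfolding U_minus_lowest_column[OF s] by (simp del: of_nat_Suc)
    qed
  qed
  let ?h = "elem (int n) 0 0"
  have h: "?h \<in> ops (mono_index p)" by (rule elem_in_ops[OF highest_range])
  have comm: "commutator p (ladder p (matrix_unit 1 2)) ?h x = 0" "commutator p (ladder p (matrix_unit 2 3)) ?h x = 0" for x
    using fun_cong[OF gt_family_highest(1)[OF gt], of x] fun_cong[OF gt_family_highest(2)[OF gt], of x]
    unfolding T_plus_def U_plus_def drep_op_act[OF h] by simp_all
  \<comment> \<open>Since \<open>?h\<close> commutes with the raising operators, a zero column at
    one monomial forces a zero column at the raised one. This ends in \<open>?h\<close> being zero,
    against its norm 1.\<close>
  have zero: "\<forall>i. ?h (i, j) = 0" if "j \<in> mono_index p" for j
    using that
  proof (rule mono_index_induct)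
    show "\<forall>i. ?h (i, lowest) = 0"
      using col highest_range ops_eq_0[OF h] by blast
  next
    fix j k l
    assume s: "j + k + Suc l = p" and IH: "\<forall>i. ?h (i, (j, k, Suc l)) = 0"
    show "\<forall>i. ?h (i, (j, Suc k, l)) = 0"
    proof
      fix i
      have "op_mult (mono_index p) ?h (ladder p (matrix_unit 1 2)) (i, (j, k, Suc l)) = 0"
        using comm(1)[of "(i, (j, k, Suc l))"] IH by (simp add: commutator_def op_mult_def)
      then show "?h (i, (j, Suc k, l)) = 0"
        using sum_T_plus_column[OF s, of "\<lambda>m. ?h (i, m)"]
        by (simp add: op_mult_def mult.commute del: of_nat_Suc)
    qed
  next
    fix j k l
    assume s: "j + Suc k + l = p" and IH: "\<forall>i. ?h (i, (j, Suc k, l)) = 0"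
    show "\<forall>i. ?h (i, (Suc j, k, l)) = 0"
    proof
      fix i
      have "op_mult (mono_index p) ?h (ladder p (matrix_unit 2 3)) (i, (j, Suc k, l)) = 0"
        using comm(2)[of "(i, (j, Suc k, l))"] IH by (simp add: commutator_def op_mult_def)
      then show "?h (i, (Suc j, k, l)) = 0"
        using sum_U_plus_column[OF s, of "\<lambda>m. ?h (i, m)"]
        by (simp add: op_mult_def mult.commute del: of_nat_Suc)
    qed
  qed
  then have z: "?h (i, j) = 0" if "j \<in> mono_index p" for i j using that by blast
  have "op_inner (mono_index p) ?h ?h = 0"
    unfolding op_inner_def op_trace_def op_mult_def prod.case
    by (intro sum.neutral ballI) (simp only: z mult_zero_right)
  moreover have "op_inner (mono_index p) ?h ?h = 1"
    using gt gt_elem_label[OF highest_range] unfolding gt_family_def gt_elem_def by fastforce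
  ultimately show False by simp
qed

end

section \<open>The symbol map\<close>

definition first_axis :: "complex^3" where "first_axis = vector [1, 0, 0]"

definition lowest_proj :: "nat \<Rightarrow> operator" where
  "lowest_proj p = (\<lambda>(i, j). of_bool (i = (0, 0, p) \<and> j = (0, 0, p)))"

lemma norm_first_axis: "norm first_axis = 1"
  by (simp add: first_axis_def norm_vec_def L2_set_def sum_3)

text \<open>The sign is that of \<open>check_e 3\<close>, the negative of the first dual basis
  vector; it disappears in the projection.\<close>

lemma coherent_first_axis: "coherent p first_axis i = of_bool (i = (0, 0, p)) * (-1) ^ p"
proof -
  obtain j k l where i: "i = (j, k, l)" by (metis surj_pair)
  show ?thesis by (cases "j = 0"; cases "k = 0") (simp_all add: i coherent_apply first_axis_def)
qed

lemma coherent_proj_first_axis: "coherent_proj p first_axis = lowest_proj p"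
proof -
  have "(-1 :: complex) ^ p * (-1) ^ p = 1" by (cases "even p") auto
  then show ?thesis
    by (auto simp: coherent_proj_def lowest_proj_def coherent_first_axis fun_eq_iff)
qed

lemma lowest_proj_in_ops: "lowest_proj p \<in> ops (mono_index p)"
  unfolding coherent_proj_first_axis[symmetric] by (rule coherent_proj_in_ops)

lemma op_apply_lowest_proj: "op_apply (mono_index p) (lowest_proj p) v i = of_bool (i = (0, 0, p)) * v (0, 0, p)"
proof -
  have "op_apply (mono_index p) (lowest_proj p) v i =
      (\<Sum>j\<in>mono_index p. of_bool (i = (0, 0, p) \<and> j = (0, 0, p)) * 1 * v j)"
    by (simp add: op_apply_def lowest_proj_def)
  also have "\<dots> = of_bool (i = (0, 0, p)) * 1 * v (0, 0, p)" by (rule sum_hop) auto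
  finally show ?thesis by simp
qed

lemma lowest_weight_iff:
  assumes "i \<in> mono_index p"
  shows "mono_t i = t_of (0, int p, int p) \<and> mono_u i = u_of (0, int p, int p) \<longleftrightarrow> i = (0, 0, p)"
  using assms by (cases i) (auto simp: field_simps)

lemma lowest_weight_space:
  "weight_space p (0, int p, int p) = {v \<in> cspace (mono_index p). \<forall>i. v i \<noteq> 0 \<longrightarrow> i = (0, 0, p)}"
proof -
  have "(T_three (vec_act p) v = (\<lambda>i. of_real (t_of (0, int p, int p)) * v i) \<and>
      U_three (vec_act p) v = (\<lambda>i. of_real (u_of (0, int p, int p)) * v i)) \<longleftrightarrow>
      (\<forall>i. v i \<noteq> 0 \<longrightarrow> i = (0, 0, p))" if v: "v \<in> cspace (mono_index p)" for v
  proof -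
    have "(of_real (mono_t i) * v i = of_real (t_of (0, int p, int p)) * v i \<and>
        of_real (mono_u i) * v i = of_real (u_of (0, int p, int p)) * v i) \<longleftrightarrow>
        (v i \<noteq> 0 \<longrightarrow> i = (0, 0, p))" for i
      using lowest_weight_iff[of i p] cspace_nonzero[OF v, of i]
      by (simp only: mult_cancel_right of_real_eq_iff) blast
    then show ?thesis unfolding drep_three[OF v] fun_eq_iff by blast
  qed
  then show ?thesis unfolding weight_space_def by blast
qed

text \<open>Uniqueness is tested column by column: the basis vector at (0, 0, p) lies in the weight
  space and all other basis vectors are orthogonal to it, so the defining conditions prescribe every
  column.\<close>

lemma weight_projection_lowest: "weight_projection p (0, int p, int p) = lowest_proj p"
  unfolding weight_projection_def orth_projection_def lowest_weight_space
proof (rule the_equality, intro conjI ballI impI)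
  let ?S = "{v \<in> cspace (mono_index p). \<forall>i. v i \<noteq> 0 \<longrightarrow> i = (0, 0, p)}"
  define d :: "mono \<Rightarrow> mono \<Rightarrow> complex" where "d j = (\<lambda>i. of_bool (i = j))" for j
  have d: "d j \<in> cspace (mono_index p)" if "j \<in> mono_index p" for j
    using that unfolding cspace_def d_def by auto
  have d0: "d (0, 0, p) \<in> ?S" using d[of "(0, 0, p)"] by (simp add: d_def)
  have inner: "cinner (mono_index p) (d j) v = v j" if "j \<in> mono_index p" for j v
  proof -
    have "cinner (mono_index p) (d j) v = (\<Sum>i\<in>mono_index p. of_bool (True \<and> i = j) * 1 * v i)"
      unfolding cinner_def d_def by (intro sum.cong refl) auto
    also have "\<dots> = v j" using that by (subst sum_hop) auto
    finally show ?thesis .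
  qed
  show "lowest_proj p \<in> ops (mono_index p)" by (rule lowest_proj_in_ops)
  show "op_apply (mono_index p) (lowest_proj p) v = v" if "v \<in> ?S" for v
    using that by (auto simp: op_apply_lowest_proj fun_eq_iff)
  show "op_apply (mono_index p) (lowest_proj p) v = (\<lambda>_. 0)"
    if "v \<in> cspace (mono_index p)" "\<forall>s\<in>?S. cinner (mono_index p) s v = 0" for v
    using bspec[OF that(2) d0] inner[of "(0, 0, p)" v] by (simp add: op_apply_lowest_proj fun_eq_iff)
  fix Q
  assume Q: "Q \<in> ops (mono_index p) \<and> (\<forall>v\<in>?S. op_apply (mono_index p) Q v = v) \<and>
    (\<forall>v\<in>cspace (mono_index p). (\<forall>s\<in>?S. cinner (mono_index p) s v = 0) \<longrightarrow>
      op_apply (mono_index p) Q v = (\<lambda>_. 0))"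
  have col: "op_apply (mono_index p) Q (d j) i = Q (i, j)" if "j \<in> mono_index p" for i j
  proof -
    have "op_apply (mono_index p) Q (d j) i = (\<Sum>k\<in>mono_index p. of_bool (True \<and> k = j) * 1 * Q (i, k))"
      unfolding op_apply_def d_def by (intro sum.cong refl) auto
    also have "\<dots> = Q (i, j)" using that by (subst sum_hop) auto
    finally show ?thesis .
  qed
  have "Q (i, j) = lowest_proj p (i, j)" for i j
  proof (cases "j \<in> mono_index p")
    case False
    have "Q (i, j) = 0" using Q False by (intro ops_eq_0[of Q "mono_index p"]) auto
    moreover have "lowest_proj p (i, j) = 0"
      using lowest_proj_in_ops False by (intro ops_eq_0[of _ "mono_index p"]) auto
    ultimately show ?thesis by simp
  next
    case True
    show ?thesis
    proof (cases "j = (0, 0, p)")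
      case j: True
      have "op_apply (mono_index p) Q (d j) = d j" using Q d0 j by blast
      then show ?thesis using col[OF True, of i] j by (simp add: d_def lowest_proj_def)
    next
      case j: False
      have "\<forall>s\<in>?S. cinner (mono_index p) s (d j) = 0"
        using j by (auto simp: cinner_def d_def intro!: sum.neutral)
      then have "op_apply (mono_index p) Q (d j) = (\<lambda>_. 0)" using Q d[OF True] by blast
      then show ?thesis using col[OF True, of i] j by (simp add: lowest_proj_def)
    qed
  qed
  then show "Q = lowest_proj p" by (auto simp: fun_eq_iff)
qed

section \<open>Homogeneity and the symbol as a function on the projective plane\<close>

lemma norm_vector_smult: "norm (c *s v) = cmod c * norm (v :: complex^'n)"
  by (simp add: norm_vec_def norm_mult L2_set_right_distrib)

lemma husimi_scale: "husimi p A (c *s n) = of_real (cmod c ^ (2 * p)) * husimi p A n"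
proof -
  have "cnj c ^ p * c ^ p = of_real (cmod c ^ (2 * p))"
    by (simp add: power_mult power_mult_distrib[symmetric] complex_norm_square[symmetric]
        mult.commute[of "cnj c"])
  then have eq: "cnj (cnj c ^ p * x) * y * (cnj c ^ p * z) = of_real (cmod c ^ (2 * p)) * (cnj x * y * z)" for x y z
    by (metis (no_types, opaque_lifting) complex_cnj_cnj complex_cnj_mult complex_cnj_power
        mult.assoc mult.left_commute)
  then show ?thesis
    unfolding husimi_coherent coherent_scale by (simp only: eq sum_distrib_left)
qed

lemma proj_scale: "n \<noteq> 0 \<Longrightarrow> c \<noteq> 0 \<Longrightarrow> proj (c *s n) = proj n"
  by (subst eq_commute, subst proj_eq_iff) auto

text \<open>Two unit vectors over the same point differ by a phase, and \<open>husimi\<close> scales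
  by the 2p-th power of the modulus. The choice made in \<open>B_minus\<close> is therefore
  immaterial.\<close>

lemma B_minus_proj_unit:
  assumes n: "norm n = 1"
  shows "B_minus p A (proj n) = husimi p A n"
proof -
  define m where "m = (SOME m. norm m = 1 \<and> proj m = proj n)"
  have "norm m = 1 \<and> proj m = proj n"
    unfolding m_def by (rule someI[of _ n]) (use n in simp)
  then have m: "norm m = 1" "proj m = proj n" by auto
  then obtain c where c: "n = c *s m"
    using proj_eq_iff[of m n] n by fastforce
  then have "cmod c = 1" using m(1) n by (simp add: norm_vector_smult)
  then have "husimi p A m = husimi p A n" by (simp add: c husimi_scale)
  then show ?thesis unfolding B_minus_def m_def[symmetric] .
qed

lemma unit_representative:
  obtains n where "norm n = 1" "proj n = x"
proof -
  let ?r = "rep_cp2 x"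
  have r: "norm ?r \<noteq> 0" using rep_cp2_nonzero by simp
  have "norm (of_real (inverse (norm ?r)) *s ?r) = 1"
    using r by (simp add: norm_vector_smult norm_inverse)
  moreover have "proj (of_real (inverse (norm ?r)) *s ?r) = x"
    using r by (subst proj_scale) (auto simp: proj_rep_cp2)
  ultimately show ?thesis using that by blast
qed

text \<open>The homogeneous form, valid for every nonzero representative. The affine charts and the
  ball over which \<open>cp2_integral\<close> integrates do not consist of unit vectors.\<close>

lemma B_minus_proj:
  assumes "z \<noteq> 0"
  shows "B_minus p A (proj z) = husimi p A z / of_real (norm z ^ (2 * p))"
proof -
  let ?c = "of_real (inverse (norm z)) :: complex"
  have "norm (?c *s z) = 1" using assms by (simp add: norm_vector_smult norm_inverse)
  then have "B_minus p A (proj (?c *s z)) = husimi p A (?c *s z)" by (rule B_minus_proj_unit)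
  moreover have "proj (?c *s z) = proj z" using assms by (intro proj_scale) auto
  moreover have "cmod ?c = inverse (norm z)" by (simp add: norm_inverse)
  ultimately show ?thesis
    by (simp only: husimi_scale power_inverse of_real_inverse divide_inverse mult.commute)
qed

lemma B_minus_op_act:
  assumes g: "g \<in> SU3"
  shows "B_minus p (op_act p g A) x = B_minus p A (act (matrix_inv g) x)"
proof -
  obtain n where n: "norm n = 1" "proj n = x" by (rule unit_representative)
  then have n0: "n \<noteq> 0" by auto
  have g': "cadjoint g \<in> SU3" by (rule cadjoint_SU3[OF g])
  have "B_minus p (op_act p g A) x = husimi p A (cadjoint g *v n)"
    using n B_minus_proj_unit[OF n(1)] husimi_op_act[OF SU3_unitary[OF g]] by simp
  also have "\<dots> = B_minus p A (proj (cadjoint g *v n))"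
    using B_minus_proj_unit[of "cadjoint g *v n"] norm_SU3[OF g'] n by simp
  finally show ?thesis using act_proj[OF g' n0] n by (simp add: matrix_inv_SU3[OF g])
qed

lemma isotropy_unitary:
  assumes "h \<in> isotropy_group"
  shows "h \<in> unitary_group" "\<exists>c. cmod c = 1 \<and> h *v first_axis = c *s first_axis"
proof -
  obtain U :: "complex^2^2" where U: "U \<in> unitary_group"
    and h: "h = vector [vector [inverse (det U), 0, 0],
              vector [0, U $ 1 $ 1, U $ 1 $ 2], vector [0, U $ 2 $ 1, U $ 2 $ 2]]"
    using assms by (auto simp: isotropy_group_def)
  have UU: "cadjoint U ** U = mat 1" using U by (simp add: unitary_group_def)
  have "det (cadjoint U) = cnj (det U)" by (simp add: det_2)
  then have "cnj (det U) * det U = 1" using arg_cong[OF UU, of det] by (simp add: det_mul)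
  then have "of_real ((cmod (det U))\<^sup>2) = (1 :: complex)"
    unfolding complex_norm_square by (simp only: mult.commute)
  then have "(cmod (det U))\<^sup>2 = 1" by (simp only: of_real_eq_1_iff)
  then have d: "cmod (det U) = 1" by (simp add: power2_eq_1_iff) (smt (verit) norm_ge_zero)
  have dd: "cnj (inverse (det U)) * inverse (det U) = 1"
    using \<open>cnj (det U) * det U = 1\<close> by (metis complex_cnj_inverse inverse_1 inverse_mult_distrib mult.commute)
  have e: "cnj (U $ 1 $ i) * U $ 1 $ j + cnj (U $ 2 $ i) * U $ 2 $ j = (if i = j then 1 else 0)" for i j
    using arg_cong[OF UU, of "\<lambda>M. M $ i $ j"] by (simp add: matrix_matrix_mult_def sum_2 mat_def)
  have "cadjoint h ** h = mat 1"
    using dd e[of 1 1] e[of 1 2] e[of 2 1] e[of 2 2]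
    by (simp add: vec_eq_iff forall_3 matrix_matrix_mult_def sum_3 mat_def h)
  moreover from this have "h ** cadjoint h = mat 1" by (simp add: matrix_left_right_inverse)
  ultimately show "h \<in> unitary_group" by (simp add: unitary_group_def)
  have "h *v first_axis = inverse (det U) *s first_axis"
    by (simp add: vec_eq_iff forall_3 matrix_vector_mult_def sum_3 h first_axis_def)
  moreover have "cmod (inverse (det U)) = 1" using d by (simp add: norm_inverse)
  ultimately show "\<exists>c. cmod c = 1 \<and> h *v first_axis = c *s first_axis" by blast
qed

lemma B_minus_kernel: "is_operator_kernel p (B_minus p) (lowest_proj p)"
  unfolding is_operator_kernel_def
proof (intro conjI ballI)
  show "lowest_proj p \<in> ops (mono_index p)" by (rule lowest_proj_in_ops)
next
  fix h assume h: "h \<in> isotropy_group"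
  obtain c where "cmod c = 1" "h *v first_axis = c *s first_axis" using isotropy_unitary(2)[OF h] by blast
  then show "op_act p h (lowest_proj p) = lowest_proj p"
    using op_act_coherent_proj[OF isotropy_unitary(1)[OF h], of p first_axis]
    by (simp add: coherent_proj_phase coherent_proj_first_axis)
next
  fix A g assume g: "g \<in> SU3"
  have "first_axis \<noteq> 0" using norm_first_axis by auto
  then have "act g base_point = proj (g *v first_axis)"
    using act_proj[OF g, of first_axis] by (simp add: base_point_def first_axis_def)
  moreover have "norm (g *v first_axis) = 1" by (simp add: norm_SU3[OF g] norm_first_axis)
  ultimately have "B_minus p A (act g base_point) = husimi p A (g *v first_axis)"
    by (simp add: B_minus_proj_unit)
  also have "\<dots> = op_trace (mono_index p) (op_mult (mono_index p) A (op_act p g (lowest_proj p)))"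
    unfolding coherent_proj_first_axis[symmetric] op_act_coherent_proj[OF SU3_unitary[OF g]]
    by (rule op_trace_coherent_proj[symmetric])
  finally show "B_minus p A (act g base_point) =
      op_trace (mono_index p) (op_mult (mono_index p) A (op_act p g (lowest_proj p)))" .
qed

lemma coherent_nonzero:
  assumes "n \<noteq> 0"
  shows "coherent p n \<noteq> (\<lambda>_. 0)"
proof
  assume "coherent p n = (\<lambda>_. 0)"
  then have z: "coherent p n (p, 0, 0) = 0" "coherent p n (0, p, 0) = 0" "coherent p n (0, 0, p) = 0"
    by simp_all
  then have "n $ 1 = 0" "n $ 2 = 0" "n $ 3 = 0" by (auto simp: coherent_apply split: if_splits)
  then show False using assms by (simp add: vec_eq_iff forall_3)
qed

lemma B_minus_mapping_positive: "mapping_positive p (B_minus p)"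
  unfolding mapping_positive_def
proof (intro conjI allI impI)
  fix A x assume A: "positive_op (mono_index p) A"
  obtain n where n: "norm n = 1" "proj n = x" by (rule unit_representative)
  then have B: "B_minus p A x = cinner (mono_index p) (coherent p n) (op_apply (mono_index p) A (coherent p n))"
    using B_minus_proj_unit[OF n(1)] by (simp add: husimi_def coherent_def)
  then show "B_minus p A x \<in> \<real>" "0 \<le> Re (B_minus p A x)"
    using A coherent_in_cspace[of p n] unfolding positive_op_def B by blast+
next
  fix A x assume A: "positive_definite_op (mono_index p) A"
  obtain n where n: "norm n = 1" "proj n = x" by (rule unit_representative)
  then have B: "B_minus p A x = cinner (mono_index p) (coherent p n) (op_apply (mono_index p) A (coherent p n))"
    using B_minus_proj_unit[OF n(1)] by (simp add: husimi_def coherent_def)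
  have "coherent p n \<noteq> (\<lambda>_. 0)" using n by (intro coherent_nonzero) auto
  then show "B_minus p A x \<in> \<real>" "0 < Re (B_minus p A x)"
    using A coherent_in_cspace[of p n] unfolding positive_definite_op_def B by blast+
qed

lemma SU3_transitive:
  assumes n: "norm n = 1"
  obtains g where "g \<in> SU3" "g *v first_axis = n"
proof -
  define a b c where "a = n $ 1" and "b = n $ 2" and "c = n $ 3"
  have norm: "(norm n)\<^sup>2 = (cmod a)\<^sup>2 + (cmod b)\<^sup>2 + (cmod c)\<^sup>2"
    by (simp add: norm_vec_def L2_set_def sum_3 a_def b_def c_def)
  have unit: "a * cnj a + b * cnj b + c * cnj c = 1"
    using arg_cong[OF norm, of complex_of_real] unfolding of_real_add complex_norm_square n by simp
  have SU3: "g \<in> SU3" if "cadjoint g ** g = mat 1" "det g = 1" for g :: "complex^3^3"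
    using that by (simp add: SU3_def unitary_group_def matrix_left_right_inverse)
  show ?thesis
  proof (cases "b = 0 \<and> c = 0")
    case True
    let ?g = "vector [vector [a, 0, 0], vector [0, cnj a, 0], vector [0, 0, 1]] :: complex^3^3"
    have "?g \<in> SU3"
      using unit True
      by (intro SU3) (simp_all add: vec_eq_iff forall_3 matrix_matrix_mult_def sum_3 mat_def det_3 mult.commute)
    moreover have "?g *v first_axis = n"
      using True by (simp add: vec_eq_iff forall_3 matrix_vector_mult_def sum_3 first_axis_def a_def b_def c_def)
    ultimately show ?thesis by (rule that)
  next
    case False
    define s where "s = sqrt ((cmod b)\<^sup>2 + (cmod c)\<^sup>2)"
    have "(cmod b)\<^sup>2 + (cmod c)\<^sup>2 > 0"
      using False by (auto simp: sum_power2_gt_zero_iff)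
    then have s: "s > 0" "s * s = (cmod b)\<^sup>2 + (cmod c)\<^sup>2" by (simp_all add: s_def)
    define t :: complex where "t = of_real s"
    have t0: "t \<noteq> 0" using s by (simp add: t_def)
    have tt: "t * t = b * cnj b + c * cnj c"
      using arg_cong[OF s(2), of complex_of_real] unfolding of_real_add complex_norm_square of_real_mult t_def .
    define r where "r = inverse t"
    have cnj: "cnj t = t" "cnj r = r" by (simp_all add: t_def r_def)
    have rt: "r * t = 1" using t0 by (simp add: r_def)
    \<comment> \<open>The third column is the first axis made orthogonal to n = (a, b, c) and
      normalised: the projected vector has norm t, the square root of 1 minus the squared modulus of
      a. The second column is (0, - cnj c, cnj b) / t, with the sign that makes the determinant
      1.\<close>
    let ?g = "vector [vector [a, 0, t], vector [b, - cnj c * r, - cnj a * b * r],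
        vector [c, cnj b * r, - cnj a * c * r]] :: complex^3^3"
    have e: "cnj a * a + cnj b * b + cnj c * c = 1"
      "t * a - a * cnj b * r * b - a * cnj c * r * c = 0"
      "cnj a * t - cnj b * (cnj a * b * r) - cnj c * (cnj a * c * r) = 0"
      "b * r * (cnj b * r) + c * r * (cnj c * r) = 1"
      "t * t + a * cnj b * r * (cnj a * b * r) + a * cnj c * r * (cnj a * c * r) = 1"
      "a * (cnj c * r * (cnj a * c * r) + cnj a * b * r * (cnj b * r)) + t * (b * (cnj b * r) + cnj c * r * c) = 1"
      using unit tt rt by algebra+
    have "cadjoint ?g ** ?g = mat 1"
      using e by (simp add: vec_eq_iff forall_3 matrix_matrix_mult_def sum_3 mat_def cnj)
    moreover have "det ?g = 1"
      using e(6) by (simp add: det_3 algebra_simps)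
    ultimately have "?g \<in> SU3" by (rule SU3)
    moreover have "?g *v first_axis = n"
      by (simp add: vec_eq_iff forall_3 matrix_vector_mult_def sum_3 first_axis_def a_def b_def c_def)
    ultimately show ?thesis by (rule that)
  qed
qed

section \<open>Smoothness and the invariant integral\<close>

text \<open>\<open>Ck\<close> asks for all iterated directional derivatives, so the induction needs
  a class of functions closed under them. Linearity is real, so complex conjugation is
  included.\<close>

inductive smooth_expr :: "('a :: real_normed_vector \<Rightarrow> complex) \<Rightarrow> bool" where
  const: "smooth_expr (\<lambda>_. c)"
| linear: "bounded_linear f \<Longrightarrow> smooth_expr f"
| add: "smooth_expr f \<Longrightarrow> smooth_expr g \<Longrightarrow> smooth_expr (\<lambda>x. f x + g x)"
| mult: "smooth_expr f \<Longrightarrow> smooth_expr g \<Longrightarrow> smooth_expr (\<lambda>x. f x * g x)"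
| inverse: "smooth_expr f \<Longrightarrow> (\<And>x. f x \<noteq> 0) \<Longrightarrow> smooth_expr (\<lambda>x. inverse (f x))"

lemma smooth_expr_minus:
  assumes "smooth_expr f" shows "smooth_expr (\<lambda>x. - f x)"
  using smooth_expr.mult[OF smooth_expr.const[of "- 1"] assms] by simp

lemma smooth_expr_power:
  assumes "smooth_expr f" shows "smooth_expr (\<lambda>x. f x ^ m)"
  by (induction m) (simp_all add: smooth_expr.const smooth_expr.mult[OF assms])

lemma smooth_expr_sum:
  assumes "\<And>i. i \<in> I \<Longrightarrow> smooth_expr (f i)"
  shows "smooth_expr (\<lambda>x. \<Sum>i\<in>I. f i x)"
proof (cases "finite I")
  case True
  then show ?thesis using assms
    by (induction I rule: finite_induct) (simp_all add: smooth_expr.const smooth_expr.add)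
qed (simp add: smooth_expr.const)

lemma smooth_expr_derivative:
  assumes "smooth_expr f"
  shows "\<exists>f'. (\<forall>x. (f has_derivative f' x) (at x)) \<and> (\<forall>v. smooth_expr (\<lambda>x. f' x v))"
  using assms
proof induction
  case (const c)
  show ?case by (intro exI[of _ "\<lambda>x v. 0"]) (auto intro: smooth_expr.const)
next
  case (linear f)
  then show ?case
    by (intro exI[of _ "\<lambda>x. f"]) (auto intro: smooth_expr.const bounded_linear_imp_has_derivative)
next
  case (add f g)
  then obtain f' g' where
    "\<And>x. (f has_derivative f' x) (at x)" "\<And>v. smooth_expr (\<lambda>x. f' x v)"
    "\<And>x. (g has_derivative g' x) (at x)" "\<And>v. smooth_expr (\<lambda>x. g' x v)" by blast
  then show ?case
    by (intro exI[of _ "\<lambda>x v. f' x v + g' x v"]) (auto intro: smooth_expr.add has_derivative_add)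
next
  case (mult f g)
  then obtain f' g' where
    "\<And>x. (f has_derivative f' x) (at x)" "\<And>v. smooth_expr (\<lambda>x. f' x v)"
    "\<And>x. (g has_derivative g' x) (at x)" "\<And>v. smooth_expr (\<lambda>x. g' x v)" by blast
  then show ?case using mult.hyps
    by (intro exI[of _ "\<lambda>x v. f x * g' x v + f' x v * g x"])
      (intro conjI allI has_derivative_mult smooth_expr.add smooth_expr.mult; assumption)
next
  case (inverse f)
  then obtain f' where f':
    "\<And>x. (f has_derivative f' x) (at x)" "\<And>v. smooth_expr (\<lambda>x. f' x v)" by blast
  have inv: "smooth_expr (\<lambda>x. inverse (f x))" using inverse.hyps by (rule smooth_expr.inverse)
  show ?case
    using f' inverse.hyps(2)
    by (intro exI[of _ "\<lambda>x v. - (inverse (f x) * f' x v * inverse (f x))"])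
      (auto intro!: smooth_expr_minus smooth_expr.mult inv has_derivative_inverse)
qed

lemma smooth_expr_Ck: "smooth_expr f \<Longrightarrow> Ck k f"
proof (induction k arbitrary: f)
  case 0
  then obtain f' where "\<forall>x. (f has_derivative f' x) (at x)" using smooth_expr_derivative by blast
  then show ?case by (auto intro!: continuous_at_imp_continuous_on has_derivative_continuous)
next
  case (Suc k)
  then obtain f' where f': "\<And>x. (f has_derivative f' x) (at x)" "\<And>v. smooth_expr (\<lambda>x. f' x v)"
    using smooth_expr_derivative by blast
  have "frechet_derivative f (at x) = f' x" for x using frechet_derivative_at[OF f'(1)[of x]] by simp
  moreover have "f differentiable_on UNIV"
    using f'(1) by (auto simp: differentiable_on_def differentiable_def)
  ultimately show ?case using Suc.IH[OF f'(2)] by simp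
qed

lemma norm_square_sum: "complex_of_real (norm z ^ (2 * p)) = (z $ 1 * cnj (z $ 1) + z $ 2 * cnj (z $ 2) + z $ 3 * cnj (z $ 3)) ^ p"
  for z :: "complex^3"
proof -
  have "(norm z)\<^sup>2 = (cmod (z $ 1))\<^sup>2 + (cmod (z $ 2))\<^sup>2 + (cmod (z $ 3))\<^sup>2"
    by (simp add: norm_vec_def L2_set_def sum_3)
  then have "complex_of_real ((norm z)\<^sup>2) = z $ 1 * cnj (z $ 1) + z $ 2 * cnj (z $ 2) + z $ 3 * cnj (z $ 3)"
    by (simp only: of_real_add complex_norm_square)
  then show ?thesis by (simp only: power_mult of_real_power)
qed

text \<open>By homogeneity the symbol is a polynomial in the coordinates and their conjugates
  divided by \<open>norm (z w) ^ (2 * p)\<close>, itself such a polynomial and nowhere zero on the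
  chart.\<close>

lemma B_minus_smooth_chart:
  fixes z :: "'a :: real_normed_vector \<Rightarrow> complex^3"
  assumes z: "\<And>i. smooth_expr (\<lambda>w. z w $ i)" "\<And>i. smooth_expr (\<lambda>w. cnj (z w $ i))"
    and nz: "\<And>w. z w \<noteq> 0"
  shows "smooth_expr (\<lambda>w. B_minus p A (proj (z w)))"
proof -
  have coh: "smooth_expr (\<lambda>w. coherent p (z w) i)" "smooth_expr (\<lambda>w. cnj (coherent p (z w) i))" for i
  proof -
    obtain j k l where i: "i = (j, k, l)" by (metis surj_pair)
    show "smooth_expr (\<lambda>w. coherent p (z w) i)" "smooth_expr (\<lambda>w. cnj (coherent p (z w) i))"
      by (cases "j + k + l = p"; simp add: i coherent_apply;
        intro smooth_expr.mult smooth_expr.const smooth_expr_power smooth_expr_minus z)+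
  qed
  have den: "smooth_expr (\<lambda>w. inverse (complex_of_real (norm (z w) ^ (2 * p))))"
  proof (rule smooth_expr.inverse)
    show "smooth_expr (\<lambda>w. complex_of_real (norm (z w) ^ (2 * p)))"
      unfolding norm_square_sum by (intro smooth_expr_power smooth_expr.add smooth_expr.mult z)
    show "complex_of_real (norm (z w) ^ (2 * p)) \<noteq> 0" for w using nz[of w] by simp
  qed
  show ?thesis
    unfolding B_minus_proj[OF nz] divide_inverse husimi_coherent
    by (intro smooth_expr.mult smooth_expr_sum smooth_expr.const coh den)
qed

lemma B_minus_smooth: "smooth_cp2 (B_minus p A)"
proof -
  have lin: "smooth_expr (fst :: complex \<times> complex \<Rightarrow> complex)" "smooth_expr (snd :: complex \<times> complex \<Rightarrow> complex)"
    "smooth_expr (\<lambda>w :: complex \<times> complex. cnj (fst w))" "smooth_expr (\<lambda>w :: complex \<times> complex. cnj (snd w))"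
    by (intro smooth_expr.linear bounded_linear_fst bounded_linear_snd
        bounded_linear_compose[OF bounded_linear_cnj])+
  have chart: "Ck k (\<lambda>w. B_minus p A (proj (z w)))"
    if "\<And>i. smooth_expr (\<lambda>w. z w $ i)" "\<And>i. smooth_expr (\<lambda>w. cnj (z w $ i))" "\<And>w. z w \<noteq> 0"
    for k and z :: "complex \<times> complex \<Rightarrow> complex^3"
    using that by (intro smooth_expr_Ck B_minus_smooth_chart)
  have comp: "smooth_expr (\<lambda>w. (vector [f w, g w, h w] :: complex^3) $ i)"
    "smooth_expr (\<lambda>w. cnj ((vector [f w, g w, h w] :: complex^3) $ i))"
    if "smooth_expr f" "smooth_expr g" "smooth_expr h"
      "smooth_expr (\<lambda>w. cnj (f w))" "smooth_expr (\<lambda>w. cnj (g w))" "smooth_expr (\<lambda>w. cnj (h w))"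
    for f g h :: "complex \<times> complex \<Rightarrow> complex" and i
    using that by (cases i rule: exhaust_3_cases; simp)+
  note lin' = lin smooth_expr.const[of 1] smooth_expr.const[of "cnj 1"]
  show ?thesis
    unfolding smooth_cp2_def case_prod_beta
    by (intro allI conjI chart comp lin') (simp_all add: vec_eq_iff forall_3)
qed

section \<open>The integral of a symbol\<close>

definition matrix_unit_op :: "mono \<Rightarrow> mono \<Rightarrow> operator" where
  "matrix_unit_op i j = (\<lambda>(a, b). of_bool (a = i \<and> b = j))"

lemma husimi_matrix_unit_op:
  assumes "i \<in> mono_index p" "j \<in> mono_index p"
  shows "husimi p (matrix_unit_op i j) n = cnj (coherent p n i) * coherent p n j"
proof -
  have "husimi p (matrix_unit_op i j) n =
      (\<Sum>a\<in>mono_index p. of_bool (True \<and> a = i) * 1 *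
        (\<Sum>b\<in>mono_index p. of_bool (True \<and> b = j) * 1 * (cnj (coherent p n a) * coherent p n b)))"
    unfolding husimi_coherent matrix_unit_op_def prod.case sum_distrib_left
    by (intro sum.cong refl) (simp add: of_bool_conj)
  also have "\<dots> = (\<Sum>a\<in>mono_index p. of_bool (True \<and> a = i) * 1 * (cnj (coherent p n a) * coherent p n j))"
  proof -
    have "(\<Sum>b\<in>mono_index p. of_bool (True \<and> b = j) * 1 * (c * coherent p n b)) = c * coherent p n j" for c
      by (subst sum_hop) (use assms in auto)
    then show ?thesis by (simp only:)
  qed
  also have "\<dots> = cnj (coherent p n i) * coherent p n j"
    by (subst sum_hop) (use assms in auto)
  finally show ?thesis .
qed

lemma husimi_expand:
  "husimi p A n = (\<Sum>i\<in>mono_index p. \<Sum>j\<in>mono_index p. A (i, j) * husimi p (matrix_unit_op i j) n)"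
  unfolding husimi_coherent[of p A]
  by (intro sum.cong refl) (simp add: husimi_matrix_unit_op mult_ac)

lemma B_minus_expand:
  "B_minus p A x = (\<Sum>i\<in>mono_index p. \<Sum>j\<in>mono_index p. A (i, j) * B_minus p (matrix_unit_op i j) x)"
  unfolding B_minus_def by (rule husimi_expand)

lemma continuous_husimi: "continuous_on UNIV (husimi p A)"
proof -
  have "continuous_on UNIV (\<lambda>n. coherent p n i)" for i
  proof -
    obtain j k l where i: "i = (j, k, l)" by (metis surj_pair)
    show ?thesis unfolding i coherent_apply by (cases "j + k + l = p") (auto intro!: continuous_intros)
  qed
  then show ?thesis unfolding husimi_coherent[abs_def] by (intro continuous_intros)
qed

lemma B_minus_measurable: "(\<lambda>z. B_minus p A (proj z)) \<in> borel_measurable borel"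
proof -
  \<comment> \<open>At the origin \<open>proj\<close> has an unspecified value, so that point is
    split off.\<close>
  have "(\<lambda>z. if z = 0 then B_minus p A (proj 0) else husimi p A z / of_real (norm z ^ (2 * p)))
      \<in> borel_measurable borel"
    by (intro measurable_If borel_measurable_divide borel_measurable_continuous_onI continuous_husimi
        continuous_intros) auto
  also have "(\<lambda>z. if z = 0 then B_minus p A (proj 0) else husimi p A z / of_real (norm z ^ (2 * p))) =
      (\<lambda>z. B_minus p A (proj z))"
    using B_minus_proj by fastforce
  finally show ?thesis .
qed

lemma B_minus_bounded: "\<exists>M. \<forall>x. cmod (B_minus p A x) \<le> M"
proof -
  have "compact (husimi p A ` sphere 0 1)"
    using continuous_husimi by (intro compact_continuous_image) (auto intro: continuous_on_subset)
  then obtain M where "\<And>y. y \<in> husimi p A ` sphere 0 1 \<Longrightarrow> cmod y \<le> M"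
    using compact_imp_bounded bounded_iff by metis
  then have M: "cmod (husimi p A n) \<le> M" if "norm n = 1" for n using that by auto
  have "cmod (B_minus p A x) \<le> M" for x
    by (rule unit_representative[of x]) (metis B_minus_proj_unit M)
  then show ?thesis by blast
qed

lemma B_minus_integrable: "set_integrable lborel (ball 0 1) (\<lambda>z. B_minus p A (proj z))"
proof -
  obtain M where M: "\<forall>x. cmod (B_minus p A x) \<le> M" using B_minus_bounded by blast
  show ?thesis
    unfolding set_integrable_def
  proof (rule integrableI_bounded_set_indicator)
    show "(\<lambda>z. B_minus p A (proj z)) \<in> borel_measurable lborel" using B_minus_measurable by simp
    show "emeasure lborel (ball 0 1 :: (complex^3) set) < \<infinity>" by (rule emeasure_lborel_ball_finite)
    show "AE z in lborel. z \<in> ball 0 1 \<longrightarrow> norm (B_minus p A (proj z)) \<le> M" using M by simp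
  qed auto
qed

lemma cp2_integral_B_minus:
  "cp2_integral (B_minus p A) =
    (\<Sum>i\<in>mono_index p. \<Sum>j\<in>mono_index p. A (i, j) * cp2_integral (B_minus p (matrix_unit_op i j)))"
proof -
  have "(LINT z:ball (0 :: complex^3) 1|lborel. B_minus p A (proj z)) =
      (\<Sum>i\<in>mono_index p. \<Sum>j\<in>mono_index p. A (i, j) *
        (LINT z:ball (0 :: complex^3) 1|lborel. B_minus p (matrix_unit_op i j) (proj z)))"
  proof -
    have sum: "(LINT z|lborel. (\<Sum>i\<in>mono_index p. \<Sum>j\<in>mono_index p. A (i, j) * F i j z)) =
        (\<Sum>i\<in>mono_index p. \<Sum>j\<in>mono_index p. A (i, j) * (LINT z|lborel. F i j z))"
      if "\<And>i j. integrable lborel (F i j)" for F :: "mono \<Rightarrow> mono \<Rightarrow> complex^3 \<Rightarrow> complex"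
      using that by simp
    have "integrable lborel (\<lambda>z. indicator (ball 0 1) z *\<^sub>R B_minus p (matrix_unit_op i j) (proj z))" for i j
      using B_minus_integrable[of p "matrix_unit_op i j"] by (simp only: set_integrable_def)
    from sum[OF this] show ?thesis
      unfolding B_minus_expand[of p A] set_lebesgue_integral_def scaleR_sum_right mult_scaleR_right[symmetric] .
  qed
  then show ?thesis by (simp add: cp2_integral_def sum_divide_distrib)
qed

lemma opsI: "(\<And>i j. i \<notin> I \<or> j \<notin> I \<Longrightarrow> A (i, j) = 0) \<Longrightarrow> A \<in> ops I"
  by (auto simp: cspace_def)

text \<open>This is the squared norm of the coherent state. It is invariant under the unitary
  action, and transitivity on the unit sphere reduces it to the base vector, whose coherent state is
  a basis vector up to sign.\<close>

lemma husimi_id_unit: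
  assumes "norm n = 1"
  shows "husimi p (op_id (mono_index p)) n = 1"
proof -
  have id: "husimi p (op_id (mono_index p)) m = cinner (mono_index p) (coherent p m) (coherent p m)" for m
  proof -
    have "op_apply (mono_index p) (op_id (mono_index p)) (coherent p m) i = coherent p m i" for i
      using fun_cong[OF vec_act_coherent[OF mat_1_unitary], of p m i]
      by (simp add: vec_act_def rho_mat_1)
    then have "op_apply (mono_index p) (op_id (mono_index p)) (coherent p m) = coherent p m" by (rule ext)
    then show ?thesis unfolding husimi_def coherent_def[symmetric] by (simp only:)
  qed
  obtain g where g: "g \<in> SU3" "g *v first_axis = n" using SU3_transitive[OF assms] .
  note u = SU3_unitary[OF g(1)]
  have "husimi p (op_id (mono_index p)) n =
      cinner (mono_index p) (coherent p n) (vec_act p g (coherent p first_axis))"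
    by (simp add: id vec_act_coherent[OF u] g)
  also have "\<dots> = cinner (mono_index p) (vec_act p (cadjoint g) (coherent p n)) (coherent p first_axis)"
    unfolding vec_act_def cinner_op_apply[of _ _ "rho p g"] rho_matrix_inv[OF u, symmetric]
      matrix_inv_unitary[OF u] ..
  also have "\<dots> = cinner (mono_index p) (coherent p first_axis) (coherent p first_axis)"
    by (simp add: vec_act_coherent[OF cadjoint_unitary[OF u]] g(2)[symmetric] unitary_cadjoint_mv[OF u])
  also have "\<dots> = (\<Sum>i\<in>mono_index p. of_bool (True \<and> i = (0, 0, p)) * 1 * 1)"
  proof -
    have "cnj ((-1) ^ p) * (-1) ^ p = (1 :: complex)" by (cases "even p") auto
    then show ?thesis by (simp add: cinner_def coherent_first_axis mult_ac)
  qed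
  also have "\<dots> = 1" by (subst sum_hop) auto
  finally show ?thesis .
qed

text \<open>The symbol polynomial is homogeneous of degree 2p, and since p is positive it vanishes
  at the origin too. This passes from functions on the projective plane to the polynomial identity
  that injectivity requires.\<close>

lemma husimi_scaled_unit:
  assumes "1 \<le> p" and unit: "\<And>n. norm n = 1 \<Longrightarrow> husimi p A n = 0"
  shows "husimi p A n = 0"
proof (cases "n = 0")
  case True
  then have "n = 0 *s n" by simp
  then have "husimi p A n = of_real (cmod 0 ^ (2 * p)) * husimi p A n" using husimi_scale by metis
  then show ?thesis using assms(1) by (simp add: power_0_left)
next
  case False
  let ?m = "of_real (inverse (norm n)) *s n"
  have "norm ?m = 1" using False by (simp add: norm_vector_smult norm_inverse)
  then have "husimi p A ?m = 0" by (rule unit)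
  moreover have "cmod (of_real (inverse (norm n))) \<noteq> 0" using False by simp
  ultimately show ?thesis unfolding husimi_scale mult_eq_0_iff of_real_eq_0_iff power_eq_0_iff by blast
qed

text \<open>By invariance the integral of the symbol of a coherent projection does not depend on the
  projection. Since the coherent projections span all operators, the integral is a multiple of the
  trace.\<close>

lemma cp2_integral_B_minus_trace:
  assumes p: "1 \<le> p" and A: "A \<in> ops (mono_index p)"
  shows "cp2_integral (B_minus p A) = op_trace (mono_index p) A / of_real (irrep_dim 0 p)"
proof -
  \<comment> \<open>The matrix representing the functional: with these transposed indices the
    integral of the symbol of A is the trace of A times M.\<close>
  define M where "M = (\<lambda>(j, i). if j \<in> mono_index p \<and> i \<in> mono_index p
    then cp2_integral (B_minus p (matrix_unit_op i j)) else 0)"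
  have int: "cp2_integral (B_minus p A) = (\<Sum>i\<in>mono_index p. \<Sum>j\<in>mono_index p. A (i, j) * M (j, i))" for A
    unfolding cp2_integral_B_minus[of p A] by (intro sum.cong refl) (simp add: M_def)
  define c where "c = cp2_integral (B_minus p (lowest_proj p))"
  \<comment> \<open>Reciprocity: the symbol of M at n is the trace of M against the coherent
    projection, that is, the integral of the symbol of that projection.\<close>
  have M: "husimi p M n = c" if n: "norm n = 1" for n
  proof -
    obtain g where g: "g \<in> SU3" "g *v first_axis = n" using SU3_transitive[OF n] .
    have "husimi p M n = (\<Sum>j\<in>mono_index p. \<Sum>i\<in>mono_index p. coherent_proj p n (i, j) * M (j, i))"
      unfolding husimi_coherent by (intro sum.cong refl) (simp add: coherent_proj_def mult_ac)
    also have "\<dots> = (\<Sum>i\<in>mono_index p. \<Sum>j\<in>mono_index p. coherent_proj p n (i, j) * M (j, i))"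
      by (rule sum.swap)
    also have "\<dots> = cp2_integral (B_minus p (coherent_proj p n))" by (simp only: int)
    also have "coherent_proj p n = op_act p g (lowest_proj p)"
      unfolding coherent_proj_first_axis[symmetric] op_act_coherent_proj[OF SU3_unitary[OF g(1)]] g(2) ..
    also have "cp2_integral (B_minus p (op_act p g (lowest_proj p))) =
        cp2_integral (\<lambda>x. B_minus p (lowest_proj p) (act (matrix_inv g) x))"
      unfolding B_minus_op_act[OF g(1)] ..
    also have "\<dots> = c"
      unfolding c_def matrix_inv_SU3[OF g(1)]
      by (rule cp2_integral_invariant[OF cadjoint_SU3[OF g(1)] B_minus_measurable])
    finally show ?thesis .
  qed
  \<comment> \<open>The identity has symbol 1 on unit vectors, so D has zero symbol and injectivity
    gives that M is c times the identity.\<close>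
  define D where "D = (\<lambda>x. M x - c * op_id (mono_index p) x)"
  have "D = (\<lambda>_. 0)"
  proof (rule husimi_eq_0_imp)
    have "D (i, j) = 0" if "i \<notin> mono_index p \<or> j \<notin> mono_index p" for i j
      using that by (auto simp: D_def M_def op_id_def)
    then show "D \<in> ops (mono_index p)" by (rule opsI)
    have "husimi p D n = husimi p M n - c * husimi p (op_id (mono_index p)) n" for n
      unfolding husimi_coherent D_def
      by (simp add: sum_distrib_left algebra_simps sum_subtractf)
    then have "husimi p D n = 0" if "norm n = 1" for n
      using that by (simp add: M husimi_id_unit)
    then show "husimi p D n = 0" for n by (rule husimi_scaled_unit[OF p])
  qed
  then have M_id: "M x = c * op_id (mono_index p) x" for x
    unfolding D_def by (metis eq_iff_diff_eq_0)
  have trace: "cp2_integral (B_minus p A) = c * op_trace (mono_index p) A" for A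
  proof -
    have "cp2_integral (B_minus p A) =
        (\<Sum>i\<in>mono_index p. \<Sum>j\<in>mono_index p. of_bool (True \<and> j = i) * c * A (i, j))"
      unfolding int M_id by (intro sum.cong refl) (simp add: op_id_def)
    also have "\<dots> = (\<Sum>i\<in>mono_index p. c * A (i, i))"
    proof (rule sum.cong[OF refl])
      fix i assume "i \<in> mono_index p"
      then show "(\<Sum>j\<in>mono_index p. of_bool (True \<and> j = i) * c * A (i, j)) = c * A (i, i)"
        by (subst sum_hop) auto
    qed
    finally show ?thesis by (simp add: op_trace_def sum_distrib_left)
  qed
  \<comment> \<open>The identity fixes c: its symbol integrates to the total mass 1, and its trace
    is the dimension.\<close>
  have "B_minus p (op_id (mono_index p)) = (\<lambda>_. 1)"
  proof
    fix x
    obtain n where "norm n = 1" "proj n = x" by (rule unit_representative)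
    then show "B_minus p (op_id (mono_index p)) x = 1"
      using B_minus_proj_unit husimi_id_unit by metis
  qed
  then have "c * op_trace (mono_index p) (op_id (mono_index p)) = 1"
    using trace[of "op_id (mono_index p)"] by (simp add: cp2_integral_one)
  moreover have "op_trace (mono_index p) (op_id (mono_index p)) = of_real (irrep_dim 0 p)"
    unfolding card_mono_index[symmetric] by (simp add: op_trace_def op_id_def)
  ultimately have c: "c * of_real (irrep_dim 0 p) = 1" by simp
  then have "complex_of_real (irrep_dim 0 p) \<noteq> 0" by auto
  then have "c = 1 / of_real (irrep_dim 0 p)" using c by (simp add: field_simps)
  then show ?thesis using trace[of A] by simp
qed

lemma B_minus_symbol_correspondence:
  assumes p: "1 \<le> p"
  shows "symbol_correspondence p (B_minus p)"
  unfolding symbol_correspondence_def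
proof (intro conjI ballI allI)
  show "smooth_cp2 (B_minus p A)" for A by (rule B_minus_smooth)
  show "B_minus p (\<lambda>i. a * A i + b * B i) = (\<lambda>x. a * B_minus p A x + b * B_minus p B x)" for A B a b
    unfolding B_minus_def husimi_coherent
    by (simp add: fun_eq_iff sum_distrib_left algebra_simps sum.distrib)
  show "inj_on (B_minus p) (ops (mono_index p))"
  proof (rule inj_onI)
    fix A B assume A: "A \<in> ops (mono_index p)" and B: "B \<in> ops (mono_index p)"
      and eq: "B_minus p A = B_minus p B"
    define D where "D = (\<lambda>x. 1 * (A x - B x))"
    have "D = (\<lambda>_. 0)"
    proof (rule husimi_eq_0_imp)
      show "D \<in> ops (mono_index p)" unfolding D_def using A B by (rule cspace_lin)
      have "husimi p D n = husimi p A n - husimi p B n" for n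
        unfolding husimi_coherent D_def by (simp add: algebra_simps sum_subtractf)
      then have "husimi p D n = 0" if "norm n = 1" for n
        using B_minus_proj_unit[OF that, of p] fun_cong[OF eq, of "proj n"] by simp
      then show "husimi p D n = 0" for n by (rule husimi_scaled_unit[OF p])
    qed
    then show "A = B" by (simp add: D_def fun_eq_iff)
  qed
  show "B_minus p (op_act p g A) x = B_minus p A (act (matrix_inv g) x)" if "g \<in> SU3" for A g x
    by (rule B_minus_op_act[OF that])
  show "B_minus p (op_adj A) x = cnj (B_minus p A x)" for A x
  proof -
    have "husimi p (op_adj A) n = cnj (husimi p A n)" for n
    proof -
      have "cnj (husimi p A n) =
          (\<Sum>i\<in>mono_index p. \<Sum>j\<in>mono_index p. cnj (coherent p n j) * cnj (A (i, j)) * coherent p n i)"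
        by (simp add: husimi_coherent mult_ac)
      also have "\<dots> = (\<Sum>j\<in>mono_index p. \<Sum>i\<in>mono_index p. cnj (coherent p n j) * cnj (A (i, j)) * coherent p n i)"
        by (rule sum.swap)
      finally show ?thesis by (simp add: husimi_coherent op_adj_def)
    qed
    then show ?thesis by (simp only: B_minus_def)
  qed
  show "cp2_integral (B_minus p A) = op_trace (mono_index p) A / of_real (irrep_dim 0 p)"
    if "A \<in> ops (mono_index p)" for A
    by (rule cp2_integral_B_minus_trace[OF p that])
qed

section \<open>The lowest weight projection in Gelfand-Tsetlin bases\<close>

lemma finite_gt_labels: "finite (gt_labels p q)"
proof -
  let ?I = "{0..int p + int q}"
  have "gt_labels p q \<subseteq>
      (\<lambda>(rp, rm, n3). (gt_weight p q rp rm n3, real_of_int (rp - rm) / 2)) ` (?I \<times> ?I \<times> ?I)"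
  proof
    fix x assume "x \<in> gt_labels p q"
    then obtain rp rm n3 where r: "gt_range p q rp rm n3"
      and x: "x = (gt_weight p q rp rm n3, real_of_int (rp - rm) / 2)"
      by (cases x) (auto simp: gt_labels_iff)
    have "(rp, rm, n3) \<in> ?I \<times> ?I \<times> ?I" using r by (auto simp: gt_range_def)
    then show "x \<in> (\<lambda>(rp, rm, n3). (gt_weight p q rp rm n3, real_of_int (rp - rm) / 2)) ` (?I \<times> ?I \<times> ?I)"
      unfolding x by (rule rev_image_eqI) simp
  qed
  then show ?thesis by (rule finite_subset) simp
qed

lemma op_inner_lowest_proj: "op_inner (mono_index p) A (lowest_proj p) = cnj (A ((0, 0, p), (0, 0, p)))"
proof -
  have "op_inner (mono_index p) A (lowest_proj p) =
      (\<Sum>i\<in>mono_index p. \<Sum>j\<in>mono_index p. of_bool (True \<and> i = (0, 0, p)) * of_bool (True \<and> j = (0, 0, p)) * cnj (A (j, i)))"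
    unfolding op_inner_def op_trace_def op_mult_def op_adj_def lowest_proj_def prod.case
    by (intro sum.cong refl) (simp add: of_bool_conj mult_ac)
  also have "\<dots> = (\<Sum>i\<in>mono_index p. of_bool (True \<and> i = (0, 0, p)) * 1 *
      (\<Sum>j\<in>mono_index p. of_bool (True \<and> j = (0, 0, p)) * 1 * cnj (A (j, i))))"
    by (simp only: sum_distrib_left mult_1_right mult.assoc)
  also have "\<dots> = (\<Sum>j\<in>mono_index p. of_bool (True \<and> j = (0, 0, p)) * 1 * cnj (A (j, (0, 0, p))))"
    by (subst sum_hop) auto
  also have "\<dots> = cnj (A ((0, 0, p), (0, 0, p)))" by (subst sum_hop) auto
  finally show ?thesis .
qed

text \<open>By its weight the vector with label (0, p, p) is a phase times the basis vector at (0,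
  0, p), and the phase cancels against its conjugate in the dual factor. The sign remains: (-1) to
  the power \<nu>1 - \<nu>3 = -p.\<close>

lemma gt_basis_lowest:
  assumes gt: "gt_basis p e"
  shows "op_tensor (gt_vec e (0, int p, int p)) (dual_gt_vec p e (int p, 0, 0)) = (\<lambda>x. (-1) ^ p * lowest_proj p x)"
proof -
  have fam: "gt_family (cinner (mono_index p)) (vec_act p) 0 p e"
    and sp: "\<And>\<nu> J. (\<nu>, J) \<in> gt_labels 0 p \<Longrightarrow> e \<nu> J \<in> cspace (mono_index p)"
    using gt by (auto simp: gt_basis_def)
  define v where "v = gt_elem 0 p e (int p) (int p) (int p)"
  have r: "gt_range 0 p (int p) (int p) (int p)" "gt_range 0 p (int p) 0 0" by (simp_all add: gt_range_def)
  have w: "gt_weight 0 p (int p) (int p) (int p) = (0, int p, int p)" by (simp add: gt_weight_def)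
  have v: "gt_vec e (0, int p, int p) = v" by (simp add: gt_vec_def v_def gt_elem_def w)
  have "vec_weight p (0, int p, int p) v"
    unfolding v_def w[symmetric]
  proof (rule vec_weight_gt_elem[OF fam _ r(1)])
    show "gt_elem 0 p e (int p) 0 0 \<in> cspace (mono_index p)"
      unfolding gt_elem_def by (rule sp[OF gt_elem_label[OF r(2)]])
  qed
  then have supp: "v i = 0" if "i \<noteq> (0, 0, p)" for i
    using that lowest_weight_iff[of i p] cspace_nonzero[of v "mono_index p" i] unfolding vec_weight_def by blast
  have "cinner (mono_index p) v v = 1"
    using fam gt_elem_label[OF r(1)] unfolding gt_family_def v_def gt_elem_def by fastforce
  moreover have "cinner (mono_index p) v v = (\<Sum>i\<in>mono_index p. of_bool (True \<and> i = (0, 0, p)) * 1 * (cnj (v i) * v i))"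
  proof -
    have "cnj (v i) * v i = of_bool (True \<and> i = (0, 0, p)) * 1 * (cnj (v i) * v i)" for i
      by (cases "i = (0, 0, p)") (simp_all add: supp)
    then show ?thesis unfolding cinner_def by (rule sum.cong[OF refl])
  qed
  moreover have "\<dots> = cnj (v (0, 0, p)) * v (0, 0, p)" by (subst sum_hop) auto
  ultimately have unit: "v (0, 0, p) * cnj (v (0, 0, p)) = 1" by (simp add: mult.commute)
  have sign: "(-1 :: complex) powi (- int p) = (-1) ^ p"
    by (simp add: power_int_minus flip: power_inverse)
  have dual: "dual_gt_vec p e (int p, 0, 0) = (\<lambda>i. (-1) ^ p * cnj (v i))"
    by (simp add: dual_gt_vec_def v sign)
  have "v i * ((-1) ^ p * cnj (v j)) = (-1) ^ p * lowest_proj p (i, j)" for i j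
    using unit supp[of i] supp[of j] by (auto simp: lowest_proj_def mult.left_commute)
  then show ?thesis by (auto simp: op_tensor_def v dual fun_eq_iff)
qed

section \<open>Characteristic numbers\<close>

lemma coupled_basis_family:
  assumes "coupled_basis p e E" "n \<le> p"
  shows "op_gt_family p n (E n)"
proof -
  have "\<forall>n\<le>p. gt_family (op_inner (mono_index p)) (op_act p) n n (E n) \<and>
        (\<forall>(\<nu>, J)\<in>gt_labels n n. E n \<nu> J \<in> ops (mono_index p))"
    using assms(1) unfolding coupled_basis_def by (rule conjunct1)
  then have *: "gt_family (op_inner (mono_index p)) (op_act p) n n (E n) \<and>
        (\<forall>(\<nu>, J)\<in>gt_labels n n. E n \<nu> J \<in> ops (mono_index p))"
    using assms(2) by (elim allE[of _ n] impE)
  show ?thesis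
  proof (rule op_gt_family.intro)
    show "gt_family (op_inner (mono_index p)) (op_act p) n n (E n)" using * by (rule conjunct1)
    show "E n \<nu> J \<in> ops (mono_index p)" if "(\<nu>, J) \<in> gt_labels n n" for \<nu> J
      using bspec[OF conjunct2[OF *] that] by (simp only: prod.case)
  qed
qed

lemma coupled_basis_complete:
  assumes "coupled_basis p e E" "A \<in> ops (mono_index p)"
  shows "A = (\<lambda>i. \<Sum>n\<le>p. \<Sum>(\<nu>, J)\<in>gt_labels n n. op_inner (mono_index p) (E n \<nu> J) A * E n \<nu> J i)"
  using assms(1) unfolding coupled_basis_def
  by (elim conjE) (drule (1) bspec[OF _ assms(2)])

lemma coupled_basis_real:
  assumes "coupled_basis p e E" "n \<le> p" "(\<nu>, J) \<in> gt_labels n n"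
    and "\<nu>1 \<in> fst ` gt_labels 0 p" "\<nu>2 \<in> fst ` gt_labels p 0"
  shows "clebsch_gordan p e E n \<nu>1 \<nu>2 \<nu> J \<in> \<real>"
proof -
  have "\<forall>n\<le>p. \<forall>(\<nu>, J)\<in>gt_labels n n. \<forall>\<nu>1\<in>fst ` gt_labels 0 p. \<forall>\<nu>2\<in>fst ` gt_labels p 0.
        clebsch_gordan p e E n \<nu>1 \<nu>2 \<nu> J \<in> \<real>"
    using assms(1) unfolding coupled_basis_def by (elim conjE)
  then show ?thesis using assms(2-) by fast
qed

lemma coupled_basis_zero:
  assumes "coupled_basis p e E"
  shows "E 0 (0, 0, 0) 0 = (\<lambda>i. op_id (mono_index p) i / of_real (sqrt (irrep_dim 0 p)))"
  using assms unfolding coupled_basis_def by (elim conjE)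

text \<open>Two signs (-1)^p cancel, leaving the proposed number as
  \<open>sqrt (dim / (n + 1)^3)\<close> times the conjugate of the corner entry \<open>d n\<close>.
  This root is inverse to the one in the normal form of the kernel, so the kernel sum is the
  expansion of the lowest weight projection in the coupled basis.\<close>

lemma B_minus_characteristic_numbers:
  assumes e: "gt_basis p e" and E: "coupled_basis p e E"
  shows "characteristic_numbers p E (B_minus p)
    (\<lambda>n. (-1) ^ p * of_real (sqrt (irrep_dim 0 p / real ((n + 1) ^ 3))) *
       clebsch_gordan p e E n (0, int p, int p) (int p, 0, 0) (int n, int n, int n) 0)"
proof -
  define dim where "dim = irrep_dim 0 p"
  have dim: "dim > 0" by (simp add: dim_def irrep_dim_def add_pos_nonneg)
  define d where "d n = E n (int n, int n, int n) 0 ((0, 0, p), (0, 0, p))" for n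
  let ?C = "\<lambda>n. clebsch_gordan p e E n (0, int p, int p) (int p, 0, 0) (int n, int n, int n) 0"
  have C: "?C n = (-1) ^ p * cnj (d n)" for n
  proof -
    have "op_inner (mono_index p) A (\<lambda>x. c * B x) = c * op_inner (mono_index p) A B" for A B c
      by (simp add: op_inner_def op_trace_def op_mult_def sum_distrib_left mult_ac)
    then show ?thesis
      by (simp add: clebsch_gordan_def gt_basis_lowest[OF e] op_inner_lowest_proj d_def)
  qed
  let ?c = "\<lambda>n. (-1) ^ p * of_real (sqrt (dim / real ((n + 1) ^ 3))) * ?C n"
  have c: "?c n = of_real (sqrt (dim / real ((n + 1) ^ 3))) * cnj (d n)" for n
    unfolding C by (cases "even p") simp_all
  have fam: "op_gt_family p n (E n)" if "n \<le> p" for n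
    by (rule coupled_basis_family[OF E that])
  have elem: "gt_elem n n (E n) (int n) (int n) (int n) = E n (int n, int n, int n) 0" for n
    by (simp add: gt_elem_def gt_weight_def)
  have label: "((int n, int n, int n), 0) \<in> gt_labels n n" for n
    using gt_elem_label[of n n "int n" "int n" "int n"] by (simp add: gt_range_def gt_weight_def)
  have c_real: "?c n \<in> \<real>" if "n \<le> p" for n
  proof -
    have "(0, int p, int p) \<in> fst ` gt_labels 0 p"
      using gt_elem_label[of 0 p "int p" "int p" "int p"]
      by (force simp: gt_range_def gt_weight_def)
    moreover have "(int p, 0, 0) \<in> fst ` gt_labels p 0"
      using gt_elem_label[of p 0 0 0 0] by (force simp: gt_range_def gt_weight_def)
    ultimately have "?C n \<in> \<real>" by (rule coupled_basis_real[OF E that label])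
    then show ?thesis by (intro Reals_mult Reals_power) auto
  qed
  have c_nonzero: "?c n \<noteq> 0" if "n \<le> p" for n
  proof -
    have "d n \<noteq> 0" using op_gt_family.corner_nonzero[OF fam[OF that]] unfolding elem d_def .
    then show ?thesis unfolding c using dim by simp
  qed
  \<comment> \<open>This rests on the phase convention for the coupled basis, which makes its
    element with n = 0 the positive multiple of the identity with corner entry
    \<open>1 / sqrt dim\<close>.\<close>
  have c_zero: "?c 0 = 1"
  proof -
    have "E 0 (0, 0, 0) 0 = (\<lambda>i. op_id (mono_index p) i / of_real (sqrt dim))"
      unfolding dim_def by (rule coupled_basis_zero[OF E])
    then have "d 0 = 1 / of_real (sqrt dim)" by (simp add: d_def op_id_def)
    then show ?thesis unfolding c using dim by simp
  qed
  \<comment> \<open>The inner product with the projection is the conjugate of the corner entry,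
    which by \<open>lowest_corner\<close> is zero for every label except ((n, n, n), 0).\<close>
  have sum_labels: "(\<Sum>(\<nu>, J)\<in>gt_labels n n. op_inner (mono_index p) (E n \<nu> J) (lowest_proj p) * E n \<nu> J i) =
      cnj (d n) * E n (int n, int n, int n) 0 i" if n: "n \<le> p" for n i
  proof -
    interpret F: op_gt_family p n "E n" by (rule fam[OF n])
    have zero: "E n \<nu> J ((0, 0, p), (0, 0, p)) = 0"
      if "(\<nu>, J) \<in> gt_labels n n - {((int n, int n, int n), 0)}" for \<nu> J
    proof (rule ccontr)
      assume nz: "E n \<nu> J ((0, 0, p), (0, 0, p)) \<noteq> 0"
      have "(\<nu>, J) \<in> gt_labels n n" using that by blast
      then obtain rp rm n3 where r: "gt_range n n rp rm n3" "\<nu> = gt_weight n n rp rm n3"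
        "J = real_of_int (rp - rm) / 2" unfolding gt_labels_iff by blast
      have "rp = int n \<and> rm = int n \<and> n3 = int n"
        by (rule F.lowest_corner[OF r(1)]) (use nz r(2,3) in \<open>simp add: gt_elem_def\<close>)
      then show False using that r(2,3) by (simp add: gt_weight_def)
    qed
    let ?f = "\<lambda>(\<nu>, J). op_inner (mono_index p) (E n \<nu> J) (lowest_proj p) * E n \<nu> J i"
    have "sum ?f (gt_labels n n) = ?f ((int n, int n, int n), 0) + sum ?f (gt_labels n n - {((int n, int n, int n), 0)})"
      by (rule sum.remove[OF finite_gt_labels label])
    also have "sum ?f (gt_labels n n - {((int n, int n, int n), 0)}) = 0"
    proof (rule sum.neutral, rule ballI)
      fix x assume x: "x \<in> gt_labels n n - {((int n, int n, int n), 0)}"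
      obtain \<nu> J where \<nu>: "x = (\<nu>, J)" by (rule prod.exhaust)
      show "?f x = 0"
        using zero[OF x[unfolded \<nu>]] by (simp only: \<nu> prod.case op_inner_lowest_proj complex_cnj_zero mult_zero_left)
    qed
    finally show ?thesis by (simp only: prod.case op_inner_lowest_proj d_def add_0_right)
  qed
  have "(\<lambda>i. \<Sum>n\<le>p. ?c n * of_real (sqrt (real ((n + 1) ^ 3) / dim)) * E n (int n, int n, int n) 0 i) =
      (\<lambda>i. \<Sum>n\<le>p. cnj (d n) * E n (int n, int n, int n) 0 i)"
  proof -
    have "?c n * of_real (sqrt (real ((n + 1) ^ 3) / dim)) = cnj (d n)" for n
    proof -
      have "sqrt (dim / real ((n + 1) ^ 3)) * sqrt (real ((n + 1) ^ 3) / dim) = 1"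
        using dim by (simp add: real_sqrt_mult[symmetric])
      then have "of_real (sqrt (dim / real ((n + 1) ^ 3))) * of_real (sqrt (real ((n + 1) ^ 3) / dim)) = (1 :: complex)"
        by (simp only: of_real_mult[symmetric] of_real_1)
      then have "of_real (sqrt (dim / real ((n + 1) ^ 3))) * x * of_real (sqrt (real ((n + 1) ^ 3) / dim)) = x"
        for x :: complex
        by (metis mult.commute mult.left_commute mult_1_right)
      then show ?thesis unfolding c .
    qed
    then show ?thesis by (simp only:)
  qed
  also have "\<dots> = (\<lambda>i. \<Sum>n\<le>p. \<Sum>(\<nu>, J)\<in>gt_labels n n.
      op_inner (mono_index p) (E n \<nu> J) (lowest_proj p) * E n \<nu> J i)"
    by (intro ext sum.cong refl) (simp add: sum_labels)
  also have "\<dots> = lowest_proj p"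
    by (rule coupled_basis_complete[OF E lowest_proj_in_ops, symmetric])
  finally show ?thesis
    using c_real c_nonzero c_zero B_minus_kernel[of p]
    unfolding characteristic_numbers_def dim_def by simp
qed

theorem proposition4p18:
  fixes p :: nat
  assumes "1 \<le> p"
  shows "(\<forall>A\<in>ops (mono_index p). \<forall>x n. norm n = 1 \<and> proj n = x \<longrightarrow>
            B_minus p A x =
              cinner (mono_index p) (Phi p (theta n)) (op_apply (mono_index p) A (Phi p (theta n)))) \<and>
         symbol_correspondence p (B_minus p) \<and>
         mapping_positive p (B_minus p) \<and>
         is_operator_kernel p (B_minus p) (weight_projection p (0, int p, int p)) \<and>
         (\<forall>e E. gt_basis p e \<longrightarrow> coupled_basis p e E \<longrightarrow>
            characteristic_numbers p E (B_minus p)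
              (\<lambda>n. (-1) ^ p * of_real (sqrt (irrep_dim 0 p / real ((n + 1) ^ 3))) *
                   clebsch_gordan p e E n (0, int p, int p) (int p, 0, 0) (int n, int n, int n) 0))"
proof (intro conjI ballI allI impI)
  show "B_minus p A x =
      cinner (mono_index p) (Phi p (theta n)) (op_apply (mono_index p) A (Phi p (theta n)))"
    if "norm n = 1 \<and> proj n = x" for A x n
    using that B_minus_proj_unit[of n p A] unfolding husimi_def by blast
  show "symbol_correspondence p (B_minus p)" by (rule B_minus_symbol_correspondence[OF assms])
  show "mapping_positive p (B_minus p)" by (rule B_minus_mapping_positive)
  show "is_operator_kernel p (B_minus p) (weight_projection p (0, int p, int p))"
    unfolding weight_projection_lowest by (rule B_minus_kernel)
  show "characteristic_numbers p E (B_minus p)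
      (\<lambda>n. (-1) ^ p * of_real (sqrt (irrep_dim 0 p / real ((n + 1) ^ 3))) *
         clebsch_gordan p e E n (0, int p, int p) (int p, 0, 0) (int n, int n, int n) 0)"
    if "gt_basis p e" "coupled_basis p e E" for e E
    by (rule B_minus_characteristic_numbers[OF that])
qed

end
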